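(* Let $\mathcal C$ be a class of Artin groups that is closed under taking standard parabolic subgroups and under taking amalgamated products over standard parabolic subgroups. Suppose that the parabolic intersection property and the normaliser structure property hold for all Artin groups in $\mathcal C$. If the power alternative holds for all free-of-infinity Artin groups in $\mathcal C$, then it holds for all Artin groups in $\mathcal C$.
   Context: A group $G$ satisfies the power alternative if for every $g,h\in G$ there exists an integer $n\ge 1$ such that either $g^n$ and $h^n$ commute or $\langle g^n,h^n\rangle\cong F_2$. A presentation graph is a finite simplicial graph $\Gamma$ with a label $m_{st}\in\{2,3,\dots\}$ on each edge $\{s,t\}$. The Artin group is $A_\Gamma=\langle \mathrm{Vert}(\Gamma)\mid \underbrace{sts\cdots}_{m_{st}}=\underbrace{tst\cdots}_{m_{st}}\text{ for every edge }\{s,t\}\rangle$. For $S\subseteq\mathrm{Vert}(\Gamma)$, the subgroup $A_S=\langle S\rangle$ is a standard parabolic subgroup; it is naturally isomorphic to the Artin group of the full subgraph spanned by $S$. A parabolic subgroup is a conjugate of a standard parabolic subgroup. $A_\Gamma$ is free-of-infinity if $\Gamma$ is a complete graph. Amalgamated products over standard parabolic subgroups: if $\Gamma$ is the union of full subgraphs $\Gamma_1,\Gamma_2$ with $\Gamma_1\cap\Gamma_2=\Gamma_0$, then $A_\Gamma\cong A_{\Gamma_1}*_{A_{\Gamma_0}}A_{\Gamma_2}$. Parabolic intersection property of $A_\Gamma$: for all parabolic subgroups $P,Q\le A_\Gamma$, $P\cap Q$ is a parabolic subgroup. Normaliser structure property of $A_\Gamma$: for every $S\subseteq\mathrm{Vert}(\Gamma)$,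 $N_{A_\Gamma}(A_S)=A_S\cdot \mathrm{QZ}_{A_\Gamma}(A_S)$, where $\mathrm{QZ}_{A_\Gamma}(A_S)=\{g\in A_\Gamma: gSg^{-1}=S\}$. *)

theory Defs
  imports "HOL-Algebra.Group_Action" "HOL-Algebra.Elementary_Groups"
begin

section \<open>Groups given by generators and relations\<close>

text \<open>
  A letter \<open>(x, True)\<close> stands for the generator \<open>x\<close> and \<open>(x, False)\<close> for its formal inverse.
  Elements of the presented group are classes of words in these letters modulo the least
  congruence that cancels adjacent inverse letters and identifies the two sides of every relation.
\<close>

type_synonym 'a word = "('a \<times> bool) list"

definition words :: "'a set \<Rightarrow> 'a word set" where
  "words X = lists (X \<times> UNIV)"

inductive_set pres_cong :: "'a set \<Rightarrow> ('a word \<times> 'a word) set \<Rightarrow> ('a word \<times> 'a word) set"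
  for X :: "'a set" and R :: "('a word \<times> 'a word) set"
where
  refl: "u \<in> words X \<Longrightarrow> (u, u) \<in> pres_cong X R"
| sym: "(u, v) \<in> pres_cong X R \<Longrightarrow> (v, u) \<in> pres_cong X R"
| trans: "(u, v) \<in> pres_cong X R \<Longrightarrow> (v, w) \<in> pres_cong X R \<Longrightarrow> (u, w) \<in> pres_cong X R"
| append: "(u, u') \<in> pres_cong X R \<Longrightarrow> (v, v') \<in> pres_cong X R
    \<Longrightarrow> (u @ v, u' @ v') \<in> pres_cong X R"
| cancel: "x \<in> X \<Longrightarrow> ([(x, b), (x, \<not> b)], []) \<in> pres_cong X R"
| relation: "(u, v) \<in> R \<Longrightarrow> u \<in> words X \<Longrightarrow> v \<in> words X \<Longrightarrow> (u, v) \<in> pres_cong X R"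

definition presented_group :: "'a set \<Rightarrow> ('a word \<times> 'a word) set \<Rightarrow> 'a word set monoid" where
  "presented_group X R =
    \<lparr> carrier = words X // pres_cong X R,
      mult = (\<lambda>A B. \<Union>u\<in>A. \<Union>v\<in>B. pres_cong X R `` {u @ v}),
      one = pres_cong X R `` {[]} \<rparr>"

lemma pres_cong_words: "(u, v) \<in> pres_cong X R \<Longrightarrow> u \<in> words X \<and> v \<in> words X"
  by (induction rule: pres_cong.induct) (auto simp: words_def)

lemma equiv_pres_cong: "equiv (words X) (pres_cong X R)"
  by (rule equivI)
     (auto simp: refl_on_def sym_def trans_def
           dest: pres_cong_words intro: pres_cong.refl pres_cong.sym pres_cong.trans)

lemma presented_group_mult:
  assumes "u \<in> words X" "v \<in> words X"
  shows "pres_cong X R `` {u} \<otimes>\<^bsub>presented_group X R\<^esub> pres_cong X R `` {v} =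
    pres_cong X R `` {u @ v}"
proof -
  have eq: "pres_cong X R `` {u' @ v'} = pres_cong X R `` {u @ v}"
    if "u' \<in> pres_cong X R `` {u}" "v' \<in> pres_cong X R `` {v}" for u' v'
    using that by (intro equiv_class_eq[OF equiv_pres_cong, symmetric] pres_cong.append) auto
  have ne: "pres_cong X R `` {u} \<noteq> {}" "pres_cong X R `` {v} \<noteq> {}"
    using assms pres_cong.refl by blast+
  have "(\<Union>u'\<in>pres_cong X R `` {u}. \<Union>v'\<in>pres_cong X R `` {v}. pres_cong X R `` {u' @ v'}) =
      (\<Union>u'\<in>pres_cong X R `` {u}. \<Union>v'\<in>pres_cong X R `` {v}. pres_cong X R `` {u @ v})"
    by (intro SUP_cong HOL.refl eq)
  also have "\<dots> = pres_cong X R `` {u @ v}"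
    using ne by simp
  finally show ?thesis by (simp add: presented_group_def)
qed

lemma group_presented_group: "group (presented_group X R)"
proof -
  let ?G = "presented_group X R" and ?c = "\<lambda>u. pres_cong X R `` {u}"
  have carrier: "carrier ?G = ?c ` words X"
    by (auto simp: presented_group_def quotient_def)
  have one: "\<one>\<^bsub>?G\<^esub> = ?c []" by (simp add: presented_group_def)
  have nil: "[] \<in> words X" by (simp add: words_def)
  have app: "u @ v \<in> words X" if "u \<in> words X" "v \<in> words X" for u v
    using that by (simp add: words_def)
  have left_inv: "\<exists>v\<in>words X. (v @ u, []) \<in> pres_cong X R" if "u \<in> words X" for u
    using that unfolding words_def
  proof (induction u)
    case Nil
    show ?case using pres_cong.refl[OF nil] by (intro bexI[of _ "[]"]) auto
  next
    case (Cons a u)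
    obtain x b where a: "a = (x, b)" by (cases a)
    from Cons have x: "x \<in> X" and u: "u \<in> words X" by (auto simp: a words_def)
    from Cons.IH obtain v where v: "v \<in> words X" "(v @ u, []) \<in> pres_cong X R"
      by (auto simp: words_def)
    have "([(x, \<not> b), (x, b)], []) \<in> pres_cong X R"
      using pres_cong.cancel[OF x, of "\<not> b"] by simp
    from pres_cong.append[OF pres_cong.refl[OF v(1)] pres_cong.append[OF this pres_cong.refl[OF u]]]
    have "(v @ [(x, \<not> b)] @ a # u, v @ u) \<in> pres_cong X R" by (simp add: a)
    from pres_cong.trans[OF this v(2)] show ?case
      using v(1) x by (intro bexI[of _ "v @ [(x, \<not> b)]"]) (auto simp: words_def)
  qed
  show ?thesis
  proof (rule groupI)
    fix A assume "A \<in> carrier ?G"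
    then obtain u where u: "u \<in> words X" "A = ?c u" by (auto simp: carrier)
    from left_inv[OF u(1)] obtain v
      where v: "v \<in> words X" "(v @ u, []) \<in> pres_cong X R" by blast
    have "?c v \<otimes>\<^bsub>?G\<^esub> A = \<one>\<^bsub>?G\<^esub>"
      using equiv_class_eq[OF equiv_pres_cong v(2)] u v by (simp add: presented_group_mult one)
    then show "\<exists>B\<in>carrier ?G. B \<otimes>\<^bsub>?G\<^esub> A = \<one>\<^bsub>?G\<^esub>" using v by (auto simp: carrier)
  qed (auto simp: carrier one presented_group_mult app nil)
qed


section \<open>The power alternative\<close>

definition free_group :: "'a set \<Rightarrow> 'a word set monoid" where
  "free_group X = presented_group X {}"

abbreviation F\<^sub>2 :: "bool word set monoid" where
  "F\<^sub>2 \<equiv> free_group (UNIV :: bool set)"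

definition power_alternative :: "('g, 'm) monoid_scheme \<Rightarrow> bool" where
  "power_alternative G \<longleftrightarrow>
    (\<forall>g\<in>carrier G. \<forall>h\<in>carrier G. \<exists>n::nat. n \<ge> 1 \<and>
      (g [^]\<^bsub>G\<^esub> n \<otimes>\<^bsub>G\<^esub> h [^]\<^bsub>G\<^esub> n = h [^]\<^bsub>G\<^esub> n \<otimes>\<^bsub>G\<^esub> g [^]\<^bsub>G\<^esub> n \<or>
       subgroup_generated G {g [^]\<^bsub>G\<^esub> n, h [^]\<^bsub>G\<^esub> n} \<cong> F\<^sub>2))"


section \<open>Presentation graphs and Artin groups\<close>

text \<open>
  The edges of a presentation graph are the two-element sets on which the partial map \<open>label\<close>
  is defined.
\<close>

record 'a pgraph =
  verts :: "'a set"
  label :: "'a set \<rightharpoonup> nat"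

definition edges :: "'a pgraph \<Rightarrow> 'a set set" where
  "edges \<Gamma> = dom (label \<Gamma>)"

definition presentation_graph :: "'a pgraph \<Rightarrow> bool" where
  "presentation_graph \<Gamma> \<longleftrightarrow>
    finite (verts \<Gamma>) \<and>
    (\<forall>e\<in>edges \<Gamma>. e \<subseteq> verts \<Gamma> \<and> card e = 2) \<and>
    (\<forall>m\<in>ran (label \<Gamma>). m \<ge> 2)"

definition full_subgraph :: "'a pgraph \<Rightarrow> 'a set \<Rightarrow> 'a pgraph" where
  "full_subgraph \<Gamma> S = \<lparr> verts = S, label = label \<Gamma> |` Pow S \<rparr>"

definition free_of_infinity :: "'a pgraph \<Rightarrow> bool" where
  "free_of_infinity \<Gamma> \<longleftrightarrow> (\<forall>s\<in>verts \<Gamma>. \<forall>t\<in>verts \<Gamma>. s \<noteq> t \<longrightarrow> {s, t} \<in> edges \<Gamma>)"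

fun alternating :: "nat \<Rightarrow> 'a \<Rightarrow> 'a \<Rightarrow> 'a word" where
  "alternating 0 s t = []"
| "alternating (Suc n) s t = (s, True) # alternating n t s"

definition artin_relations :: "'a pgraph \<Rightarrow> ('a word \<times> 'a word) set" where
  "artin_relations \<Gamma> =
    {(alternating m s t, alternating m t s) | m s t. label \<Gamma> {s, t} = Some m}"

definition artin_group :: "'a pgraph \<Rightarrow> 'a word set monoid" where
  "artin_group \<Gamma> = presented_group (verts \<Gamma>) (artin_relations \<Gamma>)"

definition artin_gen :: "'a pgraph \<Rightarrow> 'a \<Rightarrow> 'a word set" where
  "artin_gen \<Gamma> s = pres_cong (verts \<Gamma>) (artin_relations \<Gamma>) `` {[(s, True)]}"


section \<open>Parabolic subgroups\<close>

definition standard_parabolic :: "'a pgraph \<Rightarrow> 'a set \<Rightarrow> 'a word set set" where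
  "standard_parabolic \<Gamma> S = generate (artin_group \<Gamma>) (artin_gen \<Gamma> ` S)"

definition conjugate :: "('g, 'm) monoid_scheme \<Rightarrow> 'g \<Rightarrow> 'g set \<Rightarrow> 'g set" where
  "conjugate G g H = g <#\<^bsub>G\<^esub> H #>\<^bsub>G\<^esub> inv\<^bsub>G\<^esub> g"

definition parabolic :: "'a pgraph \<Rightarrow> 'a word set set \<Rightarrow> bool" where
  "parabolic \<Gamma> P \<longleftrightarrow>
    (\<exists>S\<subseteq>verts \<Gamma>. \<exists>g\<in>carrier (artin_group \<Gamma>).
      P = conjugate (artin_group \<Gamma>) g (standard_parabolic \<Gamma> S))"

definition parabolic_intersection_property :: "'a pgraph \<Rightarrow> bool" where
  "parabolic_intersection_property \<Gamma> \<longleftrightarrow>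
    (\<forall>P Q. parabolic \<Gamma> P \<and> parabolic \<Gamma> Q \<longrightarrow> parabolic \<Gamma> (P \<inter> Q))"

definition QZ :: "'a pgraph \<Rightarrow> 'a set \<Rightarrow> 'a word set set" where
  "QZ \<Gamma> S = {g \<in> carrier (artin_group \<Gamma>).
    conjugate (artin_group \<Gamma>) g (artin_gen \<Gamma> ` S) = artin_gen \<Gamma> ` S}"

definition normaliser_structure_property :: "'a pgraph \<Rightarrow> bool" where
  "normaliser_structure_property \<Gamma> \<longleftrightarrow>
    (\<forall>S\<subseteq>verts \<Gamma>. normalizer (artin_group \<Gamma>) (standard_parabolic \<Gamma> S) =
      standard_parabolic \<Gamma> S <#>\<^bsub>artin_group \<Gamma>\<^esub> QZ \<Gamma> S)"


section \<open>Closure properties of classes of Artin groups\<close>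

text \<open>
  A class of Artin groups is given as a set of presentation graphs, since standard parabolic
  subgroups depend on the presentation.  The subgroup \<open>A\<^sub>S\<close> is represented by the Artin group of
  the full subgraph spanned by \<open>S\<close>, to which it is naturally isomorphic.
\<close>

definition closed_under_standard_parabolics :: "'a pgraph set \<Rightarrow> bool" where
  "closed_under_standard_parabolics \<C> \<longleftrightarrow>
    (\<forall>\<Gamma>\<in>\<C>. \<forall>S\<subseteq>verts \<Gamma>. full_subgraph \<Gamma> S \<in> \<C>)"

text \<open>
  If \<open>\<Gamma>\<close> is the union of its full subgraphs on \<open>S\<^sub>1\<close> and \<open>S\<^sub>2\<close>, then these meet in the full
  subgraph on \<open>S\<^sub>1 \<inter> S\<^sub>2\<close>, and the Artin group of \<open>\<Gamma>\<close> is the amalgamated product of the two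
  Artin groups over the standard parabolic subgroup on \<open>S\<^sub>1 \<inter> S\<^sub>2\<close>.
\<close>

definition closed_under_parabolic_amalgams :: "'a pgraph set \<Rightarrow> bool" where
  "closed_under_parabolic_amalgams \<C> \<longleftrightarrow>
    (\<forall>\<Gamma> S\<^sub>1 S\<^sub>2. presentation_graph \<Gamma> \<and>
      verts \<Gamma> = S\<^sub>1 \<union> S\<^sub>2 \<and>
      edges \<Gamma> = edges (full_subgraph \<Gamma> S\<^sub>1) \<union> edges (full_subgraph \<Gamma> S\<^sub>2) \<and>
      full_subgraph \<Gamma> S\<^sub>1 \<in> \<C> \<and> full_subgraph \<Gamma> S\<^sub>2 \<in> \<C> \<longrightarrow> \<Gamma> \<in> \<C>)"

end

theory Submission
  imports Defs Complex_Main
begin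

text \<open>
  If \<open>s\<close> and \<open>t\<close> span no edge, then \<open>A\<^sub>\<Gamma>\<close> is an amalgam of the standard parabolic subgroups on the
  complements of \<open>t\<close> and of \<open>s\<close>, so it acts on a tree whose vertex stabilisers lie in conjugates of
  these; by induction the power alternative holds in them.  For two elements of a group acting on a
  tree, ping-pong yields a free group generated by powers, unless powers have a common fixed vertex
  or there is a ray translated by \<open>h\<close>, say, along which powers of \<open>g\<close> agree with powers of \<open>h\<close> on
  every finite segment.  In the case of a ray, the parabolic intersection property and the
  descending chain condition for parabolic subgroups show that the stabiliser \<open>P\<close> of the ray is
  parabolic, that \<open>h\<close> normalises \<open>P\<close>, and that \<open>g\<^sup>a \<in> h\<^sup>b P\<close> with \<open>a \<ge> 1\<close>.  By the normaliser
  structure property a power of \<open>h\<close> is \<open>u z\<close> with \<open>u \<in> P\<close> and \<open>z\<close> centralising \<open>P\<close>, which reduces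
  the claim to the power alternative in \<open>P\<close>.

  The descending chain condition and the embedding of the Artin groups of full subgraphs come from
  an action of \<open>A\<^sub>\<Gamma>\<close> on pairs of a minimal coset representative of the Coxeter group modulo
  \<open>W\<^sub>T\<close> and an element of \<open>A\<^sub>T\<close>, where a generator moves the representative or, if it fixes the
  coset, multiplies the element of \<open>A\<^sub>T\<close> by the corresponding generator.
\<close>

section \<open>Words in groups\<close>

text \<open>The obstacle is a lack of uniformity. When g is elliptic, the fixed sets of its powers
  may grow along the axis of h without any single power fixing a whole ray, so powers of g and h are
  only known to agree on each initial segment, with exponents depending on the segment. The chain
  condition repairs this: the stabilisers along the ray intersect in P after finitely many vertices,
  and agreement on that many vertices already puts a power of g into a coset of P.

  Shifting the ray gives only an inclusion of a conjugate of P in P. It is an equality because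
  nested parabolic subgroups of equal rank coincide.

  The centralising element arises since an element of \<open>QZ\<close> permutes the finite set of
  standard generators, so some power of it fixes each of them. Suitable powers of g and h are then
  elements of P multiplied by powers of one element z that commutes with P. Such a twist preserves
  commutation, and it preserves freeness because a free group of rank two has trivial centre and its
  relators have exponent sums zero.\<close>

lemma words_Nil [simp]: "[] \<in> words X"
  by (simp add: words_def)

lemma words_Cons [simp]: "l # w \<in> words X \<longleftrightarrow> fst l \<in> X \<and> w \<in> words X"
  by (cases l) (simp add: words_def)

lemma words_append [simp]: "u @ v \<in> words X \<longleftrightarrow> u \<in> words X \<and> v \<in> words X"
  by (simp add: words_def)

abbreviation pres_class :: "'a set \<Rightarrow> ('a word \<times> 'a word) set \<Rightarrow> 'a word \<Rightarrow> 'a word set" where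
  "pres_class X R w \<equiv> pres_cong X R `` {w}"

lemma carrier_presented_group: "carrier (presented_group X R) = pres_class X R ` words X"
  by (auto simp: presented_group_def quotient_def)

lemma one_presented_group: "\<one>\<^bsub>presented_group X R\<^esub> = pres_class X R []"
  by (simp add: presented_group_def)

lemma pres_class_eq_iff:
  "u \<in> words X \<Longrightarrow> v \<in> words X \<Longrightarrow> pres_class X R u = pres_class X R v \<longleftrightarrow> (u, v) \<in> pres_cong X R"
  by (rule eq_equiv_class_iff[OF equiv_pres_cong])

primrec weval :: "('g, 'm) monoid_scheme \<Rightarrow> ('a \<Rightarrow> 'g) \<Rightarrow> 'a word \<Rightarrow> 'g" where
  "weval G f [] = \<one>\<^bsub>G\<^esub>"
| "weval G f (l # w) = (if snd l then f (fst l) else inv\<^bsub>G\<^esub> f (fst l)) \<otimes>\<^bsub>G\<^esub> weval G f w"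

definition inverse_word :: "'a word \<Rightarrow> 'a word" where
  "inverse_word w = rev (map (\<lambda>(x, b). (x, \<not> b)) w)"

lemma inverse_word_in_words [simp]: "inverse_word w \<in> words X \<longleftrightarrow> w \<in> words X"
  by (induction w) (auto simp: inverse_word_def)

context group
begin

lemma commute_inv:
  assumes "x \<in> carrier G" "y \<in> carrier G" "x \<otimes> y = y \<otimes> x"
  shows "x \<otimes> inv y = inv y \<otimes> x"
proof -
  have "x \<otimes> inv y = inv y \<otimes> (y \<otimes> x) \<otimes> inv y"
    using assms(1,2) by (simp add: m_assoc[symmetric])
  also have "\<dots> = inv y \<otimes> x"
    using assms(1,2) by (simp add: assms(3)[symmetric] m_assoc)
  finally show ?thesis .
qed

lemma commute_mult:
  assumes "x \<in> carrier G" "u \<in> carrier G" "v \<in> carrier G" "x \<otimes> u = u \<otimes> x" "x \<otimes> v = v \<otimes> x"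
  shows "x \<otimes> (u \<otimes> v) = (u \<otimes> v) \<otimes> x"
proof -
  have "x \<otimes> (u \<otimes> v) = u \<otimes> (x \<otimes> v)"
    using assms(1-3) by (simp add: m_assoc[symmetric] assms(4))
  also have "\<dots> = (u \<otimes> v) \<otimes> x"
    using assms(1-3) by (simp add: m_assoc assms(5))
  finally show ?thesis .
qed

lemma commute_int_pow:
  assumes "x \<in> carrier G" "y \<in> carrier G" "x \<otimes> y = y \<otimes> x"
  shows "x \<otimes> y [^] (k :: int) = y [^] k \<otimes> x"
proof -
  have *: "x \<otimes> y [^] (n :: nat) = y [^] n \<otimes> x" for n
    using group_commutes_pow[OF assms(3)[symmetric] assms(2,1)] by metis
  obtain n where "k = int n \<or> k = - int n" by (cases k rule: int_cases2) auto
  then show ?thesis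
  proof
    assume "k = - int n"
    then show ?thesis using commute_inv[OF assms(1) _ *[of n]] assms(2)
      by (simp only: int_pow_neg int_pow_int nat_pow_closed)
  qed (simp only: int_pow_int *)
qed

lemma weval_closed [simp]: "f ` X \<subseteq> carrier G \<Longrightarrow> w \<in> words X \<Longrightarrow> weval G f w \<in> carrier G"
  by (induction w) auto

lemma weval_append:
  "f ` X \<subseteq> carrier G \<Longrightarrow> u \<in> words X \<Longrightarrow> v \<in> words X \<Longrightarrow>
    weval G f (u @ v) = weval G f u \<otimes> weval G f v"
proof (induction u)
  case (Cons l u)
  then have "f (fst l) \<in> carrier G" "weval G f u \<in> carrier G" "weval G f v \<in> carrier G"
    by (auto intro: weval_closed)
  with Cons show ?case by (auto simp: m_assoc)
qed simp

lemma weval_inverse_word: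
  "f ` X \<subseteq> carrier G \<Longrightarrow> w \<in> words X \<Longrightarrow> weval G f (inverse_word w) = inv (weval G f w)"
proof (induction w)
  case (Cons l w)
  obtain x b where l: "l = (x, b)" by (cases l)
  have *: "f x \<in> carrier G" "weval G f w \<in> carrier G" "w \<in> words X" "x \<in> X"
    using Cons by (auto simp: l)
  have "weval G f (inverse_word (l # w)) = weval G f (inverse_word w @ [(x, \<not> b)])"
    by (simp add: inverse_word_def l)
  also have "\<dots> = inv (weval G f w) \<otimes> weval G f [(x, \<not> b)]"
    using Cons * by (subst weval_append[of f X]) auto
  also have "\<dots> = inv (weval G f (l # w))"
    using * by (auto simp: l inv_mult_group)
  finally show ?case .
qed (simp add: inverse_word_def)

lemma generate_eq_weval:
  assumes "f ` X \<subseteq> carrier G"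
  shows "generate G (f ` X) = weval G f ` words X"
proof
  show "generate G (f ` X) \<subseteq> weval G f ` words X"
  proof
    fix g assume "g \<in> generate G (f ` X)"
    then show "g \<in> weval G f ` words X"
    proof induction
      case one show ?case by (intro image_eqI[of _ _ "[]"]) auto
    next
      case (incl h)
      then obtain x where x: "x \<in> X" "h = f x" by blast
      then have "f x \<in> carrier G" using assms by blast
      with x show ?case by (intro image_eqI[of _ _ "[(x, True)]"]) auto
    next
      case (inv h)
      then obtain x where x: "x \<in> X" "h = f x" by blast
      then have "f x \<in> carrier G" using assms by blast
      with x show ?case by (intro image_eqI[of _ _ "[(x, False)]"]) auto
    next
      case (eng h1 h2)
      then obtain u v where "u \<in> words X" "v \<in> words X" "h1 = weval G f u" "h2 = weval G f v"
        by blast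
      then show ?case using weval_append[OF assms] by (intro image_eqI[of _ _ "u @ v"]) auto
    qed
  qed
  have "weval G f w \<in> generate G (f ` X)" if "w \<in> words X" for w
    using that
  proof (induction w)
    case (Cons l w)
    then show ?case by (auto intro: generate.eng generate.incl generate.inv)
  qed (simp add: generate.one)
  then show "weval G f ` words X \<subseteq> generate G (f ` X)" by blast
qed

lemma weval_pres_cong:
  assumes "f ` X \<subseteq> carrier G"
    and "\<And>u v. (u, v) \<in> R \<Longrightarrow> u \<in> words X \<Longrightarrow> v \<in> words X \<Longrightarrow> weval G f u = weval G f v"
    and "(u, v) \<in> pres_cong X R"
  shows "weval G f u = weval G f v"
  using assms(3)
proof (induction rule: pres_cong.induct)
  case (append u u' v v')
  then show ?case using pres_cong_words weval_append[OF assms(1)] by metis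
next
  case (cancel x b)
  then have "f x \<in> carrier G" using assms(1) by blast
  then show ?case by auto
qed (use assms(2) in auto)

end

lemma weval_presented_group:
  assumes "w \<in> words X"
  shows "weval (presented_group X R) (\<lambda>x. pres_class X R [(x, True)]) w = pres_class X R w"
proof -
  interpret group "presented_group X R" by (rule group_presented_group)
  have inv: "inv\<^bsub>presented_group X R\<^esub> (pres_class X R [(x, True)]) = pres_class X R [(x, False)]"
    if "x \<in> X" for x
  proof (rule inv_equality)
    have "([(x, False), (x, True)], []) \<in> pres_cong X R"
      using pres_cong.cancel[OF that, of False] by simp
    then show "pres_class X R [(x, False)] \<otimes>\<^bsub>presented_group X R\<^esub> pres_class X R [(x, True)]
        = \<one>\<^bsub>presented_group X R\<^esub>"
      using that by (simp add: presented_group_mult one_presented_group pres_class_eq_iff)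
  qed (use that in \<open>auto simp: carrier_presented_group\<close>)
  show ?thesis using assms
  proof (induction w)
    case (Cons l w)
    then show ?case
      using inv presented_group_mult[of "[l]" X w R] by (cases l) auto
  qed (simp add: one_presented_group)
qed

lemma presented_group_generators:
  "(\<lambda>x. pres_class X R [(x, True)]) ` X \<subseteq> carrier (presented_group X R)"
  by (auto simp: carrier_presented_group)

text \<open>Two words have equal values iff the first followed by the inverse of the second is a
  relator, so sending the value of a word under f to its value under f' is well defined and
  injective. Freeness of subgroups is always transported in this way.\<close>

lemma iso_of_same_relators:
  assumes G: "group G" and G': "group G'"
    and f: "f ` X \<subseteq> carrier G" and f': "f' ` X \<subseteq> carrier G'"
    and rel: "\<And>w. w \<in> words X \<Longrightarrow> weval G f w = \<one>\<^bsub>G\<^esub> \<longleftrightarrow> weval G' f' w = \<one>\<^bsub>G'\<^esub>"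
  shows "subgroup_generated G (f ` X) \<cong> subgroup_generated G' (f' ` X)"
proof -
  interpret G: group G by fact
  interpret G': group G' by fact
  have eq: "weval G f u = weval G f v \<longleftrightarrow> weval G' f' u = weval G' f' v"
    if "u \<in> words X" "v \<in> words X" for u v
  proof -
    have "weval G f u = weval G f v \<longleftrightarrow> weval G f (u @ inverse_word v) = \<one>\<^bsub>G\<^esub>"
      using that f G.inv_solve_right'[of "\<one>\<^bsub>G\<^esub>" "weval G f u" "weval G f v"]
      by (auto simp: G.weval_append[OF f] G.weval_inverse_word[OF f])
    also have "\<dots> \<longleftrightarrow> weval G' f' (u @ inverse_word v) = \<one>\<^bsub>G'\<^esub>"
      using that by (intro rel) simp
    also have "\<dots> \<longleftrightarrow> weval G' f' u = weval G' f' v"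
      using that f' G'.inv_solve_right'[of "\<one>\<^bsub>G'\<^esub>" "weval G' f' u" "weval G' f' v"]
      by (auto simp: G'.weval_append[OF f'] G'.weval_inverse_word[OF f'])
    finally show ?thesis .
  qed
  have car: "carrier (subgroup_generated G (f ` X)) = weval G f ` words X"
    "carrier (subgroup_generated G' (f' ` X)) = weval G' f' ` words X"
    using f f' by (simp_all add: carrier_subgroup_generated Int_absorb1
        G.generate_eq_weval G'.generate_eq_weval)
  define \<phi> where "\<phi> g = weval G' f' (SOME w. w \<in> words X \<and> weval G f w = g)" for g
  have \<phi>: "\<phi> (weval G f w) = weval G' f' w" if "w \<in> words X" for w
  proof -
    have "\<exists>v. v \<in> words X \<and> weval G f v = weval G f w" using that by blast
    from someI_ex[OF this] show ?thesis
      using that eq unfolding \<phi>_def by blast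
  qed
  have "\<phi> \<in> iso (subgroup_generated G (f ` X)) (subgroup_generated G' (f' ` X))"
    unfolding iso_def bij_betw_def
  proof (intro CollectI conjI)
    show "\<phi> \<in> hom (subgroup_generated G (f ` X)) (subgroup_generated G' (f' ` X))"
    proof (rule homI)
      fix x y assume "x \<in> carrier (subgroup_generated G (f ` X))"
        "y \<in> carrier (subgroup_generated G (f ` X))"
      then obtain u v where uv: "u \<in> words X" "v \<in> words X" "x = weval G f u" "y = weval G f v"
        by (auto simp: car)
      then show "\<phi> (x \<otimes>\<^bsub>subgroup_generated G (f ` X)\<^esub> y) =
          \<phi> x \<otimes>\<^bsub>subgroup_generated G' (f' ` X)\<^esub> \<phi> y"
        using \<phi>[of "u @ v"] by (simp add: \<phi> G.weval_append[OF f] G'.weval_append[OF f'])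
    qed (auto simp: car \<phi>)
    show "inj_on \<phi> (carrier (subgroup_generated G (f ` X)))"
      unfolding car by (rule inj_onI) (auto simp: \<phi> eq)
    show "\<phi> ` carrier (subgroup_generated G (f ` X)) = carrier (subgroup_generated G' (f' ` X))"
      unfolding car image_image by (rule image_cong) (auto simp: \<phi>)
  qed
  then show ?thesis by (auto simp: is_iso_def)
qed


section \<open>The free group of rank two\<close>

definition cancels :: "'a \<times> bool \<Rightarrow> 'a \<times> bool \<Rightarrow> bool" where
  "cancels l k \<longleftrightarrow> fst l = fst k \<and> snd l \<noteq> snd k"

abbreviation reduced_word :: "'a word \<Rightarrow> bool" where
  "reduced_word \<equiv> successively (\<lambda>l k. \<not> cancels l k)"

definition reduce_Cons :: "'a \<times> bool \<Rightarrow> 'a word \<Rightarrow> 'a word" where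
  "reduce_Cons l w = (if w \<noteq> [] \<and> cancels l (hd w) then tl w else l # w)"

lemma reduced_reduce_Cons: "reduced_word w \<Longrightarrow> reduced_word (reduce_Cons l w)"
  by (cases w) (auto simp: reduce_Cons_def successively_Cons)

lemma reduce_Cons_cancel:
  assumes "reduced_word w"
  shows "reduce_Cons (x, b) (reduce_Cons (x, \<not> b) w) = w"
proof (cases "w \<noteq> [] \<and> cancels (x, \<not> b) (hd w)")
  case True
  then obtain w' where w: "w = (x, b) # w'"
    by (cases w; cases "hd w") (auto simp: cancels_def)
  with assms have "\<not> (w' \<noteq> [] \<and> cancels (x, b) (hd w'))"
    by (auto simp: successively_Cons)
  with w show ?thesis by (auto simp: reduce_Cons_def cancels_def)
qed (auto simp: reduce_Cons_def cancels_def)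

lemma reduced_foldr_reduce_Cons: "reduced_word w \<Longrightarrow> reduced_word (foldr reduce_Cons u w)"
  by (induction u) (auto intro: reduced_reduce_Cons)

lemma foldr_reduce_Cons_reduced: "reduced_word u \<Longrightarrow> foldr reduce_Cons u [] = u"
  by (induction u) (auto simp: successively_Cons reduce_Cons_def)

text \<open>Van der Waerden's argument: letters act on reduced words, opposite letters inversely to
  each other, so congruent words act equally. Acting on the empty word then separates reduced
  words.\<close>

lemma free_cong_foldr:
  "(u, v) \<in> pres_cong X {} \<Longrightarrow> reduced_word w \<Longrightarrow> foldr reduce_Cons u w = foldr reduce_Cons v w"
proof (induction arbitrary: w rule: pres_cong.induct)
  case (append u u' v v')
  then show ?case using reduced_foldr_reduce_Cons[of w v'] by simp
qed (auto simp: reduce_Cons_cancel)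

lemma free_cong_reduced_eq:
  "(u, v) \<in> pres_cong X {} \<Longrightarrow> reduced_word u \<Longrightarrow> reduced_word v \<Longrightarrow> u = v"
  using free_cong_foldr[of u v X "[]"] by (simp add: foldr_reduce_Cons_reduced)

lemma ex_reduced_word:
  "w \<in> words X \<Longrightarrow> \<exists>v. reduced_word v \<and> (w, v) \<in> pres_cong X R"
proof (induction w)
  case Nil
  then show ?case by (intro exI[of _ "[]"]) (auto intro: pres_cong.refl)
next
  case (Cons l w)
  obtain x b where l: "l = (x, b)" by (cases l)
  from Cons l obtain v where v: "reduced_word v" "(w, v) \<in> pres_cong X R" and x: "x \<in> X" by auto
  have lw: "(l # w, l # v) \<in> pres_cong X R"
    using pres_cong.append[OF pres_cong.refl v(2), of "[l]"] x l by auto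
  have "(l # v, reduce_Cons l v) \<in> pres_cong X R"
  proof (cases "v \<noteq> [] \<and> cancels l (hd v)")
    case True
    then obtain v' where v': "v = (x, \<not> b) # v'"
      by (cases v; cases "hd v") (auto simp: cancels_def l)
    then have "v' \<in> words X" using v pres_cong_words by fastforce
    from pres_cong.append[OF pres_cong.cancel[OF x, of b] pres_cong.refl[OF this]]
    show ?thesis using True by (simp add: reduce_Cons_def v' l cancels_def)
  next
    case False
    then have "reduce_Cons l v = l # v" by (auto simp: reduce_Cons_def)
    then show ?thesis using pres_cong_words[OF lw] pres_cong.refl by metis
  qed
  then show ?case using reduced_reduce_Cons[OF v(1)] pres_cong.trans[OF lw] by blast
qed

abbreviation free_gen :: "bool \<Rightarrow> bool word set" where
  "free_gen x \<equiv> pres_class UNIV {} [(x, True)]"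

lemma group_F2: "group F\<^sub>2"
  by (simp add: free_group_def group_presented_group)

lemma weval_F2: "weval F\<^sub>2 free_gen w = pres_class UNIV {} w"
  unfolding free_group_def by (rule weval_presented_group) (simp add: words_def)

lemma free_gen_closed: "free_gen ` UNIV \<subseteq> carrier F\<^sub>2"
  unfolding free_group_def by (rule presented_group_generators)

lemma carrier_F2: "carrier F\<^sub>2 = range (pres_class UNIV {})"
  unfolding free_group_def carrier_presented_group by (simp add: words_def)

lemma in_words_UNIV [simp]: "w \<in> words UNIV"
  by (simp add: words_def)

lemma (in group) F2_if_reduced_words_nontrivial:
  assumes ab: "a \<in> carrier G" "b \<in> carrier G"
    and nontriv: "\<And>w. reduced_word w \<Longrightarrow> w \<noteq> [] \<Longrightarrow> weval G (\<lambda>x. if x then a else b) w \<noteq> \<one>"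
  shows "subgroup_generated G {a, b} \<cong> F\<^sub>2"
proof -
  let ?f = "\<lambda>x. if x then a else b"
  interpret F: group "F\<^sub>2" by (rule group_F2)
  have f: "?f ` UNIV \<subseteq> carrier G" using ab by auto
  have "weval G ?f w = \<one> \<longleftrightarrow> weval F\<^sub>2 free_gen w = \<one>\<^bsub>F\<^sub>2\<^esub>" for w
  proof -
    obtain v where v: "reduced_word v" "(w, v) \<in> pres_cong UNIV {}"
      using ex_reduced_word[of w UNIV "{}"] by auto
    have w: "weval G ?f w = weval G ?f v"
      by (rule weval_pres_cong[OF f _ v(2)]) auto
    have "weval F\<^sub>2 free_gen w = weval F\<^sub>2 free_gen v"
      using v(2) by (simp add: weval_F2 pres_class_eq_iff)
    moreover have "weval F\<^sub>2 free_gen v = \<one>\<^bsub>F\<^sub>2\<^esub> \<longleftrightarrow> v = []"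
      using free_cong_reduced_eq[of v "[]" UNIV] v(1)
      unfolding weval_F2 by (auto simp: free_group_def one_presented_group pres_class_eq_iff
          intro: pres_cong.refl)
    moreover have "weval G ?f v = \<one> \<longleftrightarrow> v = []" using nontriv v(1) by auto
    ultimately show ?thesis using w by simp
  qed
  from iso_of_same_relators[OF is_group group_F2 f free_gen_closed this]
  have "subgroup_generated G (range ?f) \<cong> subgroup_generated F\<^sub>2 (range free_gen)" .
  moreover have "range ?f = {a, b}" by auto
  moreover have "subgroup_generated F\<^sub>2 (range free_gen) = F\<^sub>2"
  proof -
    have "generate F\<^sub>2 (range free_gen) = carrier F\<^sub>2"
      using F.generate_eq_weval[OF free_gen_closed] by (auto simp: carrier_F2 weval_F2)
    then show ?thesis
      using free_gen_closed by (simp add: subgroup_generated_def Int_absorb1)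
  qed
  ultimately show ?thesis by metis
qed

lemma F2_center_trivial:
  assumes c: "c \<in> carrier F\<^sub>2" and comm: "\<And>x. c \<otimes>\<^bsub>F\<^sub>2\<^esub> free_gen x = free_gen x \<otimes>\<^bsub>F\<^sub>2\<^esub> c"
  shows "c = \<one>\<^bsub>F\<^sub>2\<^esub>"
proof -
  interpret F: group "F\<^sub>2" by (rule group_F2)
  obtain w0 where "c = pres_class UNIV {} w0" using c by (auto simp: carrier_F2)
  moreover obtain w where w: "reduced_word w" "(w0, w) \<in> pres_cong UNIV {}"
    using ex_reduced_word[of w0 UNIV "{}"] by auto
  ultimately have cw: "c = pres_class UNIV {} w" by (simp add: pres_class_eq_iff)
  have "w = []"
  proof (rule ccontr)
    assume ne: "w \<noteq> []"
    \<comment> \<open>The generator differs from that of the first letter, so l followed by w is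
      reduced; the sign agrees with that of the last letter, so w followed by l is reduced whatever
      the generator of that letter.\<close>
    define l where "l = (\<not> fst (hd w), snd (last w))"
    have comm_l: "c \<otimes>\<^bsub>F\<^sub>2\<^esub> pres_class UNIV {} [l] = pres_class UNIV {} [l] \<otimes>\<^bsub>F\<^sub>2\<^esub> c"
    proof -
      have gen: "free_gen (fst l) \<in> carrier F\<^sub>2" using free_gen_closed by auto
      have "weval F\<^sub>2 free_gen [l] = (if snd l then free_gen (fst l) else inv\<^bsub>F\<^sub>2\<^esub> free_gen (fst l))"
        using gen by simp
      moreover have "c \<otimes>\<^bsub>F\<^sub>2\<^esub> (inv\<^bsub>F\<^sub>2\<^esub> free_gen (fst l)) = (inv\<^bsub>F\<^sub>2\<^esub> free_gen (fst l)) \<otimes>\<^bsub>F\<^sub>2\<^esub> c"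
        using gen c comm by (intro F.commute_inv) auto
      ultimately show ?thesis unfolding weval_F2 using comm by simp
    qed
    have red: "reduced_word (w @ [l])" "reduced_word (l # w)"
      using w(1) ne by (auto simp: successively_append_iff successively_Cons l_def cancels_def)
    have "(w @ [l], l # w) \<in> pres_cong UNIV {}"
      using comm_l presented_group_mult[of w UNIV "[l]" "{}"]
        presented_group_mult[of "[l]" UNIV w "{}"]
      by (simp add: free_group_def cw pres_class_eq_iff)
    from this red have "w @ [l] = l # w" by (rule free_cong_reduced_eq)
    then have "hd w = l" using ne by (cases w) auto
    then show False by (cases "hd w") (auto simp: l_def)
  qed
  with cw show ?thesis by (simp add: free_group_def one_presented_group)
qed

section \<open>Exponent sums and central twists of free generators\<close>

primrec exponent_sum :: "'a \<Rightarrow> 'a word \<Rightarrow> int" where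
  "exponent_sum x [] = 0"
| "exponent_sum x (l # w) = (if fst l = x then if snd l then 1 else -1 else 0) + exponent_sum x w"

lemma exponent_sum_append: "exponent_sum x (u @ v) = exponent_sum x u + exponent_sum x v"
  by (induction u) auto

lemma exponent_sum_cong: "(u, v) \<in> pres_cong X {} \<Longrightarrow> exponent_sum x u = exponent_sum x v"
  by (induction rule: pres_cong.induct) (auto simp: exponent_sum_append)


text \<open>The first four equations say that two integer matrices have the identity as product, so
  the second has nonzero determinant and (x, y) lies in its trivial left kernel.\<close>

lemma ints_det_zero_unique:
  fixes p q r s a b c d x y :: int
  assumes "a * p + b * r = 1" "a * q + b * s = 0" "c * p + d * r = 0" "c * q + d * s = 1"
    and "x * p + y * r = 0" "x * q + y * s = 0"
  shows "x = 0" "y = 0"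
proof -
  have det: "(a * d - b * c) * (p * s - q * r) = 1"
    using assms(1-4) by algebra
  then have "p * s - q * r \<noteq> 0" by auto
  moreover have "x * (p * s - q * r) = 0" "y * (p * s - q * r) = 0"
    using assms(5,6) by algebra+
  ultimately show "x = 0" "y = 0" by auto
qed

context group
begin

text \<open>
  In an abelianisation \<open>\<int>\<^sup>2\<close> two generators are linearly independent, so a word that is trivial in
  \<open>a\<close> and \<open>b\<close> has vanishing exponent sums.
\<close>

lemma exponent_sum_eq_0:
  assumes ab: "a \<in> carrier G" "b \<in> carrier G"
    and iso: "subgroup_generated G {a, b} \<cong> F\<^sub>2"
    and w: "weval G (\<lambda>x. if x then a else b) w = \<one>"
  shows "exponent_sum x w = 0"
proof -
  let ?f = "\<lambda>x. if x then a else b" and ?H = "subgroup_generated G {a, b}"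
  have f: "?f ` UNIV \<subseteq> carrier G" using ab by auto
  interpret F: group "F\<^sub>2" by (rule group_F2)
  interpret H: group ?H by (rule group_subgroup_generated)
  obtain \<kappa> where \<kappa>: "\<kappa> \<in> iso ?H F\<^sub>2" using iso by (auto simp: is_iso_def)
  have carH: "carrier ?H = range (weval G ?f)"
  proof -
    have "range ?f = {a, b}" by auto
    moreover have "words UNIV = (UNIV :: bool word set)" by auto
    ultimately show ?thesis
      using generate_eq_weval[OF f] ab by (simp add: carrier_subgroup_generated Int_absorb1)
  qed
  have wval: "weval G ?f u \<in> carrier ?H" for u by (auto simp: carH)
  interpret \<kappa>: group_hom ?H F\<^sub>2 \<kappa>
    using \<kappa> by unfold_locales (auto simp: iso_def)
  define E where "E A = (exponent_sum True (SOME u. A = pres_class UNIV {} u),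
      exponent_sum False (SOME u. A = pres_class UNIV {} u))" for A
  have E: "E (pres_class UNIV {} u) = (exponent_sum True u, exponent_sum False u)" for u
  proof -
    have "pres_class UNIV {} u = pres_class UNIV {} (SOME v. pres_class UNIV {} u = pres_class UNIV {} v)"
      by (rule someI) simp
    then have "(u, SOME v. pres_class UNIV {} u = pres_class UNIV {} v) \<in> pres_cong UNIV {}"
      using pres_class_eq_iff in_words_UNIV by metis
    from exponent_sum_cong[OF this] show ?thesis unfolding E_def by simp
  qed
  have E_mult: "E (A \<otimes>\<^bsub>F\<^sub>2\<^esub> B) = (fst (E A) + fst (E B), snd (E A) + snd (E B))"
    if AB: "A \<in> carrier F\<^sub>2" "B \<in> carrier F\<^sub>2" for A B
  proof -
    obtain u v where [simp]: "A = pres_class UNIV {} u" "B = pres_class UNIV {} v"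
      using AB by (auto simp: carrier_F2)
    have "A \<otimes>\<^bsub>F\<^sub>2\<^esub> B = pres_class UNIV {} (u @ v)"
      using presented_group_mult[of u UNIV v "{}"] by (simp add: free_group_def)
    then show ?thesis by (simp add: E exponent_sum_append)
  qed
  have E_one: "E (\<one>\<^bsub>F\<^sub>2\<^esub>) = (0, 0)"
    using E[of "[]"] by (simp add: free_group_def one_presented_group)
  have E_inv: "E (inv\<^bsub>F\<^sub>2\<^esub> A) = (- fst (E A), - snd (E A))" if "A \<in> carrier F\<^sub>2" for A
    using E_mult[of A "inv\<^bsub>F\<^sub>2\<^esub> A"] that by (simp add: E_one F.r_inv add_eq_0_iff prod_eq_iff)
  \<comment> \<open>The isomorphism \<kappa> is arbitrary and need not send a and b to the standard
    generators. Surjectivity makes the matrix of the exponent sums of their images invertible, which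
    suffices.\<close>
  obtain p q where pq: "E (\<kappa> a) = (p, q)" by fastforce
  obtain r s where rs: "E (\<kappa> b) = (r, s)" by fastforce
  have gens: "a \<in> carrier ?H" "b \<in> carrier ?H"
    using wval[of "[(True, True)]"] wval[of "[(False, True)]"] ab by auto
  have Ew: "E (\<kappa> (weval G ?f u)) =
      (exponent_sum True u * p + exponent_sum False u * r,
       exponent_sum True u * q + exponent_sum False u * s)" for u
  proof (induction u)
    case Nil
    then show ?case using \<kappa>.hom_one E_one by simp
  next
    case (Cons l u)
    obtain x c where l: "l = (x, c)" by (cases l)
    define y where "y = ?f x"
    have Ey: "E (\<kappa> y) = (if x then (p, q) else (r, s))" using pq rs by (simp add: y_def)
    have yH: "y \<in> carrier ?H" using gens by (simp add: y_def)
    have inv_y: "inv\<^bsub>?H\<^esub> y = inv y"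
      using yH ab by (subst inv_subgroup_generated) (auto simp: carrier_subgroup_generated)
    have y: "weval G ?f (l # u) = (if c then y else inv\<^bsub>?H\<^esub> y) \<otimes>\<^bsub>?H\<^esub> weval G ?f u"
      by (simp add: l y_def[symmetric] inv_y)
    show ?case
    proof (cases c)
      case True
      then have "\<kappa> (weval G ?f (l # u)) = \<kappa> y \<otimes>\<^bsub>F\<^sub>2\<^esub> \<kappa> (weval G ?f u)"
        using \<kappa>.hom_mult[OF yH wval[of u]] y by simp
      then show ?thesis
        using Cons Ey E_mult[OF \<kappa>.hom_closed[OF yH] \<kappa>.hom_closed[OF wval[of u]]] True
        by (cases x) (auto simp: l algebra_simps)
    next
      case False
      then have "\<kappa> (weval G ?f (l # u)) = inv\<^bsub>F\<^sub>2\<^esub> \<kappa> y \<otimes>\<^bsub>F\<^sub>2\<^esub> \<kappa> (weval G ?f u)"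
        using \<kappa>.hom_mult[OF H.inv_closed[OF yH] wval[of u]] y \<kappa>.hom_inv[OF yH] by simp
      then show ?thesis
        using Cons Ey False E_inv[OF \<kappa>.hom_closed[OF yH]]
          E_mult[OF F.inv_closed[OF \<kappa>.hom_closed[OF yH]] \<kappa>.hom_closed[OF wval[of u]]]
        by (cases x) (auto simp: l algebra_simps)
    qed
  qed
  have surj: "\<exists>u. \<kappa> (weval G ?f u) = free_gen x" for x
  proof -
    have "free_gen x \<in> \<kappa> ` carrier ?H"
      using \<kappa> free_gen_closed by (auto simp: iso_def bij_betw_def)
    then show ?thesis by (auto simp: carH)
  qed
  obtain u v where "\<kappa> (weval G ?f u) = free_gen True" "\<kappa> (weval G ?f v) = free_gen False"
    using surj by metis
  then have "exponent_sum True u * p + exponent_sum False u * r = 1"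
    "exponent_sum True u * q + exponent_sum False u * s = 0"
    "exponent_sum True v * p + exponent_sum False v * r = 0"
    "exponent_sum True v * q + exponent_sum False v * s = 1"
    using Ew[of u] Ew[of v] E[of "[(True, True)]"] E[of "[(False, True)]"] by simp_all
  moreover have "exponent_sum True w * p + exponent_sum False w * r = 0"
    "exponent_sum True w * q + exponent_sum False w * s = 0"
    using Ew[of w] w \<kappa>.hom_one E_one by simp_all
  ultimately have "exponent_sum True w = 0" "exponent_sum False w = 0"
    using ints_det_zero_unique by blast+
  then show ?thesis by (cases x) auto
qed

lemma F2_subgroup_center_trivial:
  assumes ab: "a \<in> carrier G" "b \<in> carrier G"
    and iso: "subgroup_generated G {a, b} \<cong> F\<^sub>2"
    and c: "c \<in> generate G {a, b}" "c \<otimes> a = a \<otimes> c" "c \<otimes> b = b \<otimes> c"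
  shows "c = \<one>"
proof -
  let ?H = "subgroup_generated G {a, b}"
  interpret F: group "F\<^sub>2" by (rule group_F2)
  interpret H: group ?H by (rule group_subgroup_generated)
  have carH: "carrier ?H = generate G {a, b}"
    using ab by (simp add: carrier_subgroup_generated Int_absorb1)
  have sub: "{a, b} \<subseteq> carrier G" using ab by simp
  obtain \<kappa> where \<kappa>: "\<kappa> \<in> iso ?H F\<^sub>2" using iso by (auto simp: is_iso_def)
  interpret \<kappa>: group_hom ?H F\<^sub>2 \<kappa>
    using \<kappa> by unfold_locales (auto simp: iso_def)
  have cG: "c \<in> carrier G" using generate_in_carrier[OF sub c(1)] .
  have central: "c \<otimes> y = y \<otimes> c" if "y \<in> generate G {a, b}" for y
    using that
  proof induction
    case (incl y) then show ?case using c by auto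
  next
    case (inv y) then show ?case using c cG ab commute_inv by auto
  next
    case (eng y z)
    then have "y \<in> carrier G" "z \<in> carrier G" using generate_in_carrier[OF sub] by auto
    then show ?case using eng cG by (metis m_assoc)
  qed (use cG in simp)
  have "\<kappa> c \<otimes>\<^bsub>F\<^sub>2\<^esub> y = y \<otimes>\<^bsub>F\<^sub>2\<^esub> \<kappa> c" if y: "y \<in> carrier F\<^sub>2" for y
  proof -
    obtain y' where y': "y' \<in> carrier ?H" "y = \<kappa> y'"
      using \<kappa> y by (auto simp: iso_def bij_betw_def)
    then have "\<kappa> (c \<otimes>\<^bsub>?H\<^esub> y') = \<kappa> (y' \<otimes>\<^bsub>?H\<^esub> c)" using central c(1) by (simp add: carH)
    then show ?thesis using y' c(1) by (simp add: carH del: mult_subgroup_generated)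
  qed
  then have "\<kappa> c = \<one>\<^bsub>F\<^sub>2\<^esub>"
    using F2_center_trivial free_gen_closed c(1) by (simp add: carH image_subset_iff)
  then have "\<kappa> c = \<kappa> \<one>" using \<kappa>.hom_one by simp
  moreover have "inj_on \<kappa> (carrier ?H)" using \<kappa> by (simp add: iso_def bij_betw_def)
  ultimately show ?thesis using c(1) generate.one[of G "{a, b}"] by (auto simp: inj_on_def carH)
qed

text \<open>The twist multiplies the value of a word by a power of z that is linear in its exponent
  sums. Relators have exponent sums zero and so stay relators. Conversely, if a twisted word is
  trivial, its untwisted value is a power of z, hence central in the free group, hence
  trivial.\<close>

lemma F2_central_twist:
  assumes ab: "a \<in> carrier G" "b \<in> carrier G" and z: "z \<in> carrier G"
    and comm: "z \<otimes> a = a \<otimes> z" "z \<otimes> b = b \<otimes> z"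
    and iso: "subgroup_generated G {a, b} \<cong> F\<^sub>2"
  shows "subgroup_generated G {a \<otimes> z [^] (i :: int), b \<otimes> z [^] (j :: int)} \<cong> F\<^sub>2"
proof -
  let ?f = "\<lambda>x. if x then a else b" and ?m = "\<lambda>x. if x then i else j"
  let ?f' = "\<lambda>x. ?f x \<otimes> z [^] (?m x)"
  define e where "e w = i * exponent_sum True w + j * exponent_sum False w" for w
  have f: "?f ` UNIV \<subseteq> carrier G" and f': "?f' ` UNIV \<subseteq> carrier G" using ab z by auto
  have fx: "?f x \<in> carrier G" for x using ab by simp
  have comm': "z [^] (k :: int) \<otimes> ?f x = ?f x \<otimes> z [^] k" for k x
    using commute_int_pow[OF fx z] comm by (cases x) metis+
  have twist: "weval G ?f' w = weval G ?f w \<otimes> z [^] e w" for w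
  proof (induction w)
    case (Cons l w)
    obtain x c where l: "l = (x, c)" by (cases l)
    define y where "y = (if c then ?f x else inv (?f x))"
    define k where "k = (if c then ?m x else - ?m x)"
    have W: "weval G ?f w \<in> carrier G" by (rule weval_closed[OF f]) simp
    have yG: "y \<in> carrier G" using fx[of x] by (simp add: y_def)
    have comm_y: "z [^] n \<otimes> y = y \<otimes> z [^] n" for n :: int
      using comm'[of n x] fx[of x] z commute_inv by (simp add: y_def)
    have comm_w: "z [^] n \<otimes> weval G ?f v = weval G ?f v \<otimes> z [^] n" for n :: int and v
    proof (induction v)
      case (Cons l' v)
      have V: "weval G ?f v \<in> carrier G" by (rule weval_closed[OF f]) simp
      define u where "u = (if snd l' then ?f (fst l') else inv (?f (fst l')))"
      have U: "u \<in> carrier G" using fx[of "fst l'"] by (simp add: u_def)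
      have "z [^] n \<otimes> u = u \<otimes> z [^] n"
        using comm'[of n "fst l'"] fx[of "fst l'"] z commute_inv by (simp add: u_def)
      from commute_mult[OF _ U V this Cons] show ?case using z by (simp add: u_def)
    qed (use z in simp)
    have "(if c then ?f' x else inv (?f' x)) = y \<otimes> z [^] k"
      using fx[of x] z comm_y[of k] by (auto simp: y_def k_def inv_mult_group int_pow_neg)
    moreover have "weval G ?f' (l # w) = (if c then ?f' x else inv (?f' x)) \<otimes> weval G ?f' w"
      by (simp only: l weval.simps fst_conv snd_conv)
    ultimately have "weval G ?f' (l # w) = (y \<otimes> z [^] k) \<otimes> (weval G ?f w \<otimes> z [^] e w)"
      by (simp only: Cons)
    also have "\<dots> = y \<otimes> (z [^] k \<otimes> weval G ?f w) \<otimes> z [^] e w"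
      using yG W z by (simp only: m_assoc int_pow_closed m_closed)
    also have "\<dots> = (y \<otimes> weval G ?f w) \<otimes> (z [^] k \<otimes> z [^] e w)"
      unfolding comm_w using yG W z by (simp only: m_assoc int_pow_closed m_closed)
    also have "z [^] k \<otimes> z [^] e w = z [^] e (l # w)"
      using z by (simp add: int_pow_mult[symmetric] e_def k_def l algebra_simps)
    also have "y \<otimes> weval G ?f w = weval G ?f (l # w)"
      by (simp only: l y_def weval.simps fst_conv snd_conv)
    finally show ?case .
  qed (simp add: e_def)
  have gen: "generate G {a, b} = range (weval G ?f)"
  proof -
    have "range ?f = {a, b}" by auto
    moreover have "words UNIV = (UNIV :: bool word set)" by auto
    ultimately show ?thesis using generate_eq_weval[OF f] by simp
  qed
  have rel: "weval G ?f' w = \<one> \<longleftrightarrow> weval G ?f w = \<one>" for w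
  proof
    assume "weval G ?f w = \<one>"
    then have "e w = 0" using exponent_sum_eq_0[OF ab iso] by (simp add: e_def)
    with \<open>weval G ?f w = \<one>\<close> show "weval G ?f' w = \<one>" by (simp add: twist)
  next
    have W: "weval G ?f w \<in> carrier G" by (rule weval_closed[OF f]) simp
    assume "weval G ?f' w = \<one>"
    then have w: "weval G ?f w = z [^] (- e w)"
      using W z inv_equality[of "weval G ?f w" "z [^] e w"] by (simp add: twist int_pow_neg)
    have "weval G ?f w \<in> generate G {a, b}" by (auto simp: gen)
    moreover have "weval G ?f w \<otimes> a = a \<otimes> weval G ?f w" "weval G ?f w \<otimes> b = b \<otimes> weval G ?f w"
      using comm'[of "- e w" True] comm'[of "- e w" False] unfolding w by simp_all
    ultimately show "weval G ?f w = \<one>" by (rule F2_subgroup_center_trivial[OF ab iso])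
  qed
  have "subgroup_generated G (range ?f') \<cong> subgroup_generated G (range ?f)"
    by (rule iso_of_same_relators[OF is_group is_group f' f]) (rule rel)
  moreover have "range ?f' = {a \<otimes> z [^] i, b \<otimes> z [^] j}" "range ?f = {a, b}" by auto
  ultimately show ?thesis using iso iso_trans by metis
qed

end


section \<open>Pairs satisfying the power alternative\<close>

definition alternative_pair :: "('g, 'm) monoid_scheme \<Rightarrow> 'g \<Rightarrow> 'g \<Rightarrow> bool" where
  "alternative_pair G g h \<longleftrightarrow> (\<exists>n::nat. n \<ge> 1 \<and>
      (g [^]\<^bsub>G\<^esub> n \<otimes>\<^bsub>G\<^esub> h [^]\<^bsub>G\<^esub> n = h [^]\<^bsub>G\<^esub> n \<otimes>\<^bsub>G\<^esub> g [^]\<^bsub>G\<^esub> n \<or>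
       subgroup_generated G {g [^]\<^bsub>G\<^esub> n, h [^]\<^bsub>G\<^esub> n} \<cong> F\<^sub>2))"

lemma power_alternative_iff:
  "power_alternative G \<longleftrightarrow> (\<forall>g\<in>carrier G. \<forall>h\<in>carrier G. alternative_pair G g h)"
  by (simp add: power_alternative_def alternative_pair_def)

lemma alternative_pair_sym: "alternative_pair G g h \<Longrightarrow> alternative_pair G h g"
  unfolding alternative_pair_def by (subst insert_commute) (elim ex_forward, auto)

context group
begin

lemma alternative_pair_inv:
  assumes gh: "g \<in> carrier G" "h \<in> carrier G" and alt: "alternative_pair G (inv g) h"
  shows "alternative_pair G g h"
proof -
  obtain n :: nat where n: "n \<ge> 1" "inv (g [^] n) \<otimes> h [^] n = h [^] n \<otimes> inv (g [^] n) \<or>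
      subgroup_generated G {inv (g [^] n), h [^] n} \<cong> F\<^sub>2"
    using alt gh by (auto simp: alternative_pair_def nat_pow_inv)
  have "subgroup_generated G {inv x, y} = subgroup_generated G {x, y}"
    if "x \<in> carrier G" "y \<in> carrier G" for x y
  proof -
    have "generate G {inv u, y} \<subseteq> generate G {u, y}" if "u \<in> carrier G" for u
      using that \<open>y \<in> carrier G\<close>
      by (intro generate_subgroup_incl generate_is_subgroup)
        (auto intro: generate.inv generate.incl)
    from this[of x] this[of "inv x"] that have "generate G {inv x, y} = generate G {x, y}" by auto
    then show ?thesis using that by (simp add: subgroup_generated_def Int_absorb1)
  qed
  moreover have "g [^] n \<otimes> h [^] n = h [^] n \<otimes> g [^] n"
    if "inv (g [^] n) \<otimes> h [^] n = h [^] n \<otimes> inv (g [^] n)"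
    using commute_inv[of "h [^] n" "inv (g [^] n)"] that gh by simp
  ultimately show ?thesis
    using n gh unfolding alternative_pair_def by (intro exI[of _ n]) auto
qed

lemma alternative_pair_hom:
  assumes H: "group H" and \<phi>: "\<phi> \<in> hom H G" "inj_on \<phi> (carrier H)"
    and gh: "g \<in> carrier H" "h \<in> carrier H" and alt: "alternative_pair H g h"
  shows "alternative_pair G (\<phi> g) (\<phi> h)"
proof -
  interpret H: group H by fact
  interpret \<phi>: group_hom H G \<phi> by unfold_locales fact
  obtain n :: nat where n: "n \<ge> 1" "g [^]\<^bsub>H\<^esub> n \<otimes>\<^bsub>H\<^esub> h [^]\<^bsub>H\<^esub> n = h [^]\<^bsub>H\<^esub> n \<otimes>\<^bsub>H\<^esub> g [^]\<^bsub>H\<^esub> n \<or>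
      subgroup_generated H {g [^]\<^bsub>H\<^esub> n, h [^]\<^bsub>H\<^esub> n} \<cong> F\<^sub>2"
    using alt by (auto simp: alternative_pair_def)
  from n(2) have "\<phi> g [^] n \<otimes> \<phi> h [^] n = \<phi> h [^] n \<otimes> \<phi> g [^] n \<or>
      subgroup_generated G {\<phi> g [^] n, \<phi> h [^] n} \<cong> F\<^sub>2"
  proof
    assume "g [^]\<^bsub>H\<^esub> n \<otimes>\<^bsub>H\<^esub> h [^]\<^bsub>H\<^esub> n = h [^]\<^bsub>H\<^esub> n \<otimes>\<^bsub>H\<^esub> g [^]\<^bsub>H\<^esub> n"
    then have "\<phi> (g [^]\<^bsub>H\<^esub> n \<otimes>\<^bsub>H\<^esub> h [^]\<^bsub>H\<^esub> n) = \<phi> (h [^]\<^bsub>H\<^esub> n \<otimes>\<^bsub>H\<^esub> g [^]\<^bsub>H\<^esub> n)" by simp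
    then show ?thesis using gh by (simp add: \<phi>.hom_nat_pow)
  next
    let ?f = "\<lambda>x. if x then g [^]\<^bsub>H\<^esub> n else h [^]\<^bsub>H\<^esub> n"
    assume iso: "subgroup_generated H {g [^]\<^bsub>H\<^esub> n, h [^]\<^bsub>H\<^esub> n} \<cong> F\<^sub>2"
    have f: "?f ` UNIV \<subseteq> carrier H" using gh by auto
    have fx: "?f x \<in> carrier H" for x using gh by auto
    have \<phi>f: "(\<lambda>x. \<phi> (?f x)) ` UNIV \<subseteq> carrier G" using fx by auto
    have w: "weval H ?f w \<in> carrier H" for w by (rule H.weval_closed[OF f]) simp
    have "weval G (\<lambda>x. \<phi> (?f x)) w = \<phi> (weval H ?f w)" for w
    proof (induction w)
      case (Cons l w)
      then show ?case using fx[of "fst l"] w[of w] \<phi>.hom_mult \<phi>.hom_inv by (cases "snd l") auto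
    qed simp
    then have "weval G (\<lambda>x. \<phi> (?f x)) w = \<one> \<longleftrightarrow> weval H ?f w = \<one>\<^bsub>H\<^esub>" for w
      using \<phi>(2) w[of w] \<phi>.hom_one by (metis H.one_closed inj_onD)
    from iso_of_same_relators[OF is_group H \<phi>f f this]
    have "subgroup_generated G (range (\<lambda>x. \<phi> (?f x))) \<cong> subgroup_generated H (range ?f)" .
    moreover have "range (\<lambda>x. \<phi> (?f x)) = {\<phi> g [^] n, \<phi> h [^] n}"
      "range ?f = {g [^]\<^bsub>H\<^esub> n, h [^]\<^bsub>H\<^esub> n}"
      using gh by (auto simp: \<phi>.hom_nat_pow)
    ultimately show ?thesis using iso iso_trans by metis
  qed
  with n(1) show ?thesis by (auto simp: alternative_pair_def)
qed

lemma alternative_pair_central_twist: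
  assumes pq: "p \<in> carrier G" "q \<in> carrier G" and z: "z \<in> carrier G"
    and comm: "z \<otimes> p = p \<otimes> z" "z \<otimes> q = q \<otimes> z"
    and alt: "alternative_pair G p q"
  shows "alternative_pair G (p \<otimes> z [^] (i :: int)) (q \<otimes> z [^] (j :: int))"
proof -
  obtain n :: nat where n: "n \<ge> 1" "p [^] n \<otimes> q [^] n = q [^] n \<otimes> p [^] n \<or>
      subgroup_generated G {p [^] n, q [^] n} \<cong> F\<^sub>2"
    using alt by (auto simp: alternative_pair_def)
  have commi: "x \<otimes> z [^] k = z [^] k \<otimes> x" if "x \<in> carrier G" "z \<otimes> x = x \<otimes> z" for x and k :: int
    using commute_int_pow[of x z k] that z by simp
  have pw: "(x \<otimes> z [^] k) [^] n = x [^] n \<otimes> z [^] (k * int n)"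
    if "x \<in> carrier G" "z \<otimes> x = x \<otimes> z" for x and k :: int
    using pow_mult_distrib[of x "z [^] k" n] commi[OF that] that z
    by (simp add: int_pow_int[symmetric] int_pow_pow)
  have cn: "z \<otimes> x [^] n = x [^] n \<otimes> z" if "x \<in> carrier G" "z \<otimes> x = x \<otimes> z" for x
    using commute_int_pow[of z x "int n"] that z by (simp add: int_pow_int)
  let ?P = "p [^] n \<otimes> z [^] (i * int n)" and ?Q = "q [^] n \<otimes> z [^] (j * int n)"
  from n(2) have "?P \<otimes> ?Q = ?Q \<otimes> ?P \<or> subgroup_generated G {?P, ?Q} \<cong> F\<^sub>2"
  proof
    assume c: "p [^] n \<otimes> q [^] n = q [^] n \<otimes> p [^] n"
    have P: "z [^] k \<otimes> p [^] n = p [^] n \<otimes> z [^] k" and Q: "z [^] k \<otimes> q [^] n = q [^] n \<otimes> z [^] k"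
      for k :: int using commi cn pq comm by simp_all
    have Z: "z [^] k \<otimes> z [^] k' = z [^] k' \<otimes> z [^] k" for k k' :: int
      using z by (simp add: int_pow_mult[symmetric] add.commute)
    have "p [^] n \<otimes> ?Q = ?Q \<otimes> p [^] n" using pq z c P by (intro commute_mult) auto
    moreover have "z [^] (i * int n) \<otimes> ?Q = ?Q \<otimes> z [^] (i * int n)"
      using pq z Q Z by (intro commute_mult) auto
    ultimately have "?Q \<otimes> ?P = ?P \<otimes> ?Q" using pq z by (intro commute_mult) auto
    then show ?thesis by simp
  next
    assume "subgroup_generated G {p [^] n, q [^] n} \<cong> F\<^sub>2"
    then show ?thesis using F2_central_twist[OF _ _ z cn cn] pq comm by auto
  qed
  then show ?thesis
    unfolding alternative_pair_def using n(1) pw pq comm by (intro exI[of _ n]) auto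
qed

end


section \<open>Ping-pong\<close>

text \<open>The game is played letter by letter rather than syllable by syllable, so that it applies
  directly to reduced words.\<close>

lemma (in group_action) ping_pong:
  assumes gh: "g \<in> carrier G" "h \<in> carrier G"
    and XE: "X \<subseteq> E" "Y \<subseteq> E" and ne: "X \<noteq> {}" "Y \<noteq> {}" and disj: "X \<inter> Y = {}"
    and g: "\<And>k y. (k :: int) \<noteq> 0 \<Longrightarrow> y \<in> Y \<Longrightarrow> \<phi> (g [^]\<^bsub>G\<^esub> k) y \<in> X"
    and h: "\<And>k x. (k :: int) \<noteq> 0 \<Longrightarrow> x \<in> X \<Longrightarrow> \<phi> (h [^]\<^bsub>G\<^esub> k) x \<in> Y"
  shows "subgroup_generated G {g, h} \<cong> F\<^sub>2"
proof -
  interpret group G using group_hom group_hom.axioms(1) by blast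
  let ?f = "\<lambda>x. if x then g else h"
  have f: "?f ` UNIV \<subseteq> carrier G" and fx: "?f x \<in> carrier G" for x using gh by auto
  define T where "T b = (if b then X else Y)" for b :: bool
  have TE: "T b \<subseteq> E" and T_ne: "T b \<noteq> {}" and T_disj: "T b \<inter> T (\<not> b) = {}" for b
    using XE ne disj by (auto simp: T_def)
  have move: "\<phi> (?f b [^] k) y \<in> T b" if "k \<noteq> 0" "y \<in> T (\<not> b)" for b y and k :: int
    using g h that by (cases b) (auto simp: T_def)
  define sg where "sg b = (if b then 1 else - 1 :: int)" for b
  \<comment> \<open>The images of the opposite side under positive powers of the letter l: a run of
    equal letters stays inside \<open>S l\<close>, and a change of generator enters the other side
    from outside.\<close>
  define S where "S l = {\<phi> (?f (fst l) [^] (sg (snd l) * k)) y | k y. k > 0 \<and> y \<in> T (\<not> fst l)}"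
    for l
  define e where "e l = ?f (fst l) [^] sg (snd l)" for l
  have eG: "e l \<in> carrier G" for l unfolding e_def using fx by (rule int_pow_closed)
  have S_T: "S l \<subseteq> T (fst l)" for l
  proof
    fix x assume "x \<in> S l"
    then obtain k y where x: "x = \<phi> (?f (fst l) [^] (sg (snd l) * k)) y" "k > 0" "y \<in> T (\<not> fst l)"
      unfolding S_def by blast
    then have "sg (snd l) * k \<noteq> 0" by (simp add: sg_def)
    from move[OF this x(3)] show "x \<in> T (fst l)" using x(1) by simp
  qed
  have from_T: "\<phi> (e l) y \<in> S l" if "y \<in> T (\<not> fst l)" for l y
    unfolding S_def e_def using that by (intro CollectI exI[of _ 1] exI[of _ y]) auto
  have from_S: "\<phi> (e l) y \<in> S l" if y: "y \<in> S l" for l y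
  proof -
    obtain k y' where y': "y = \<phi> (?f (fst l) [^] (sg (snd l) * k)) y'" "k > 0" "y' \<in> T (\<not> fst l)"
      using y unfolding S_def by blast
    have "\<phi> (e l) y = \<phi> (e l \<otimes> ?f (fst l) [^] (sg (snd l) * k)) y'"
      unfolding y'(1) using y'(3) TE fx int_pow_closed[OF fx]
      by (subst composition_rule) (auto simp: eG simp del: if_image_distrib)
    also have "e l \<otimes> ?f (fst l) [^] (sg (snd l) * k) = ?f (fst l) [^] (sg (snd l) * (1 + k))"
      unfolding e_def using int_pow_mult[OF fx, of "fst l" "sg (snd l)" "sg (snd l) * k"]
      by (simp add: distrib_left)
    finally show ?thesis
      unfolding S_def using y' by (intro CollectI exI[of _ "1 + k"] exI[of _ y']) auto
  qed
  have step: "\<phi> (e l) y \<in> S l" if "y \<in> S k" "\<not> cancels l k" for l k y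
  proof (cases "fst l = fst k")
    case True
    with that have "l = k" by (auto simp: cancels_def prod_eq_iff)
    then show ?thesis using from_S that by simp
  next
    case False
    then have "fst k = (\<not> fst l)" by auto
    then show ?thesis using from_T[of y l] S_T[of k] that by auto
  qed
  have weval_Cons: "\<phi> (weval G ?f (l # w)) y = \<phi> (e l) (\<phi> (weval G ?f w) y)" if "y \<in> E" for l w y
  proof -
    have "weval G ?f (l # w) = e l \<otimes> weval G ?f w"
      using fx[of "fst l"] by (simp add: e_def sg_def int_pow_neg)
    then show ?thesis
      using composition_rule[OF that eG weval_closed[OF f]] by simp
  qed
  have SE: "S l \<subseteq> E" for l using S_T TE by blast
  have run: "\<phi> (weval G ?f w) y \<in> S (hd w)"
    if "w \<noteq> []" "reduced_word w" "y \<in> T (\<not> fst (last w)) \<union> S (last w)" for w y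
    using that
  proof (induction w)
    case (Cons l w)
    have yE: "y \<in> E" using Cons.prems(3) TE SE by blast
    show ?case
    proof (cases "w = []")
      case True
      have "\<phi> (weval G ?f (l # w)) y = \<phi> (e l) y"
        using weval_Cons[OF yE, of l w] fun_cong[OF id_eq_one, of y] yE by (simp only: True weval.simps restrict_apply')
      moreover have "\<phi> (e l) y \<in> S l" using Cons.prems(3) from_T[of y l] from_S[of y l] by (auto simp: True)
      ultimately show ?thesis by simp
    next
      case False
      then have "\<phi> (weval G ?f w) y \<in> S (hd w)" "\<not> cancels l (hd w)"
        using Cons by (auto simp: successively_Cons)
      then show ?thesis using step weval_Cons[OF yE] by simp
    qed
  qed simp
  show ?thesis
  proof (rule F2_if_reduced_words_nontrivial[OF gh])
    fix w :: "bool word" assume w: "reduced_word w" "w \<noteq> []"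
    show "weval G ?f w \<noteq> \<one>"
    proof
      assume one: "weval G ?f w = \<one>"
      \<comment> \<open>A trivial word fixes both y and its image under the last letter. These lie
        on opposite sides, while the game puts both on the side of the first letter. Testing two
        points avoids conjugating the word into a special shape.\<close>
      obtain y where y: "y \<in> T (\<not> fst (last w))" using T_ne by blast
      have fixed: "x \<in> S (hd w)" if "x \<in> T (\<not> fst (last w)) \<union> S (last w)" for x
      proof -
        have "x \<in> E" using that TE SE by blast
        then show ?thesis using run[OF w(2,1) that] fun_cong[OF id_eq_one, of x] one by simp
      qed
      from fixed[of y] y have "y \<in> T (fst (hd w))" using S_T by blast
      moreover from fixed[of "\<phi> (e (last w)) y"] y have "\<phi> (e (last w)) y \<in> T (fst (hd w))"
        using S_T from_T by blast
      moreover have "\<phi> (e (last w)) y \<in> T (fst (last w))" using y S_T from_T by blast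
      ultimately show False using y T_disj[of "fst (last w)"]
        by (cases "fst (hd w) = fst (last w)") auto
    qed
  qed
qed


section \<open>Groups acting on trees\<close>

text \<open>
  A tree is described by the integral path metric on its vertices: the four-point condition says
  that it is a tree metric, and the parity condition that branching happens at vertices only.
\<close>

locale tree_metric =
  fixes X :: "'x set" and d :: "'x \<Rightarrow> 'x \<Rightarrow> int"
  assumes dist_nonneg: "x \<in> X \<Longrightarrow> y \<in> X \<Longrightarrow> 0 \<le> d x y"
    and dist_eq_0: "x \<in> X \<Longrightarrow> y \<in> X \<Longrightarrow> d x y = 0 \<longleftrightarrow> x = y"
    and dist_sym: "x \<in> X \<Longrightarrow> y \<in> X \<Longrightarrow> d x y = d y x"
    and four_point: "x \<in> X \<Longrightarrow> y \<in> X \<Longrightarrow> z \<in> X \<Longrightarrow> w \<in> X \<Longrightarrow>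
      d x y + d z w \<le> max (d x z + d y w) (d x w + d y z)"
    and parity: "x \<in> X \<Longrightarrow> y \<in> X \<Longrightarrow> z \<in> X \<Longrightarrow> even (d x y + d y z + d x z)"
    and geodesic: "x \<in> X \<Longrightarrow> y \<in> X \<Longrightarrow> 0 \<le> k \<Longrightarrow> k \<le> d x y \<Longrightarrow>
      \<exists>z\<in>X. d x z = k \<and> d z y = d x y - k"
begin

lemma dist_refl: "x \<in> X \<Longrightarrow> d x x = 0"
  by (simp add: dist_eq_0)

lemma triangle: "x \<in> X \<Longrightarrow> y \<in> X \<Longrightarrow> z \<in> X \<Longrightarrow> d x z \<le> d x y + d y z"
  using four_point[of x z y y] dist_refl[of y] dist_sym[of y z] by simp

lemma geodesic_unique:
  assumes "x \<in> X" "y \<in> X" "z \<in> X" "z' \<in> X"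
    and "d x z + d z y = d x y" "d x z' = d x z" "d z' y = d z y"
  shows "z = z'"
proof -
  have "d z z' + d x y \<le> max (d z x + d z' y) (d z y + d z' x)"
    using assms(1-4) by (intro four_point)
  then have "d z z' \<le> 0"
    using assms(5-7) dist_sym[OF assms(1,3)] dist_sym[OF assms(1,4)] by linarith
  then have "d z z' = 0" using dist_nonneg[OF assms(3,4)] by simp
  then show ?thesis using dist_eq_0[OF assms(3,4)] by simp
qed

section \<open>Bi-infinite geodesics and nearest-point projections\<close>

definition line :: "(int \<Rightarrow> 'x) \<Rightarrow> bool" where
  "line \<gamma> \<longleftrightarrow> range \<gamma> \<subseteq> X \<and> (\<forall>i j. d (\<gamma> i) (\<gamma> j) = \<bar>i - j\<bar>)"

lemma line_in [intro]: "line \<gamma> \<Longrightarrow> \<gamma> i \<in> X"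
  by (auto simp: line_def)

lemma line_dist: "line \<gamma> \<Longrightarrow> d (\<gamma> i) (\<gamma> j) = \<bar>i - j\<bar>"
  by (simp add: line_def)

lemma line_reverse: "line \<gamma> \<Longrightarrow> line (\<lambda>i. \<gamma> (- i))"
  by (auto simp: line_def)

lemma line_shift: "line \<gamma> \<Longrightarrow> line (\<lambda>i. \<gamma> (i + c))"
  by (auto simp: line_def)

text \<open>Along the line the distance to x changes by exactly one at each step, by parity, and is
  convex by the four-point condition. From a minimum it therefore grows with slope one in both
  directions.\<close>

lemma ex_projection:
  assumes "line \<gamma>" "x \<in> X"
  shows "\<exists>p D. 0 \<le> D \<and> (\<forall>i. d x (\<gamma> i) = D + \<bar>i - p\<bar>)"
proof -
  define f where "f i = d x (\<gamma> i)" for i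
  have f_nonneg: "0 \<le> f i" for i
    unfolding f_def by (intro dist_nonneg assms line_in)
  obtain p where p: "nat (f p) \<le> nat (f i)" for i
    using ex_has_least_nat[of "\<lambda>_. True" 0 "\<lambda>i. nat (f i)"] by auto
  then have min: "f p \<le> f i" for i using f_nonneg[of p] f_nonneg[of i] by (meson nat_le_eq_zle order_trans nle_le)
  have step: "\<bar>f i - f j\<bar> = 1" if "\<bar>i - j\<bar> = 1" for i j
  proof -
    have "even (d x (\<gamma> i) + d (\<gamma> i) (\<gamma> j) + d x (\<gamma> j))"
      by (intro parity assms(2) line_in[OF assms(1)])
    then have "odd (f i + f j)" using that line_dist[OF assms(1), of i j] by (auto simp: f_def)
    then have "f i \<noteq> f j" by auto
    moreover have "f i \<le> f j + 1" "f j \<le> f i + 1"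
      using triangle[of x "\<gamma> i" "\<gamma> j"] triangle[of x "\<gamma> j" "\<gamma> i"] assms line_in[OF assms(1)]
        line_dist[OF assms(1), of i j] line_dist[OF assms(1), of j i] that
      by (auto simp: f_def)
    ultimately show ?thesis by simp
  qed
  have convex: "f i + 1 \<le> max (f (i - 1)) (f (i + 1))" for i
    using four_point[of x "\<gamma> i" "\<gamma> (i - 1)" "\<gamma> (i + 1)"] assms line_in[OF assms(1)]
    by (simp add: f_def line_dist)
  have up: "f (p + int n) = f p + int n" for n
  proof (induction n rule: less_induct)
    case (less n)
    consider "n = 0" | "n = 1" | m where "n = Suc (Suc m)"
      by (metis One_nat_def old.nat.exhaust)
    then show ?case
    proof cases
      case 2
      then show ?thesis using step[of "p + 1" p] min[of "p + 1"] by simp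
    next
      case (3 m)
      then show ?thesis
        using less.IH[of m] less.IH[of "Suc m"] convex[of "p + int (Suc m)"]
          step[of "p + int n" "p + int (Suc m)"]
        by (simp add: algebra_simps)
    qed simp
  qed
  have down: "f (p - int n) = f p + int n" for n
  proof (induction n rule: less_induct)
    case (less n)
    consider "n = 0" | "n = 1" | m where "n = Suc (Suc m)"
      by (metis One_nat_def old.nat.exhaust)
    then show ?case
    proof cases
      case 2
      then show ?thesis using step[of "p - 1" p] min[of "p - 1"] by simp
    next
      case (3 m)
      then show ?thesis
        using less.IH[of m] less.IH[of "Suc m"] convex[of "p - int (Suc m)"]
          step[of "p - int n" "p - int (Suc m)"]
        by (simp add: algebra_simps)
    qed simp
  qed
  have "f i = f p + \<bar>i - p\<bar>" for i
    using up[of "nat (i - p)"] down[of "nat (p - i)"] by (cases "i \<ge> p") auto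
  then show ?thesis using f_nonneg[of p] unfolding f_def by blast
qed

definition proj :: "(int \<Rightarrow> 'x) \<Rightarrow> 'x \<Rightarrow> int" where
  "proj \<gamma> x = (SOME p. \<forall>i. d x (\<gamma> i) = d x (\<gamma> p) + \<bar>i - p\<bar>)"

lemma dist_line:
  assumes "line \<gamma>" "x \<in> X"
  shows "d x (\<gamma> i) = d x (\<gamma> (proj \<gamma> x)) + \<bar>i - proj \<gamma> x\<bar>"
proof -
  obtain p D where pD: "d x (\<gamma> i) = D + \<bar>i - p\<bar>" for i
    using ex_projection[OF assms] by blast
  have "d x (\<gamma> p) = D" using pD[of p] by simp
  with pD have "\<exists>p. \<forall>i. d x (\<gamma> i) = d x (\<gamma> p) + \<bar>i - p\<bar>" by (intro exI[of _ p]) simp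
  from someI_ex[OF this] show ?thesis unfolding proj_def by blast
qed

lemma proj_eqI:
  assumes "line \<gamma>" "x \<in> X" "\<And>i. d x (\<gamma> i) = D + \<bar>i - p\<bar>"
  shows "proj \<gamma> x = p"
  using dist_line[OF assms(1,2), of p] assms(3)[of p] assms(3)[of "proj \<gamma> x"] by linarith

lemma proj_line: "line \<gamma> \<Longrightarrow> proj \<gamma> (\<gamma> i) = i"
  by (rule proj_eqI[where D = 0]) (auto simp: line_dist)

lemma proj_reverse:
  assumes "line \<gamma>" "x \<in> X"
  shows "proj (\<lambda>i. \<gamma> (- i)) x = - proj \<gamma> x"
proof (rule proj_eqI[OF line_reverse[OF assms(1)] assms(2)])
  show "d x (\<gamma> (- i)) = d x (\<gamma> (proj \<gamma> x)) + \<bar>i - - proj \<gamma> x\<bar>" for i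
    using dist_line[OF assms, of "- i"] by linarith
qed

lemma proj_shift:
  assumes "line \<gamma>" "x \<in> X"
  shows "proj (\<lambda>i. \<gamma> (i + c)) x = proj \<gamma> x - c"
proof (rule proj_eqI[OF line_shift[OF assms(1)] assms(2)])
  show "d x (\<gamma> (i + c)) = d x (\<gamma> (proj \<gamma> x)) + \<bar>i - (proj \<gamma> x - c)\<bar>" for i
    using dist_line[OF assms, of "i + c"] by linarith
qed

text \<open>The four-point condition for x, y and their two distinct projections leaves only one way
  to be satisfied: the path from x to y enters the line at one projection and leaves it at the
  other.\<close>

lemma dist_through_line:
  assumes "line \<gamma>" "x \<in> X" "y \<in> X" "proj \<gamma> x \<noteq> proj \<gamma> y"
  shows "d x y = d x (\<gamma> (proj \<gamma> x)) + d (\<gamma> (proj \<gamma> x)) y"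
proof -
  let ?p = "proj \<gamma> x" and ?q = "proj \<gamma> y"
  have X: "\<gamma> ?p \<in> X" "\<gamma> ?q \<in> X" using assms(1) by auto
  have "d x (\<gamma> ?q) + d y (\<gamma> ?p) \<le> max (d x y + d (\<gamma> ?q) (\<gamma> ?p)) (d x (\<gamma> ?p) + d (\<gamma> ?q) y)"
    using four_point[of x "\<gamma> ?q" y "\<gamma> ?p"] assms X by simp
  then have "d x (\<gamma> ?p) + \<bar>?q - ?p\<bar> + d y (\<gamma> ?q) \<le> d x y"
    using dist_line[OF assms(1,2), of ?q] dist_line[OF assms(1,3), of ?p] assms(4)
      line_dist[OF assms(1), of ?q ?p] dist_sym[OF X(2) assms(3)] by linarith
  then show ?thesis
    using triangle[OF assms(2) X(1) assms(3)] dist_line[OF assms(1,3), of ?p]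
      dist_sym[OF assms(3) X(1)] by linarith
qed

lemma dist_between:
  assumes "line \<gamma>" "x \<in> X" "y \<in> X" "proj \<gamma> x < proj \<gamma> y" "proj \<gamma> x \<le> i" "i \<le> proj \<gamma> y"
  shows "d x (\<gamma> i) + d (\<gamma> i) y = d x y"
  using dist_through_line[OF assms(1-3)] assms(4-6) dist_line[OF assms(1,2), of i]
    dist_line[OF assms(1,3), of i] dist_line[OF assms(1,3), of "proj \<gamma> x"]
    dist_sym[OF assms(3) line_in[OF assms(1)], of i]
    dist_sym[OF assms(3) line_in[OF assms(1)], of "proj \<gamma> x"] by linarith

text \<open>A point whose projection to \<open>\<gamma>\<close> avoids the projection of \<open>\<delta>\<close> reaches \<open>\<delta>\<close> through \<open>\<gamma>\<close>.\<close>

lemma proj_via_line: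
  assumes "line \<gamma>" "line \<delta>" "x \<in> X" "\<And>j. proj \<gamma> (\<delta> j) \<noteq> proj \<gamma> x"
  shows "proj \<delta> x = proj \<delta> (\<gamma> (proj \<gamma> x))"
proof (rule proj_eqI[OF assms(2,3)])
  fix i
  let ?y = "\<gamma> (proj \<gamma> x)"
  have "d x (\<delta> i) = d x ?y + d ?y (\<delta> i)"
    using dist_through_line[OF assms(1,3), of "\<delta> i"] assms(4)[of i] assms(2) by auto
  also have "d ?y (\<delta> i) = d ?y (\<delta> (proj \<delta> ?y)) + \<bar>i - proj \<delta> ?y\<bar>"
    using dist_line[OF assms(2), of ?y] assms(1) by auto
  finally show "d x (\<delta> i) = (d x ?y + d ?y (\<delta> (proj \<delta> ?y))) + \<bar>i - proj \<delta> ?y\<bar>" by simp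
qed

text \<open>Beyond the shadow of \<delta>, moving along \<gamma> changes the distances to all points
  of \<delta> by the same amount, so the projection to \<delta> is constant there. Only finitely
  many parameters remain.\<close>

lemma bounded_proj_sym:
  assumes "line \<gamma>" "line \<delta>" "\<And>j. \<bar>proj \<gamma> (\<delta> j)\<bar> \<le> M"
  shows "\<exists>M'. \<forall>i. \<bar>proj \<delta> (\<gamma> i)\<bar> \<le> M'"
proof -
  have M: "0 \<le> M" using assms(3)[of 0] by simp
  have far: "d (\<gamma> i) (\<delta> j) = \<bar>i - k\<bar> + d (\<gamma> k) (\<delta> j)"
    if "(i \<ge> k \<and> k > M) \<or> (i \<le> k \<and> k < - M)" for i j k
    using dist_line[OF assms(1) line_in[OF assms(2)], of j i]
      dist_line[OF assms(1) line_in[OF assms(2)], of j k]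
      dist_sym[OF line_in[OF assms(1)] line_in[OF assms(2)], of i j]
      dist_sym[OF line_in[OF assms(1)] line_in[OF assms(2)], of k j] assms(3)[of j] that
    by linarith
  have far_proj: "proj \<delta> (\<gamma> i) = proj \<delta> (\<gamma> k)"
    if "(i \<ge> k \<and> k > M) \<or> (i \<le> k \<and> k < - M)" for i k
  proof (rule proj_eqI[OF assms(2) line_in[OF assms(1)]])
    fix j
    show "d (\<gamma> i) (\<delta> j) = (\<bar>i - k\<bar> + d (\<gamma> k) (\<delta> (proj \<delta> (\<gamma> k)))) + \<bar>j - proj \<delta> (\<gamma> k)\<bar>"
      using far[OF that, of j] dist_line[OF assms(2) line_in[OF assms(1)], of k j] by simp
  qed
  define K where "K = {- M - 1..M + 1}"
  define M' where "M' = Max ((\<lambda>i. \<bar>proj \<delta> (\<gamma> i)\<bar>) ` K)"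
  have near: "\<bar>proj \<delta> (\<gamma> i)\<bar> \<le> M'" if "i \<in> K" for i
    unfolding M'_def using that by (intro Max_ge) (auto simp: K_def)
  have "\<bar>proj \<delta> (\<gamma> i)\<bar> \<le> M'" for i
  proof -
    consider "i \<in> K" | "i \<ge> M + 1" | "i \<le> - M - 1" unfolding K_def by fastforce
    then show ?thesis
    proof cases
      case 2
      then show ?thesis using far_proj[of "M + 1" i] near[of "M + 1"] M by (simp add: K_def)
    next
      case 3
      then show ?thesis using far_proj[of "- M - 1" i] near[of "- M - 1"] M by (simp add: K_def)
    qed (rule near)
  qed
  then show ?thesis by blast
qed

text \<open>The point of \<gamma> lies on the geodesic between two points of \<delta>, and \<delta>
  itself has a point at the same position on that geodesic.\<close>

lemma line_common_segment:
  assumes "line \<gamma>" "line \<delta>" "proj \<gamma> (\<delta> j) < proj \<gamma> (\<delta> k)"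
    "proj \<gamma> (\<delta> j) \<le> i" "i \<le> proj \<gamma> (\<delta> k)"
  shows "\<gamma> i \<in> range \<delta>"
proof -
  note X = line_in[OF assms(1)] line_in[OF assms(2)]
  define s where "s = d (\<delta> j) (\<gamma> i)"
  have s: "s + d (\<gamma> i) (\<delta> k) = \<bar>j - k\<bar>"
    using dist_between[OF assms(1) X(2) X(2) assms(3-5)] line_dist[OF assms(2)] by (simp add: s_def)
  have nonneg: "0 \<le> s" "0 \<le> d (\<gamma> i) (\<delta> k)" using X by (auto simp: s_def intro: dist_nonneg)
  define m where "m = (if j \<le> k then j + s else j - s)"
  have "\<gamma> i = \<delta> m"
  proof (rule geodesic_unique[of "\<delta> j" "\<delta> k"])
    show "d (\<delta> j) (\<gamma> i) + d (\<gamma> i) (\<delta> k) = d (\<delta> j) (\<delta> k)"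
      using s line_dist[OF assms(2)] by (simp add: s_def)
    show "d (\<delta> j) (\<delta> m) = d (\<delta> j) (\<gamma> i)" "d (\<delta> m) (\<delta> k) = d (\<gamma> i) (\<delta> k)"
      using s nonneg line_dist[OF assms(2)] by (auto simp: m_def s_def[symmetric] split: if_splits)
  qed (use X in auto)
  then show ?thesis by blast
qed

end

lemma int_isometry_ray:
  fixes u :: "nat \<Rightarrow> int"
  assumes u: "\<And>m n. \<bar>u m - u n\<bar> = \<bar>int m - int n\<bar>"
  shows "\<exists>e\<in>{1, -1}. \<forall>m. u m = u 0 + e * int m"
proof (intro bexI allI)
  fix m
  have "u 1 - u 0 = 1 \<or> u 1 - u 0 = - 1" using u[of 1 0] by linarith
  then show "u m = u 0 + (u 1 - u 0) * int m"
    using u[of m 0] u[of m 1] by (cases m) auto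
qed (use u[of 1 0] in auto)

section \<open>Isometries of trees: axes and elliptic points\<close>

locale tree_action = group_action G X \<phi> + tree_metric X d
  for G (structure) and X :: "'x set" and \<phi> and d +
  assumes isometry: "g \<in> carrier G \<Longrightarrow> x \<in> X \<Longrightarrow> y \<in> X \<Longrightarrow> d (\<phi> g x) (\<phi> g y) = d x y"
begin

sublocale group G
  using group_hom group_hom.axioms(1) by blast

lemma act_in [simp]: "g \<in> carrier G \<Longrightarrow> x \<in> X \<Longrightarrow> \<phi> g x \<in> X"
  by (rule element_image) auto

lemma act_one [simp]: "x \<in> X \<Longrightarrow> \<phi> \<one> x = x"
  using fun_cong[OF id_eq_one, of x] by simp

lemma act_mult: "g \<in> carrier G \<Longrightarrow> h \<in> carrier G \<Longrightarrow> x \<in> X \<Longrightarrow> \<phi> (g \<otimes> h) x = \<phi> g (\<phi> h x)"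
  by (rule composition_rule)

lemma act_inv_act [simp]: "g \<in> carrier G \<Longrightarrow> x \<in> X \<Longrightarrow> \<phi> (inv g) (\<phi> g x) = x"
  by (simp add: act_mult[symmetric])

lemma act_pow_add:
  "g \<in> carrier G \<Longrightarrow> x \<in> X \<Longrightarrow> \<phi> (g [^] (j + k :: int)) x = \<phi> (g [^] j) (\<phi> (g [^] k) x)"
  by (simp add: int_pow_mult act_mult)

lemma act_pow_fixed:
  assumes "g \<in> carrier G" "x \<in> X" "\<phi> g x = x"
  shows "\<phi> (g [^] (k :: int)) x = x"
proof -
  have nat: "\<phi> (g [^] (n :: nat)) x = x" for n
    by (induction n) (use assms in \<open>auto simp: act_mult\<close>)
  obtain n where "k = int n \<or> k = - int n" by (cases k rule: int_cases2) auto
  then show ?thesis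
  proof
    assume "k = - int n"
    then show ?thesis using act_inv_act[of "g [^] n" x] nat[of n] assms
      by (simp add: int_pow_neg int_pow_int)
  qed (simp add: int_pow_int nat)
qed

text \<open>A hyperbolic element with its axis, parametrised in the direction of motion, and its
  translation length.\<close>

definition translates :: "'a \<Rightarrow> (int \<Rightarrow> 'x) \<Rightarrow> int \<Rightarrow> bool" where
  "translates g \<gamma> l \<longleftrightarrow> line \<gamma> \<and> 0 < l \<and> (\<forall>i. \<phi> g (\<gamma> i) = \<gamma> (i + l))"

lemma translates_pow:
  assumes "g \<in> carrier G" "translates g \<gamma> l"
  shows "\<phi> (g [^] (k :: int)) (\<gamma> i) = \<gamma> (i + k * l)"
proof -
  have X: "\<gamma> i \<in> X" for i using assms(2) by (auto simp: translates_def)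
  have nat: "\<phi> (g [^] (n :: nat)) (\<gamma> i) = \<gamma> (i + int n * l)" for n i
  proof (induction n arbitrary: i)
    case (Suc n)
    then show ?case
      using assms X by (simp add: act_mult translates_def algebra_simps)
  qed (use X in simp)
  obtain n where "k = int n \<or> k = - int n" by (cases k rule: int_cases2) auto
  then show ?thesis
  proof
    assume "k = - int n"
    then show ?thesis
      using act_inv_act[of "g [^] n" "\<gamma> (i - int n * l)"] nat[of n "i - int n * l"] assms X
      by (simp add: int_pow_neg int_pow_int)
  qed (simp add: int_pow_int nat)
qed

lemma proj_translates:
  assumes "g \<in> carrier G" "translates g \<gamma> l" "x \<in> X"
  shows "proj \<gamma> (\<phi> (g [^] (k :: int)) x) = proj \<gamma> x + k * l"
proof (rule proj_eqI)
  fix i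
  have \<gamma>: "line \<gamma>" using assms(2) by (simp add: translates_def)
  have "\<gamma> i = \<phi> (g [^] k) (\<gamma> (i - k * l))" using translates_pow[OF assms(1,2)] by simp
  then have "d (\<phi> (g [^] k) x) (\<gamma> i) = d x (\<gamma> (i - k * l))"
    using isometry[of "g [^] k" x "\<gamma> (i - k * l)"] assms \<gamma> by auto
  then show "d (\<phi> (g [^] k) x) (\<gamma> i) = d x (\<gamma> (proj \<gamma> x)) + \<bar>i - (proj \<gamma> x + k * l)\<bar>"
    using dist_line[OF \<gamma> assms(3), of "i - k * l"] by (simp add: algebra_simps)
qed (use assms in \<open>auto simp: translates_def\<close>)

lemma translates_reverse:
  assumes "g \<in> carrier G" "translates g \<gamma> l"
  shows "translates (inv g) (\<lambda>i. \<gamma> (- i)) l"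
  unfolding translates_def
proof (intro conjI allI)
  fix i
  have "\<phi> (inv g) (\<phi> g (\<gamma> (- i - l))) = \<gamma> (- i - l)"
    using assms by (intro act_inv_act) (auto simp: translates_def)
  then show "\<phi> (inv g) (\<gamma> (- i)) = \<gamma> (- (i + l))"
    using assms by (simp add: translates_def)
qed (use assms in \<open>auto simp: translates_def line_reverse\<close>)

lemma translates_shift:
  "translates g \<gamma> l \<Longrightarrow> translates g (\<lambda>i. \<gamma> (i + c)) l"
  by (auto simp: translates_def line_shift algebra_simps)

text \<open>The exponent depends on the point because the fixed sets of powers may keep growing and
  no single power need realise them all; the ping-pong sets have to take all powers into account at
  once.\<close>

definition elliptic_points :: "'a \<Rightarrow> 'x set" where
  "elliptic_points g = {x \<in> X. \<exists>n::nat. n \<ge> 1 \<and> \<phi> (g [^] n) x = x}"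

lemma elliptic_pointsI:
  assumes "g \<in> carrier G" "x \<in> X" "(k :: int) \<noteq> 0" "\<phi> (g [^] k) x = x"
  shows "x \<in> elliptic_points g"
proof -
  have "\<phi> (g [^] \<bar>k\<bar>) x = x"
  proof (cases "k \<ge> 0")
    case False
    then show ?thesis using act_inv_act[of "g [^] k" x] assms by (simp add: int_pow_neg)
  qed (use assms in simp)
  then have "\<phi> (g [^] nat \<bar>k\<bar>) x = x" using int_pow_int[of G g "nat \<bar>k\<bar>"] by simp
  then show ?thesis using assms by (auto simp: elliptic_points_def intro!: exI[of _ "nat \<bar>k\<bar>"])
qed

text \<open>Local geodesics in a tree are geodesics: once the path does not fold at the first orbit
  point, the four-point condition for the points with indices 0, n - 2, n - 1 and n propagates the
  distance by induction.\<close>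

lemma dist_orbit:
  assumes g: "g \<in> carrier G" and x: "x \<in> X" and L: "d x (\<phi> g x) = L" "0 < L"
    and d2: "d x (\<phi> (g [^] (2::int)) x) = 2 * L"
  shows "d (\<phi> (g [^] (j::int)) x) (\<phi> (g [^] (k::int)) x) = \<bar>j - k\<bar> * L"
proof -
  define o' where "o' k = \<phi> (g [^] (k::int)) x" for k
  have X: "o' k \<in> X" for k using g x by (simp add: o'_def)
  have inv: "d (o' (j + m)) (o' (k + m)) = d (o' j) (o' k)" for j k m
    using isometry[of "g [^] m" "o' j" "o' k"] X g x
    by (simp add: o'_def act_pow_add[symmetric] add.commute)
  have nat: "d (o' 0) (o' (int n)) = int n * L" for n
  proof (induction n rule: less_induct)
    case (less n)
    consider "n = 0" | "n = 1" | "n = 2" | m where "n = Suc (Suc (Suc m))"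
      by (metis One_nat_def Suc_1 old.nat.exhaust)
    then show ?case
    proof cases
      case (4 m)
      have "d (o' 0) (o' (int (Suc (Suc m)))) + d (o' (int (Suc m))) (o' (int n))
          \<le> max (d (o' 0) (o' (int (Suc m))) + d (o' (int (Suc (Suc m)))) (o' (int n)))
            (d (o' 0) (o' (int n)) + d (o' (int (Suc (Suc m)))) (o' (int (Suc m))))"
        by (intro four_point X)
      moreover have "d (o' (int (Suc m))) (o' (int n)) = 2 * L"
        "d (o' (int (Suc (Suc m)))) (o' (int n)) = L"
        "d (o' (int (Suc (Suc m)))) (o' (int (Suc m))) = L"
        using inv[of 0 "int (Suc m)" 2] inv[of 0 "int (Suc (Suc m))" 1] inv[of 0 "int (Suc m)" 1]
          d2 L g x 4 dist_sym[OF X X, of "int (Suc (Suc m))" "int (Suc m)"]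
        by (simp_all add: o'_def int_pow_1 add.commute)
      moreover have "d (o' 0) (o' (int n)) \<le> d (o' 0) (o' (int (Suc (Suc m)))) + d (o' (int (Suc (Suc m)))) (o' (int n))"
        by (intro triangle X)
      ultimately show ?thesis
        using less.IH[of "Suc m"] less.IH[of "Suc (Suc m)"] 4 L by (simp add: algebra_simps)
    qed (use L d2 g x dist_refl in \<open>auto simp: o'_def int_pow_1\<close>)
  qed
  have le: "d (o' j) (o' k) = (k - j) * L" if "j \<le> k" for j k
    using inv[of 0 j "k - j"] nat[of "nat (k - j)"] that by simp
  show ?thesis
    using le[of j k] le[of k j] dist_sym[OF X X, of j k] unfolding o'_def[symmetric]
    by (cases "j \<le> k") auto
qed

text \<open>
  If \<open>g\<close> moved a point \<open>x\<close> of minimal displacement but folded the path from \<open>x\<close> to \<open>g x\<close>, the first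
  vertex of that path would be moved less, or \<open>g\<close> would invert an edge.
\<close>

lemma elliptic_or_translates:
  assumes g: "g \<in> carrier G" and X: "X \<noteq> {}"
  shows "elliptic_points g \<noteq> {} \<or> (\<exists>\<gamma> l. translates g \<gamma> l)"
proof (cases "elliptic_points g = {}")
  case ell: True
  obtain x0 where "x0 \<in> X" using X by blast
  then obtain x where x: "x \<in> X" and "\<And>y. y \<in> X \<Longrightarrow> nat (d x (\<phi> g x)) \<le> nat (d y (\<phi> g y))"
    using ex_has_least_nat[of "\<lambda>x. x \<in> X" x0 "\<lambda>x. nat (d x (\<phi> g x))"] by auto
  then have min: "d x (\<phi> g x) \<le> d y (\<phi> g y)" if "y \<in> X" for y
    using that dist_nonneg[of y "\<phi> g y"] g by fastforce
  define L where "L = d x (\<phi> g x)"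
  have not_ell: "\<phi> (g [^] (k::int)) y \<noteq> y" if "k \<noteq> 0" "y \<in> X" for k y
    using elliptic_pointsI[OF g that(2,1)] ell by auto
  have L: "0 < L"
    using not_ell[of 1 x] x g dist_nonneg[of x "\<phi> g x"] dist_eq_0[of x "\<phi> g x"]
    by (auto simp: L_def int_pow_1)
  define gx ggx where "gx = \<phi> g x" and "ggx = \<phi> g gx"
  have in_X: "gx \<in> X" "ggx \<in> X" using x g by (auto simp: gx_def ggx_def)
  have ggx: "ggx = \<phi> (g [^] (2::int)) x"
    using act_pow_add[OF g x, of 1 1] g by (simp add: ggx_def gx_def int_pow_1)
  have dgx: "d x gx = L" "d gx ggx = L"
    using isometry[OF g x in_X(1)] by (auto simp: L_def gx_def ggx_def)
  have d2: "d x ggx = 2 * L"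
  proof (rule ccontr)
    assume "d x ggx \<noteq> 2 * L"
    moreover have "d x ggx \<le> 2 * L" using triangle[OF x in_X] dgx by simp
    moreover have "even (d x ggx)" using parity[OF x in_X] dgx by simp
    ultimately have fold: "d x ggx \<le> 2 * L - 2" by (auto elim!: evenE)
    \<comment> \<open>Here z is the first vertex on the way back from g x, and y the first vertex on
      the way from x to g x. Folding at g x forces z to be the image of y. For L = 1 this makes the
      square of g fix x, and otherwise y is moved less than x.\<close>
    obtain z where z: "z \<in> X" "d gx z = 1" "d z x = L - 1"
      using geodesic[OF in_X(1) x, of 1] L dgx dist_sym[OF x in_X(1)] by auto
    obtain y where y: "y \<in> X" "d x y = 1" "d y gx = L - 1"
      using geodesic[OF x in_X(1), of 1] L dgx by auto
    have gy: "\<phi> g y \<in> X" "d gx (\<phi> g y) = 1" "d (\<phi> g y) ggx = L - 1"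
      using y isometry[OF g x y(1)] isometry[OF g y(1) in_X(1)] g by (auto simp: gx_def ggx_def)
    have "d z ggx \<le> L - 1"
      using four_point[OF z(1) in_X(2) x in_X(1)] fold z dgx dist_sym[OF x in_X(1)]
        dist_sym[OF in_X] dist_sym[OF z(1) in_X(1)] dist_sym[OF in_X(2) x] by auto
    then have "d z (\<phi> g y) \<le> 0"
      using four_point[OF z(1) gy(1) in_X] z gy dgx dist_sym[OF z(1) in_X(1)]
        dist_sym[OF gy(1) in_X(1)] by auto
    then have zy: "z = \<phi> g y" using dist_nonneg[OF z(1) gy(1)] dist_eq_0[OF z(1) gy(1)] by simp
    show False
    proof (cases "L = 1")
      case True
      then have "y = gx" "z = x" using y z in_X x by (auto simp: dist_eq_0)
      then show False using zy not_ell[of 2 x] x ggx by (simp add: ggx_def)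
    next
      case False
      have "d y z \<le> L - 2"
        using four_point[OF y(1) z(1) x in_X(1)] False L y z dgx dist_sym[OF x y(1)]
          dist_sym[OF z(1) in_X(1)] by auto
      then show False using min[OF y(1)] zy by (simp add: L_def)
    qed
  qed
  have orb: "d (\<phi> (g [^] (j::int)) x) (\<phi> (g [^] (k::int)) x) = \<bar>j - k\<bar> * L" for j k
    using dist_orbit[OF g x _ L] d2 by (simp add: L_def ggx)
  have "\<forall>r. \<exists>z. 0 \<le> r \<and> r \<le> L \<longrightarrow> z \<in> X \<and> d x z = r \<and> d z gx = L - r"
    using geodesic[OF x in_X(1)] dgx by metis
  then obtain \<sigma> where \<sigma>: "\<And>r. 0 \<le> r \<Longrightarrow> r \<le> L \<Longrightarrow> \<sigma> r \<in> X \<and> d x (\<sigma> r) = r \<and> d (\<sigma> r) gx = L - r"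
    by metis
  have \<sigma>_mod: "\<sigma> (i mod L) \<in> X" "d x (\<sigma> (i mod L)) = i mod L" "d (\<sigma> (i mod L)) gx = L - i mod L" for i
    using \<sigma>[of "i mod L"] L pos_mod_bound[OF L, of i] by auto
  \<comment> \<open>The axis consists of the translates of one geodesic from x to g x;
    \<open>div\<close> selects the translate and \<open>mod\<close> the position in it.\<close>
  define \<gamma> where "\<gamma> i = \<phi> (g [^] (i div L)) (\<sigma> (i mod L))" for i
  have \<gamma>_X: "\<gamma> i \<in> X" for i
    using \<sigma>_mod g by (simp add: \<gamma>_def)
  have near: "d (\<phi> (g [^] (i div L)) x) (\<gamma> i) = i mod L"
    "d (\<gamma> i) (\<phi> (g [^] (i div L + 1)) x) = L - i mod L" for i
    using \<sigma>_mod[of i] g x in_X isometry[of "g [^] (i div L)"] act_pow_add[OF g x, of "i div L" 1]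
    by (auto simp: \<gamma>_def gx_def int_pow_1)
  \<comment> \<open>Measuring from two distant orbit points places every \<gamma> i on the geodesic
    between them, from which the mutual distances follow.\<close>
  have far: "d (\<phi> (g [^] (- N)) x) (\<gamma> i) = N * L + i" "d (\<gamma> i) (\<phi> (g [^] N) x) = N * L - i"
    if N: "\<bar>i\<bar> < N" for N i
  proof -
    let ?q = "i div L" and ?o = "\<lambda>k. \<phi> (g [^] (k::int)) x"
    have "\<bar>?q\<bar> \<le> \<bar>i\<bar>"
      using L by (smt (verit) div_by_1 div_minus_minus int_div_less_self pos_imp_zdiv_neg_iff
          pos_imp_zdiv_nonneg_iff zdiv_mono2 zdiv_mono2_neg div_0)
    then have q: "- N \<le> ?q" "?q + 1 \<le> N" using N by linarith+
    have oX: "?o k \<in> X" for k using g x by simp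
    have i: "i = ?q * L + i mod L" by simp
    have 1: "d (?o (- N)) (?o ?q) = (N + ?q) * L" "d (?o (- N)) (?o (?q + 1)) = (N + ?q + 1) * L"
      "d (?o ?q) (?o N) = (N - ?q) * L" "d (?o (?q + 1)) (?o N) = (N - ?q - 1) * L"
      using q by (simp_all add: orb)
    have "d (?o (- N)) (\<gamma> i) \<le> (N + ?q) * L + i mod L"
      using triangle[OF oX[of "- N"] oX[of ?q] \<gamma>_X[of i]] near(1)[of i] 1 by simp
    moreover have "(N + ?q + 1) * L \<le> d (?o (- N)) (\<gamma> i) + (L - i mod L)"
      using triangle[OF oX[of "- N"] \<gamma>_X[of i] oX[of "?q + 1"]] near(2)[of i] 1 by simp
    ultimately have "d (?o (- N)) (\<gamma> i) = (N + ?q) * L + i mod L" by (simp add: algebra_simps)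
    then show "d (?o (- N)) (\<gamma> i) = N * L + i" by (subst (2) i) (simp add: algebra_simps)
    have "d (\<gamma> i) (?o N) \<le> (N - ?q - 1) * L + (L - i mod L)"
      using triangle[OF \<gamma>_X[of i] oX[of "?q + 1"] oX[of N]] near(2)[of i] 1 by simp
    moreover have "(N - ?q) * L \<le> i mod L + d (\<gamma> i) (?o N)"
      using triangle[OF oX[of ?q] \<gamma>_X[of i] oX[of N]] near(1)[of i] 1 by simp
    ultimately have "d (\<gamma> i) (?o N) = (N - ?q) * L - i mod L" by (simp add: algebra_simps)
    then show "d (\<gamma> i) (?o N) = N * L - i" by (subst (2) i) (simp add: algebra_simps)
  qed
  have "line \<gamma>"
    unfolding line_def
  proof (intro conjI allI)
    fix i j :: int
    define N where "N = \<bar>i\<bar> + \<bar>j\<bar> + 1"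
    have N: "\<bar>i\<bar> < N" "\<bar>j\<bar> < N" by (auto simp: N_def)
    define a b where "a = \<phi> (g [^] (- N)) x" and "b = \<phi> (g [^] N) x"
    have ab: "a \<in> X" "b \<in> X" "d a b = 2 * N * L" using g x orb[of "- N" N] N by (auto simp: a_def b_def)
    have f: "d a (\<gamma> i) = N * L + i" "d (\<gamma> i) b = N * L - i" "d a (\<gamma> j) = N * L + j" "d (\<gamma> j) b = N * L - j"
      using far N by (auto simp: a_def b_def)
    have "\<bar>i - j\<bar> \<le> d (\<gamma> i) (\<gamma> j)"
      using triangle[OF ab(1) \<gamma>_X[of i] \<gamma>_X[of j]] triangle[OF ab(1) \<gamma>_X[of j] \<gamma>_X[of i]] f
        dist_sym[OF \<gamma>_X[of i] \<gamma>_X[of j]] by linarith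
    moreover have "d (\<gamma> i) (\<gamma> j) \<le> \<bar>i - j\<bar>"
      using four_point[OF \<gamma>_X[of i] \<gamma>_X[of j] ab(1,2)] ab(3) f dist_sym[OF \<gamma>_X[of i] ab(1)]
        dist_sym[OF \<gamma>_X[of j] ab(1)] N by (simp add: algebra_simps)
    ultimately show "d (\<gamma> i) (\<gamma> j) = \<bar>i - j\<bar>" by simp
  qed (use \<gamma>_X in auto)
  moreover have "\<phi> g (\<gamma> i) = \<gamma> (i + L)" for i
  proof -
    have "(i + L) div L = 1 + i div L" using L div_add_self2[of L i] by linarith
    then show ?thesis
      using act_pow_add[OF g \<sigma>_mod(1), of 1 "i div L" i] g by (simp add: \<gamma>_def int_pow_1)
  qed
  ultimately show ?thesis using L unfolding translates_def by blast
qed simp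

section \<open>Ping-pong on a tree and its obstruction\<close>

lemma F2_if_ping_pong:
  assumes gh: "g \<in> carrier G" "h \<in> carrier G" and n: "n \<ge> 1"
    and ne: "{x \<in> X. P x} \<noteq> {}" "{x \<in> X. Q x} \<noteq> {}" and disj: "\<And>x. x \<in> X \<Longrightarrow> P x \<Longrightarrow> \<not> Q x"
    and g: "\<And>k y. k \<noteq> 0 \<Longrightarrow> y \<in> X \<Longrightarrow> Q y \<Longrightarrow> P (\<phi> (g [^] (int n * k)) y)"
    and h: "\<And>k y. k \<noteq> 0 \<Longrightarrow> y \<in> X \<Longrightarrow> P y \<Longrightarrow> Q (\<phi> (h [^] (int n * k)) y)"
  shows "alternative_pair G g h"
proof -
  have pow: "(x [^] n) [^] k = x [^] (int n * k)" if "x \<in> carrier G" for x and k :: int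
    using int_pow_pow[OF that, of "int n" k] by (simp only: int_pow_int)
  have "subgroup_generated G {g [^] n, h [^] n} \<cong> F\<^sub>2"
    by (rule ping_pong[of _ _ "{x \<in> X. P x}" "{x \<in> X. Q x}"])
      (use assms in \<open>auto simp: pow\<close>)
  then show ?thesis using n by (auto simp: alternative_pair_def)
qed

text \<open>The case in which ping-pong fails. The exponents depend on N because an elliptic g may
  need ever larger powers to fix longer segments; that case has b = 0. Inverses are allowed so that
  only one direction of the ray has to be treated.\<close>

definition share_ray :: "'a \<Rightarrow> 'a \<Rightarrow> bool" where
  "share_ray g h \<longleftrightarrow> (\<exists>\<rho> :: nat \<Rightarrow> 'x. \<exists>l::nat. \<exists>g'\<in>{g, inv g}. \<exists>h'\<in>{h, inv h}.
    range \<rho> \<subseteq> X \<and> 0 < l \<and> (\<forall>m. \<phi> h' (\<rho> m) = \<rho> (m + l)) \<and>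
    (\<forall>N. \<exists>a::nat. \<exists>b::nat. a \<ge> 1 \<and> (\<forall>m\<le>N. \<phi> (g' [^] a) (\<rho> m) = \<phi> (h' [^] b) (\<rho> m))))"

text \<open>If the axes have bounded projections to each other, a point projecting far out on one
  axis projects near the centre of the other. The points projecting far out on \<gamma> and on
  \<delta> are therefore disjoint ping-pong sets.\<close>

lemma translates_pair_bounded:
  assumes gh: "g \<in> carrier G" "h \<in> carrier G"
    and \<gamma>: "translates g \<gamma> l" and \<delta>: "translates h \<delta> l'"
    and bnd: "\<And>j. \<bar>proj \<gamma> (\<delta> j)\<bar> \<le> M0"
  shows "alternative_pair G g h"
proof -
  have lines: "line \<gamma>" "line \<delta>" and l: "0 < l" "0 < l'"
    using \<gamma> \<delta> by (auto simp: translates_def)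
  obtain M1 where M1: "\<And>i. \<bar>proj \<delta> (\<gamma> i)\<bar> \<le> M1" using bounded_proj_sym[OF lines bnd] by blast
  define M where "M = max M0 M1"
  have M: "\<bar>proj \<gamma> (\<delta> j)\<bar> \<le> M" "\<bar>proj \<delta> (\<gamma> j)\<bar> \<le> M" for j
    using bnd[of j] M1[of j] by (auto simp: M_def)
  have M_nonneg: "0 \<le> M" using M(1)[of 0] by simp
  \<comment> \<open>A nonzero multiple of 2 M + 1 moves every integer of [-M, M] out of that
    interval.\<close>
  define n where "n = nat (2 * M + 1)"
  have n: "int n = 2 * M + 1" "n \<ge> 1" using M_nonneg by (auto simp: n_def)
  have via: "\<bar>proj \<delta> x\<bar> \<le> M" if x: "x \<in> X" "M < \<bar>proj \<gamma> x\<bar>" for x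
  proof -
    have "proj \<gamma> (\<delta> j) \<noteq> proj \<gamma> x" for j using M(1)[of j] x(2) by auto
    then show ?thesis using proj_via_line[OF lines x(1)] M(2) by simp
  qed
  have via': "\<bar>proj \<gamma> x\<bar> \<le> M" if x: "x \<in> X" "M < \<bar>proj \<delta> x\<bar>" for x
    using via[OF x(1)] x(2) by (cases "M < \<bar>proj \<gamma> x\<bar>") auto
  have far: "M < \<bar>p + int n * k * m\<bar>" if "\<bar>p\<bar> \<le> M" "k \<noteq> 0" "0 < m" for p k m :: int
  proof -
    have "1 \<le> \<bar>k * m\<bar>" using that by (metis abs_ge_self int_one_le_iff_zero_less mult_eq_0_iff order_less_irrefl zero_less_abs_iff)
    then have "int n * 1 \<le> int n * \<bar>k * m\<bar>" by (intro mult_left_mono) auto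
    then have "int n \<le> \<bar>int n * k * m\<bar>" by (simp add: abs_mult mult.assoc)
    with that n show ?thesis by linarith
  qed
  show ?thesis
  proof (rule F2_if_ping_pong[OF gh n(2), where P = "\<lambda>x. M < \<bar>proj \<gamma> x\<bar>" and Q = "\<lambda>x. M < \<bar>proj \<delta> x\<bar>"])
    have "\<gamma> (M + 1) \<in> {x \<in> X. M < \<bar>proj \<gamma> x\<bar>}" "\<delta> (M + 1) \<in> {x \<in> X. M < \<bar>proj \<delta> x\<bar>}"
      using lines M_nonneg by (auto simp: proj_line)
    then show "{x \<in> X. M < \<bar>proj \<gamma> x\<bar>} \<noteq> {}" "{x \<in> X. M < \<bar>proj \<delta> x\<bar>} \<noteq> {}" by blast+
  next
    fix k :: int and y assume "k \<noteq> 0" "y \<in> X" "M < \<bar>proj \<delta> y\<bar>"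
    then show "M < \<bar>proj \<gamma> (\<phi> (g [^] (int n * k)) y)\<bar>"
      using far via' l(1) by (simp add: proj_translates[OF gh(1) \<gamma>])
  next
    fix k :: int and y assume "k \<noteq> 0" "y \<in> X" "M < \<bar>proj \<gamma> y\<bar>"
    then show "M < \<bar>proj \<delta> (\<phi> (h [^] (int n * k)) y)\<bar>"
      using far via l(2) by (simp add: proj_translates[OF gh(2) \<delta>])
  qed (use via in fastforce)
qed

lemma act_nat_pow_ray:
  assumes "g \<in> carrier G" "range \<rho> \<subseteq> X" "\<And>m. \<phi> g (\<rho> m) = \<rho> (m + l)"
  shows "\<phi> (g [^] (n :: nat)) (\<rho> m) = \<rho> (m + n * l)"
proof (induction n arbitrary: m)
  case (Suc n)
  have "\<rho> m \<in> X" for m using assms(2) by auto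
  then show ?case using Suc assms by (simp add: act_mult algebra_simps)
qed (use assms(2) in \<open>auto simp: image_subset_iff\<close>)

text \<open>Unbounded projections make the positive part of \<gamma>, from the projection of
  \<delta> 0 on, a subset of \<delta>. Both elements translate this common ray, after replacing h by
  its inverse if the orientations differ.\<close>

lemma translates_pair_unbounded_above:
  assumes gh: "g \<in> carrier G" "h \<in> carrier G"
    and \<gamma>: "translates g \<gamma> l" and \<delta>: "translates h \<delta> l'"
    and unbd: "\<And>M. \<exists>j. M < proj \<gamma> (\<delta> j)"
  shows "share_ray g h"
proof -
  have lines: "line \<gamma>" "line \<delta>" and l: "0 < l" "0 < l'"
    using \<gamma> \<delta> by (auto simp: translates_def)
  define p where "p = proj \<gamma> (\<delta> 0)"
  have "\<exists>u. \<gamma> (p + int m) = \<delta> u" for m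
  proof -
    obtain j where "p + int m < proj \<gamma> (\<delta> j)" using unbd by blast
    then have "\<gamma> (p + int m) \<in> range \<delta>"
      using line_common_segment[OF lines, of 0 j "p + int m"] by (simp add: p_def)
    then show ?thesis by blast
  qed
  then obtain u where u: "\<And>m. \<gamma> (p + int m) = \<delta> (u m)" by metis
  have "\<bar>u m - u n\<bar> = \<bar>int m - int n\<bar>" for m n
    using line_dist[OF lines(1), of "p + int m" "p + int n"] line_dist[OF lines(2), of "u m" "u n"]
    by (simp add: u)
  then obtain e where e: "e \<in> {1, - 1}" "\<And>m. u m = u 0 + e * int m"
    using int_isometry_ray by blast
  define \<rho> where "\<rho> m = \<gamma> (p + int m)" for m
  have \<rho>_X: "range \<rho> \<subseteq> X" using lines by (auto simp: \<rho>_def)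
  have \<rho>_\<delta>: "\<rho> m = \<delta> (u 0 + e * int m)" for m
    unfolding \<rho>_def u using e(2)[of m] by (rule arg_cong)
  define h' where "h' = (if e = 1 then h else inv h)"
  have h': "h' \<in> {h, inv h}" "h' \<in> carrier G" using gh by (auto simp: h'_def)
  have g_\<rho>: "\<phi> g (\<rho> m) = \<rho> (m + nat l)" for m
    using \<gamma> l by (simp add: \<rho>_def translates_def add.assoc)
  have h_\<rho>: "\<phi> h' (\<rho> m) = \<rho> (m + nat l')" for m
  proof (cases "e = 1")
    case True
    then show ?thesis using \<delta> l by (simp add: \<rho>_\<delta> h'_def translates_def add.assoc)
  next
    case False
    then have e': "e = - 1" using e(1) by simp
    have "\<phi> h (\<delta> (u 0 - int m - l')) = \<delta> (u 0 - int m)" using \<delta> by (simp add: translates_def)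
    then have "\<phi> (inv h) (\<delta> (u 0 - int m)) = \<delta> (u 0 - int m - l')"
      using act_inv_act[OF gh(2), of "\<delta> (u 0 - int m - l')"] lines by auto
    then show ?thesis using l by (simp add: \<rho>_\<delta> h'_def e' algebra_simps)
  qed
  have "\<forall>N. \<exists>a::nat. \<exists>b::nat. a \<ge> 1 \<and> (\<forall>m\<le>N. \<phi> (g [^] a) (\<rho> m) = \<phi> (h' [^] b) (\<rho> m))"
  proof (intro allI exI conjI impI)
    \<comment> \<open>Exchanging the translation lengths as exponents moves the ray by the same
      amount l l' on both sides.\<close>
    show "\<phi> (g [^] nat l') (\<rho> m) = \<phi> (h' [^] nat l) (\<rho> m)" for m
      using act_nat_pow_ray[OF gh(1) \<rho>_X g_\<rho>] act_nat_pow_ray[OF h'(2) \<rho>_X h_\<rho>]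
      by (simp add: mult.commute)
  qed (use l in auto)
  then show ?thesis
    unfolding share_ray_def
    by (intro exI[of _ \<rho>] exI[of _ "nat l'"] bexI[of _ g] bexI[of _ h'])
      (use h' \<rho>_X h_\<rho> l in auto)
qed

lemma share_ray_inv1:
  assumes "g \<in> carrier G" "share_ray (inv g) h"
  shows "share_ray g h"
  using assms unfolding share_ray_def by auto

lemma share_ray_inv2:
  assumes "h \<in> carrier G" "share_ray g (inv h)"
  shows "share_ray g h"
  using assms unfolding share_ray_def by auto

lemma translates_pair:
  assumes gh: "g \<in> carrier G" "h \<in> carrier G"
    and \<gamma>: "translates g \<gamma> l" and \<delta>: "translates h \<delta> l'"
  shows "alternative_pair G g h \<or> share_ray g h"
proof -
  have X: "\<delta> j \<in> X" and line: "line \<gamma>" for j using \<gamma> \<delta> by (auto simp: translates_def)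
  consider "\<forall>M. \<exists>j. M < proj \<gamma> (\<delta> j)" | "\<forall>M. \<exists>j. proj \<gamma> (\<delta> j) < M"
    | M M' where "\<forall>j. proj \<gamma> (\<delta> j) \<le> M" "\<forall>j. M' \<le> proj \<gamma> (\<delta> j)"
    by (meson not_le)
  then show ?thesis
  proof cases
    case 1
    then show ?thesis using translates_pair_unbounded_above[OF gh \<gamma> \<delta>] by blast
  next
    case 2
    have "share_ray (inv g) h"
    proof (rule translates_pair_unbounded_above[OF _ gh(2) translates_reverse[OF gh(1) \<gamma>] \<delta>])
      fix M
      obtain j where "proj \<gamma> (\<delta> j) < - M" using 2 by blast
      then show "\<exists>j. M < proj (\<lambda>i. \<gamma> (- i)) (\<delta> j)" using proj_reverse[OF line X[of j]]
        by (intro exI[of _ j]) simp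
    qed (use gh in simp)
    then show ?thesis using share_ray_inv1 gh by blast
  next
    case 3
    then have "\<bar>proj \<gamma> (\<delta> j)\<bar> \<le> \<bar>M\<bar> + \<bar>M'\<bar>" for j
      using 3(1)[rule_format, of j] 3(2)[rule_format, of j] by linarith
    then show ?thesis using translates_pair_bounded[OF gh \<gamma> \<delta>] by blast
  qed
qed

section \<open>Pairs with an elliptic element\<close>

lemma fixed_between:
  assumes g: "g \<in> carrier G" and X: "x \<in> X" "y \<in> X" "z \<in> X"
    and fixed: "\<phi> g x = x" "\<phi> g y = y" and z: "d x z + d z y = d x y"
  shows "\<phi> g z = z"
  using geodesic_unique[OF X _ z, of "\<phi> g z"] isometry[OF g X(1,3)] isometry[OF g X(3,2)]
    fixed X g by simp

lemma elliptic_points_pow: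
  assumes "g \<in> carrier G" "x \<in> elliptic_points g"
  obtains n :: nat where "n \<ge> 1" "\<And>k::int. \<phi> (g [^] (int n * k)) x = x"
proof -
  obtain n :: nat where n: "n \<ge> 1" "\<phi> (g [^] n) x = x" and x: "x \<in> X"
    using assms by (auto simp: elliptic_points_def)
  have "\<phi> (g [^] (int n * k)) x = x" for k :: int
    using act_pow_fixed[OF _ x n(2), of k] assms int_pow_pow[OF assms(1), of "int n" k]
    by (simp add: int_pow_int)
  with n(1) show ?thesis by (rule that)
qed

text \<open>The product of the exponents for two elliptic points fixes both, hence the stretch of
  the axis between their projections. Choosing the second point far out covers any initial segment
  of the ray.\<close>

lemma elliptic_translates_unbounded_above:
  assumes gh: "g \<in> carrier G" "h \<in> carrier G" and \<delta>: "translates h \<delta> l"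
    and unbd: "\<And>M. \<exists>f\<in>elliptic_points g. M < proj \<delta> f"
  shows "share_ray g h"
proof -
  have line: "line \<delta>" and l: "0 < l" using \<delta> by (auto simp: translates_def)
  obtain f where f: "f \<in> elliptic_points g" using unbd by blast
  define \<rho> where "\<rho> m = \<delta> (proj \<delta> f + int m)" for m
  have \<rho>_X: "\<rho> m \<in> X" for m using line by (auto simp: \<rho>_def)
  have "\<exists>a::nat. a \<ge> 1 \<and> (\<forall>m\<le>N. \<phi> (g [^] a) (\<rho> m) = \<rho> m)" for N
  proof -
    obtain f' where f': "f' \<in> elliptic_points g" "proj \<delta> f + int N < proj \<delta> f'"
      using unbd by blast
    obtain n :: nat where n: "n \<ge> 1" "\<And>k::int. \<phi> (g [^] (int n * k)) f = f"
      using elliptic_points_pow[OF gh(1) f] by blast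
    obtain n' :: nat where n': "n' \<ge> 1" "\<And>k::int. \<phi> (g [^] (int n' * k)) f' = f'"
      using elliptic_points_pow[OF gh(1) f'(1)] by blast
    have X: "f \<in> X" "f' \<in> X" using f f' by (auto simp: elliptic_points_def)
    have "\<phi> (g [^] (n * n')) f = f" "\<phi> (g [^] (n * n')) f' = f'"
      using n(2)[of "int n'"] n'(2)[of "int n"]
      by (simp_all add: int_pow_int[symmetric] mult.commute)
    then have "\<phi> (g [^] (n * n')) (\<rho> m) = \<rho> m" if "m \<le> N" for m
      using fixed_between[OF _ X \<rho>_X, of "g [^] (n * n')" m] gh that f'(2)
        dist_between[OF line X, of "proj \<delta> f + int m"]
      by (simp add: \<rho>_def)
    then show ?thesis using n n' by (intro exI[of _ "n * n'"]) simp
  qed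
  then have "\<forall>N. \<exists>a::nat. \<exists>b::nat. a \<ge> 1 \<and> (\<forall>m\<le>N. \<phi> (g [^] a) (\<rho> m) = \<phi> (h [^] b) (\<rho> m))"
    by (metis \<rho>_X act_one nat_pow_0)
  moreover have "\<phi> h (\<rho> m) = \<rho> (m + nat l)" for m
    using \<delta> l by (simp add: \<rho>_def translates_def add.assoc)
  ultimately show ?thesis
    unfolding share_ray_def
    by (intro exI[of _ \<rho>] exI[of _ "nat l"] bexI[of _ g] bexI[of _ h]) (use \<rho>_X l in auto)
qed

text \<open>
  A power of \<open>g\<close> fixing a point over \<open>0\<close> cannot map a branch beyond \<open>M\<close> to a branch beyond \<open>M\<close>,
  and it maps a branch beyond \<open>M\<close> to one beyond \<open>-M\<close> for at most one exponent \<open>k\<^sub>0\<close>, up to sign.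
\<close>

lemma elliptic_translates_bounded:
  assumes gh: "g \<in> carrier G" "h \<in> carrier G" and \<delta>: "translates h \<delta> l"
    and f: "f \<in> elliptic_points g" "proj \<delta> f = 0"
    and bnd: "\<And>f'. f' \<in> elliptic_points g \<Longrightarrow> \<bar>proj \<delta> f'\<bar> \<le> M"
  shows "alternative_pair G g h"
proof -
  have line: "line \<delta>" and l: "0 < l" using \<delta> by (auto simp: translates_def)
  have M: "0 \<le> M" using bnd[OF f(1)] by simp
  have fX: "f \<in> X" using f by (simp add: elliptic_points_def)
  obtain n :: nat where n: "n \<ge> 1" "\<And>k::int. \<phi> (g [^] (int n * k)) f = f"
    using elliptic_points_pow[OF gh(1) f(1)] by blast
  \<comment> \<open>The first points of the axis beyond M on the two sides. The path from f to any
    point that projects beyond M passes through one of them, and neither is elliptic.\<close>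
  define c where "c s = \<delta> (s * (M + 1))" for s :: int
  have cX: "c s \<in> X" for s using line by (auto simp: c_def)
  have c_not_fixed: "\<phi> (g [^] k) (c s) \<noteq> c s" if "k \<noteq> 0" "s \<in> {1, -1}" for k s :: int
    using elliptic_pointsI[OF gh(1) cX[of s] that(1)] bnd[of "c s"] that(2) M
    by (auto simp: c_def proj_line[OF line])
  have c_f: "d f (c s) = d f (\<delta> 0) + (M + 1)" if "s \<in> {1, -1}" for s
    using dist_line[OF line fX, of "s * (M + 1)"] M that by (auto simp: f(2) c_def)
  have through_c: "d f (c s) + d (c s) x = d f x"
    if x: "x \<in> X" "M < s * proj \<delta> x" "s \<in> {1, -1}" for x s
  proof (cases "s = 1")
    case True
    then show ?thesis using dist_between[OF line fX x(1), of "M + 1"] x f(2) M by (simp add: c_def)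
  next
    case False
    then have s: "s = - 1" using x(3) by simp
    have "proj \<delta> x < proj \<delta> f" using x M s f(2) by simp
    then have "d x (c s) + d (c s) f = d x f"
      using dist_between[OF line x(1) fX, of "- (M + 1)"] x f(2) M s by (simp add: c_def)
    then show ?thesis
      using dist_sym[OF x(1) cX[of s]] dist_sym[OF cX[of s] fX] dist_sym[OF x(1) fX] by linarith
  qed
  have maps_c: "\<phi> (g [^] (int n * k)) (c s) = c t"
    if x: "x \<in> X" "M < s * proj \<delta> x" "M < t * proj \<delta> (\<phi> (g [^] (int n * k)) x)"
      and st: "s \<in> {1, -1}" "t \<in> {1, -1}" for x s t k
  proof -
    let ?g = "g [^] (int n * k)"
    have g: "?g \<in> carrier G" using gh by simp
    have 1: "d f (\<phi> ?g x) = d f x" "d f (\<phi> ?g (c s)) = d f (c s)"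
      "d (\<phi> ?g (c s)) (\<phi> ?g x) = d (c s) x"
      using isometry[OF g fX x(1)] isometry[OF g fX cX] isometry[OF g cX x(1)] n(2) by simp_all
    have 2: "d f (c s) + d (c s) x = d f x" using through_c x st by simp
    have 3: "d f (c t) + d (c t) (\<phi> ?g x) = d f (\<phi> ?g x)" using through_c[of "\<phi> ?g x" t] x st g by simp
    have 4: "d f (c s) = d f (c t)" using c_f st by simp
    show ?thesis
      using geodesic_unique[of f "\<phi> ?g x" "c t" "\<phi> ?g (c s)"] fX x g cX 1 2 3 4 by simp
  qed
  \<comment> \<open>Two such exponents would make a nonzero power of g fix c 1.\<close>
  have "\<exists>k0. \<forall>k. k \<noteq> 0 \<longrightarrow> \<phi> (g [^] (int n * k)) (c 1) = c (- 1) \<longrightarrow> k = k0"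
  proof (rule ccontr)
    assume "\<nexists>k0. \<forall>k. k \<noteq> 0 \<longrightarrow> \<phi> (g [^] (int n * k)) (c 1) = c (- 1) \<longrightarrow> k = k0"
    then obtain k1 k2 where k: "\<phi> (g [^] (int n * k1)) (c 1) = c (- 1)"
      "\<phi> (g [^] (int n * k2)) (c 1) = c (- 1)" "k1 \<noteq> k2"
      by metis
    have "\<phi> (g [^] (- (int n * k1) + int n * k2)) (c 1) = \<phi> (g [^] (- (int n * k1))) (\<phi> (g [^] (int n * k1)) (c 1))"
      using act_pow_add[OF gh(1) cX[of 1], of "- (int n * k1)" "int n * k2"] k by simp
    also have "\<dots> = c 1" using act_inv_act[of "g [^] (int n * k1)" "c 1"] gh cX by (simp add: int_pow_neg)
    finally show False
      using c_not_fixed[of "- (int n * k1) + int n * k2" 1] k(3) n(1) by simp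
  qed
  then obtain k0 where k0: "\<And>k. k \<noteq> 0 \<Longrightarrow> \<phi> (g [^] (int n * k)) (c 1) = c (- 1) \<Longrightarrow> k = k0" by blast
  \<comment> \<open>The first factor makes nonzero multiples of q avoid both signs of k0, so that g
    acts correctly; the second makes the translation by h leave [-M, M].\<close>
  define q where "q = (nat \<bar>k0\<bar> + 1) * nat (2 * M + 1)"
  have q: "q \<ge> 1" "int q = (\<bar>k0\<bar> + 1) * (2 * M + 1)" using M by (auto simp: q_def algebra_simps)
  have q_big: "\<bar>k0\<bar> < \<bar>int q * k\<bar>" "2 * M < \<bar>int q * k\<bar>" if "k \<noteq> 0" for k
  proof -
    have "int q * 1 \<le> int q * \<bar>k\<bar>" using that by (intro mult_left_mono) auto
    moreover have "\<bar>k0\<bar> + 1 \<le> int q" "2 * M + 1 \<le> int q"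
      using M mult_left_mono[of 1 "2 * M + 1" "\<bar>k0\<bar> + 1"] mult_right_mono[of 1 "\<bar>k0\<bar> + 1" "2 * M + 1"]
      unfolding q(2) by auto
    ultimately show "\<bar>k0\<bar> < \<bar>int q * k\<bar>" "2 * M < \<bar>int q * k\<bar>" by (auto simp: abs_mult)
  qed
  show ?thesis
  proof (rule F2_if_ping_pong[OF gh, of "n * q" "\<lambda>x. \<bar>proj \<delta> x\<bar> \<le> M" "\<lambda>x. M < \<bar>proj \<delta> x\<bar>"])
    have "\<delta> 0 \<in> {x \<in> X. \<bar>proj \<delta> x\<bar> \<le> M}" "\<delta> (M + 1) \<in> {x \<in> X. M < \<bar>proj \<delta> x\<bar>}"
      using line M by (auto simp: proj_line)
    then show "{x \<in> X. \<bar>proj \<delta> x\<bar> \<le> M} \<noteq> {}" "{x \<in> X. M < \<bar>proj \<delta> x\<bar>} \<noteq> {}" by blast+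
  next
    fix k :: int and y assume k: "k \<noteq> 0" and y: "y \<in> X" "M < \<bar>proj \<delta> y\<bar>"
    let ?k = "int q * k"
    have exp: "int (n * q) * k = int n * ?k" by simp
    have k': "?k \<noteq> 0" "?k \<noteq> k0" "- ?k \<noteq> k0" using q_big[OF k] k q by auto
    show "\<bar>proj \<delta> (\<phi> (g [^] (int (n * q) * k)) y)\<bar> \<le> M"
    proof (rule ccontr)
      assume "\<not> \<bar>proj \<delta> (\<phi> (g [^] (int (n * q) * k)) y)\<bar> \<le> M"
      then obtain t :: int where t: "t \<in> {1, -1}" "M < t * proj \<delta> (\<phi> (g [^] (int n * ?k)) y)"
        unfolding exp by (metis abs_if insert_iff mult_1 mult_minus1 not_le)
      obtain s :: int where s: "s \<in> {1, -1}" "M < s * proj \<delta> y"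
        using y(2) by (metis abs_if insert_iff mult_1 mult_minus1)
      have map: "\<phi> (g [^] (int n * ?k)) (c s) = c t" using maps_c[OF y(1) s(2) t(2) s(1) t(1)] .
      have "s \<noteq> t" using map c_not_fixed[of "int n * ?k" s] s(1) k' n(1) by auto
      then consider "s = 1" "t = - 1" | "s = - 1" "t = 1" using s t by auto
      then show False
      proof cases
        case 1
        then show False using k0[OF k'(1)] map k'(2) by simp
      next
        case 2
        have "\<phi> (inv (g [^] (int n * ?k))) (\<phi> (g [^] (int n * ?k)) (c (- 1))) = c (- 1)"
          by (rule act_inv_act[OF int_pow_closed[OF gh(1)] cX])
        then have "\<phi> (g [^] (int n * (- ?k))) (c 1) = c (- 1)"
          using map unfolding 2 by (simp add: int_pow_neg gh)
        then show False using k0[of "- ?k"] k' by simp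
      qed
    qed
  next
    fix k :: int and y assume k: "k \<noteq> 0" and y: "y \<in> X" "\<bar>proj \<delta> y\<bar> \<le> M"
    have "\<bar>int q * k\<bar> * 1 \<le> \<bar>int q * k\<bar> * (int n * l)"
      using n(1) l mult_mono[of 1 "int n" 1 l] by (intro mult_left_mono) auto
    then have "\<bar>int q * k\<bar> \<le> \<bar>int (n * q) * k * l\<bar>"
      using l by (simp add: abs_mult algebra_simps)
    then show "M < \<bar>proj \<delta> (\<phi> (h [^] (int (n * q) * k)) y)\<bar>"
      using q_big(2)[OF k] y(2) unfolding proj_translates[OF gh(2) \<delta> y(1)] by linarith
  qed (use n q in auto)
qed

lemma elliptic_translates:
  assumes gh: "g \<in> carrier G" "h \<in> carrier G" and \<delta>: "translates h \<delta> l"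
    and ell: "elliptic_points g \<noteq> {}"
  shows "alternative_pair G g h \<or> share_ray g h"
proof -
  have line: "line \<delta>" using \<delta> by (simp add: translates_def)
  have X: "f \<in> elliptic_points g \<Longrightarrow> f \<in> X" for f by (simp add: elliptic_points_def)
  consider "\<forall>M. \<exists>f\<in>elliptic_points g. M < proj \<delta> f" | "\<forall>M. \<exists>f\<in>elliptic_points g. proj \<delta> f < M"
    | M M' where "\<forall>f\<in>elliptic_points g. proj \<delta> f \<le> M" "\<forall>f\<in>elliptic_points g. M' \<le> proj \<delta> f"
    by (meson not_le)
  then show ?thesis
  proof cases
    case 1
    then show ?thesis using elliptic_translates_unbounded_above[OF gh \<delta>] by blast
  next
    case 2
    have "share_ray g (inv h)"
    proof (rule elliptic_translates_unbounded_above[OF gh(1) _ translates_reverse[OF gh(2) \<delta>]])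
      fix M
      obtain f where "f \<in> elliptic_points g" "proj \<delta> f < - M" using 2 by blast
      then show "\<exists>f\<in>elliptic_points g. M < proj (\<lambda>i. \<delta> (- i)) f"
        using proj_reverse[OF line X] by (intro bexI[of _ f]) auto
    qed (use gh in simp)
    then show ?thesis using share_ray_inv2 gh by blast
  next
    case 3
    obtain f where f: "f \<in> elliptic_points g" using ell by blast
    let ?\<delta> = "\<lambda>i. \<delta> (i + proj \<delta> f)"
    have "\<bar>proj ?\<delta> f'\<bar> \<le> \<bar>M\<bar> + \<bar>M'\<bar> + \<bar>proj \<delta> f\<bar>" if "f' \<in> elliptic_points g" for f'
      using 3(1)[rule_format, OF that] 3(2)[rule_format, OF that] proj_shift[OF line X[OF that], of "proj \<delta> f"]
      by linarith
    then show ?thesis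
      using elliptic_translates_bounded[OF gh translates_shift[OF \<delta>] f] proj_shift[OF line X[OF f]]
      by auto
  qed
qed

text \<open>The path from u to x starts with the same vertex e as the path to v. If u did not
  separate the image of x from v, the path from u to that image would start with e as well, so the
  power of g would fix e, an elliptic point closer to v than u.\<close>

lemma elliptic_step:
  assumes g: "g \<in> carrier G" "k \<noteq> 0" and uv: "u \<in> X" "v \<in> X" "u \<noteq> v" "\<phi> (g [^] (k::int)) u = u"
    and min: "\<And>e. e \<in> elliptic_points g \<Longrightarrow> d u v \<le> d e v"
    and x: "x \<in> X" "d x u = d x v + d u v"
  shows "d (\<phi> (g [^] k) x) v = d (\<phi> (g [^] k) x) u + d u v"
proof (rule ccontr)
  let ?g = "g [^] k"
  let ?y = "\<phi> ?g x"
  assume neq: "d ?y v \<noteq> d ?y u + d u v"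
  have gk: "?g \<in> carrier G" and yX: "?y \<in> X" using g x by auto
  have "d ?y v \<le> d ?y u + d u v" using triangle[OF yX uv(1,2)] .
  moreover have "even (d ?y u + d u v + d ?y v)" using parity[OF yX uv(1,2)] .
  ultimately have fold: "d ?y v \<le> d ?y u + d u v - 2" using neq by presburger
  have "1 \<le> d u v" using dist_nonneg[OF uv(1,2)] dist_eq_0[OF uv(1,2)] uv(3) by linarith
  then obtain e where e: "e \<in> X" "d u e = 1" "d e v = d u v - 1"
    using geodesic[OF uv(1,2), of 1] by auto
  have "d x e \<le> d x v + d v e" "d x u \<le> d x e + d e u"
    using triangle[OF x(1) uv(2) e(1)] triangle[OF x(1) e(1) uv(1)] .
  then have xe: "d x e = d x u - 1"
    using e x(2) dist_sym[OF uv(2) e(1)] dist_sym[OF e(1) uv(1)] by linarith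
  have ge: "\<phi> ?g e \<in> X" "d u (\<phi> ?g e) = 1" "d ?y (\<phi> ?g e) = d ?y u - 1"
    using isometry[OF gk uv(1) e(1)] isometry[OF gk x(1) e(1)] isometry[OF gk x(1) uv(1)]
      e uv(4) xe gk by simp_all
  have "d ?y e + d u v \<le> max (d ?y u + d e v) (d ?y v + d e u)"
    using four_point[OF yX e(1) uv(1,2)] .
  then have "d ?y e \<le> d ?y u - 1" using fold e dist_sym[OF e(1) uv(1)] by linarith
  moreover have "d ?y u \<le> d ?y e + d e u" using triangle[OF yX e(1) uv(1)] .
  ultimately have ye: "d ?y e = d ?y u - 1" using e dist_sym[OF e(1) uv(1)] by linarith
  have "e = \<phi> ?g e"
    by (rule geodesic_unique[OF uv(1) yX e(1) ge(1)])
      (use e ge ye dist_sym[OF e(1) yX] dist_sym[OF uv(1) yX] dist_sym[OF ge(1) yX] in linarith)+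
  then have "e \<in> elliptic_points g" using elliptic_pointsI[OF g(1) e(1) g(2)] by simp
  then show False using min[of e] e by simp
qed

text \<open>For a closest pair u, v of elliptic points, the ping-pong sets are the points whose path
  to v passes through u and those whose path to u passes through v.\<close>

lemma elliptic_pair_disjoint:
  assumes gh: "g \<in> carrier G" "h \<in> carrier G"
    and ne: "elliptic_points g \<noteq> {}" "elliptic_points h \<noteq> {}"
    and disj: "elliptic_points g \<inter> elliptic_points h = {}"
  shows "alternative_pair G g h"
proof -
  obtain u0 v0 where "u0 \<in> elliptic_points g \<and> v0 \<in> elliptic_points h" using ne by blast
  then have "\<exists>w. fst w \<in> elliptic_points g \<and> snd w \<in> elliptic_points h"
    by (intro exI[of _ "(u0, v0)"]) simp
  then obtain w where w: "fst w \<in> elliptic_points g \<and> snd w \<in> elliptic_points h"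
    "\<And>y. fst y \<in> elliptic_points g \<and> snd y \<in> elliptic_points h \<Longrightarrow>
      nat (d (fst w) (snd w)) \<le> nat (d (fst y) (snd y))"
    using ex_has_least_nat[of "\<lambda>w. fst w \<in> elliptic_points g \<and> snd w \<in> elliptic_points h"
        _ "\<lambda>w. nat (d (fst w) (snd w))"] by metis
  define u v where "u = fst w" and "v = snd w"
  have uv: "u \<in> elliptic_points g" "v \<in> elliptic_points h" using w by (auto simp: u_def v_def)
  have X: "u \<in> X" "v \<in> X" using uv by (auto simp: elliptic_points_def)
  have min: "d u v \<le> d e e'" if "e \<in> elliptic_points g" "e' \<in> elliptic_points h" for e e'
    using w(2)[of "(e, e')"] that dist_nonneg[of e e'] by (auto simp: u_def v_def elliptic_points_def)
  have "u \<noteq> v" using uv disj by blast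
  then have pos: "0 < d u v" using X dist_nonneg[OF X] dist_eq_0[OF X] by simp
  obtain n :: nat where n: "n \<ge> 1" "\<And>k::int. \<phi> (g [^] (int n * k)) u = u"
    using elliptic_points_pow[OF gh(1) uv(1)] by blast
  obtain n' :: nat where n': "n' \<ge> 1" "\<And>k::int. \<phi> (h [^] (int n' * k)) v = v"
    using elliptic_points_pow[OF gh(2) uv(2)] by blast
  let ?P = "\<lambda>x. d x v = d x u + d u v" and ?Q = "\<lambda>x. d x u = d x v + d u v"
  show ?thesis
  proof (rule F2_if_ping_pong[OF gh, of "n * n'" ?P ?Q])
    have "u \<in> {x \<in> X. ?P x}" "v \<in> {x \<in> X. ?Q x}"
      using X dist_refl dist_sym[OF X] by auto
    then show "{x \<in> X. ?P x} \<noteq> {}" "{x \<in> X. ?Q x} \<noteq> {}" by blast+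
  next
    fix k :: int and y assume "k \<noteq> 0" "y \<in> X" "?Q y"
    then show "?P (\<phi> (g [^] (int (n * n') * k)) y)"
      using elliptic_step[OF gh(1) _ X \<open>u \<noteq> v\<close>, of "int (n * n') * k" y] n(2)[of "int n' * k"]
        min[OF _ uv(2)] n(1) n'(1) by (simp add: mult.assoc)
  next
    fix k :: int and y assume "k \<noteq> 0" "y \<in> X" "?P y"
    moreover have "d v u \<le> d e u" if "e \<in> elliptic_points h" for e
      using min[OF uv(1) that] dist_sym[OF X] dist_sym[of e u] X that by (auto simp: elliptic_points_def)
    moreover have "\<phi> (h [^] (int (n * n') * k)) v = v"
      using n'(2)[of "int n * k"] by (simp add: algebra_simps)
    ultimately show "?Q (\<phi> (h [^] (int (n * n') * k)) y)"
      using elliptic_step[OF gh(2) _ X(2,1) \<open>u \<noteq> v\<close>[symmetric], of "int (n * n') * k" y]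
        n(1) n'(1) dist_sym[OF X] by simp
  qed (use pos n n' in auto)
qed

theorem alternative_or_elliptic_or_share_ray:
  assumes gh: "g \<in> carrier G" "h \<in> carrier G" and ne: "X \<noteq> {}"
  obtains "alternative_pair G g h"
    | n x where "(n :: nat) \<ge> 1" "x \<in> X" "\<phi> (g [^] n) x = x" "\<phi> (h [^] n) x = x"
    | "share_ray g h" | "share_ray h g"
proof -
  consider (ee) "elliptic_points g \<noteq> {}" "elliptic_points h \<noteq> {}"
    | (et) \<delta> l where "elliptic_points g \<noteq> {}" "translates h \<delta> l"
    | (te) \<delta> l where "elliptic_points h \<noteq> {}" "translates g \<delta> l"
    | (tt) \<gamma> l \<delta> l' where "translates g \<gamma> l" "translates h \<delta> l'"
    using elliptic_or_translates[OF gh(1) ne] elliptic_or_translates[OF gh(2) ne] by blast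
  then show ?thesis
  proof cases
    case ee
    show ?thesis
    proof (cases "elliptic_points g \<inter> elliptic_points h = {}")
      case True
      then show ?thesis using elliptic_pair_disjoint[OF gh ee] that(1) by blast
    next
      case False
      then obtain x where x: "x \<in> elliptic_points g" "x \<in> elliptic_points h" by blast
      obtain n :: nat where n: "n \<ge> 1" "\<And>k::int. \<phi> (g [^] (int n * k)) x = x"
        using elliptic_points_pow[OF gh(1) x(1)] by blast
      obtain n' :: nat where n': "n' \<ge> 1" "\<And>k::int. \<phi> (h [^] (int n' * k)) x = x"
        using elliptic_points_pow[OF gh(2) x(2)] by blast
      show ?thesis
      proof (rule that(2)[of "n * n'" x])
        show "\<phi> (g [^] (n * n')) x = x" "\<phi> (h [^] (n * n')) x = x"
          using n(2)[of "int n'"] n'(2)[of "int n"]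
          by (simp_all add: int_pow_int[symmetric] mult.commute)
      qed (use n n' x in \<open>auto simp: elliptic_points_def\<close>)
    qed
  next
    case et
    from elliptic_translates[OF gh et(2,1)] show ?thesis using that(1,3) by blast
  next
    case te
    from elliptic_translates[OF gh(2,1) te(2,1)] show ?thesis
      using that(1,4) alternative_pair_sym[of G h g] by blast
  next
    case tt
    from translates_pair[OF gh tt] show ?thesis using that(1,3) by blast
  qed
qed

end


section \<open>The geometric representation of the Coxeter group\<close>

text \<open>Chebyshev polynomials of the second kind, with index shifted by one. They are the
  coordinates of the roots of a dihedral group, and the recursion also covers c = 1, the case of a
  missing edge, where the quotient of sines is not defined.\<close>

fun cheb :: "real \<Rightarrow> nat \<Rightarrow> real" where
  "cheb c 0 = 0"
| "cheb c (Suc 0) = 1"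
| "cheb c (Suc (Suc k)) = 2 * c * cheb c (Suc k) - cheb c k"

lemma cheb_cos: "sin \<theta> * cheb (cos \<theta>) k = sin (real k * \<theta>)"
proof (induction "cos \<theta>" k rule: cheb.induct)
  case (3 k)
  have "sin (real (Suc (Suc k)) * \<theta>) + sin (real k * \<theta>) = 2 * cos \<theta> * sin (real (Suc k) * \<theta>)"
    using sin_plus_sin[of "real (Suc (Suc k)) * \<theta>" "real k * \<theta>"]
    by (simp add: algebra_simps add_divide_distrib)
  with 3 show ?case by (simp add: algebra_simps)
qed auto

lemma cheb_1: "cheb 1 k = real k"
  by (induction "1 :: real" k rule: cheb.induct) auto

text \<open>Anchored at the last letter x, which is the first to act under \<open>foldr\<close>, so
  that lengthening the word applies one more reflection. The relators are anchored at their first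
  letter, which causes the parity distinction in \<open>map_fst_alternating\<close>.\<close>

primrec altw :: "'a \<Rightarrow> 'a \<Rightarrow> nat \<Rightarrow> 'a list" where
  "altw x y 0 = []"
| "altw x y (Suc k) = (if even k then x else y) # altw x y k"

lemma length_altw [simp]: "length (altw x y k) = k"
  by (induction k) auto

lemma set_altw: "set (altw x y k) \<subseteq> {x, y}"
  by (induction k) auto

lemma altw_Suc_right: "altw x y (Suc k) = altw y x k @ [x]"
  by (induction k) auto

lemma altw_add: "\<exists>u. set u \<subseteq> {x, y} \<and> altw x y (j + k) = u @ altw x y k"
proof (induction j)
  case (Suc j)
  then obtain u where "set u \<subseteq> {x, y}" "altw x y (j + k) = u @ altw x y k" by blast
  then show ?case by (intro exI[of _ "(if even (j + k) then x else y) # u"]) auto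
qed auto

lemma eq_altw:
  assumes "set u \<subseteq> {x, y}" "successively (\<noteq>) u" "u \<noteq> [] \<Longrightarrow> last u \<noteq> y"
  shows "u = altw x y (length u)"
  using assms
proof (induction u arbitrary: x y rule: rev_induct)
  case (snoc z u)
  then have z: "z = x" by auto
  have "u = altw y x (length u)"
    using snoc z by (intro snoc.IH) (auto simp: successively_append_iff)
  then show ?case using z by (simp add: altw_Suc_right del: altw.simps)
qed simp

lemma map_fst_alternating:
  "map fst (alternating n s t) = (if odd n then altw s t n else altw t s n)"
  by (induction n arbitrary: s t) auto

lemma alternating_eq_map: "alternating n s t = map (\<lambda>x. (x, True)) (map fst (alternating n s t))"
  by (induction n arbitrary: s t) auto

locale coxeter_graph =
  fixes \<Gamma> :: "'a pgraph"
  assumes presentation_graph: "presentation_graph \<Gamma>"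
begin

abbreviation V :: "'a set" where "V \<equiv> verts \<Gamma>"

lemma finite_V [simp]: "finite V"
  using presentation_graph by (simp add: presentation_graph_def)

lemma label_SomeD:
  assumes "label \<Gamma> {s, t} = Some m"
  shows "s \<in> V" "t \<in> V" "s \<noteq> t" "2 \<le> m"
proof -
  have "{s, t} \<in> edges \<Gamma>" "m \<in> ran (label \<Gamma>)" using assms by (auto simp: edges_def ran_def)
  then have "{s, t} \<subseteq> V" "card {s, t} = 2" "2 \<le> m"
    using presentation_graph by (auto simp: presentation_graph_def)
  then show "s \<in> V" "t \<in> V" "s \<noteq> t" "2 \<le> m" by auto
qed

text \<open>The canonical bilinear form of the Coxeter group on simple roots; a missing edge counts
  as label infinity.\<close>

definition cos_form :: "'a \<Rightarrow> 'a \<Rightarrow> real" where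
  "cos_form s t = (if s = t then 1 else
    case label \<Gamma> {s, t} of Some m \<Rightarrow> - cos (pi / real m) | None \<Rightarrow> - 1)"

lemma cos_form_sym: "cos_form s t = cos_form t s"
  by (simp add: cos_form_def insert_commute)

lemma cos_form_self [simp]: "cos_form s s = 1"
  by (simp add: cos_form_def)

definition pairing :: "'a \<Rightarrow> ('a \<Rightarrow> real) \<Rightarrow> real" where
  "pairing s v = (\<Sum>t\<in>V. cos_form s t * v t)"

definition inner_form :: "('a \<Rightarrow> real) \<Rightarrow> ('a \<Rightarrow> real) \<Rightarrow> real" where
  "inner_form u v = (\<Sum>s\<in>V. u s * pairing s v)"

definition simple_root :: "'a \<Rightarrow> 'a \<Rightarrow> real" where
  "simple_root s = (\<lambda>x. if x = s then 1 else 0)"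

definition reflect :: "'a \<Rightarrow> ('a \<Rightarrow> real) \<Rightarrow> 'a \<Rightarrow> real" where
  "reflect s v = (\<lambda>x. v x - 2 * pairing s v * simple_root s x)"

abbreviation cox :: "'a list \<Rightarrow> ('a \<Rightarrow> real) \<Rightarrow> 'a \<Rightarrow> real" where
  "cox w \<equiv> foldr reflect w"

lemma root_self [simp]: "simple_root s s = 1"
  by (simp add: simple_root_def)

lemma root_apply: "simple_root s x = (if x = s then 1 else 0)"
  by (simp add: simple_root_def)

lemma root_inj: "simple_root s = simple_root t \<Longrightarrow> s = t"
  by (metis simple_root_def zero_neq_one)

lemma pairing_lin: "pairing s (\<lambda>x. p * u x + q * v x) = p * pairing s u + q * pairing s v"
  by (simp add: pairing_def algebra_simps sum.distrib sum_distrib_left)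

lemma pairing_root:
  assumes "t \<in> V"
  shows "pairing s (simple_root t) = cos_form s t"
proof -
  have "pairing s (simple_root t) = (\<Sum>x\<in>V. if x = t then cos_form s x else 0)"
    unfolding pairing_def by (intro sum.cong) (auto simp: simple_root_def)
  then show ?thesis using assms by simp
qed

lemma pairing_reflect: "t \<in> V \<Longrightarrow> pairing s (reflect t v) = pairing s v - 2 * pairing t v * cos_form s t"
  using pairing_lin[of s 1 v "- 2 * pairing t v" "simple_root t"]
  by (simp add: reflect_def pairing_root)

lemma reflect_lin: "reflect s (\<lambda>x. p * u x + q * v x) = (\<lambda>x. p * reflect s u x + q * reflect s v x)"
  by (simp add: reflect_def pairing_lin algebra_simps)

lemma cox_append: "cox (u @ v) = cox u \<circ> cox v"
  by (simp add: fun_eq_iff)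

lemma cox_lin: "cox w (\<lambda>x. p * u x + q * v x) = (\<lambda>x. p * cox w u x + q * cox w v x)"
  by (induction w) (simp_all add: reflect_lin)

lemma cox_scale: "cox w (\<lambda>x. p * u x) = (\<lambda>x. p * cox w u x)"
  using cox_lin[of w p u 0 u] by simp

lemma cox_uminus: "cox w (\<lambda>x. - u x) = (\<lambda>x. - cox w u x)"
  using cox_scale[of w "- 1" u] by simp

lemma reflect_reflect [simp]: "s \<in> V \<Longrightarrow> reflect s (reflect s v) = v"
  by (rule ext) (simp add: reflect_def[of s "reflect s v"] pairing_reflect, simp add: reflect_def)

lemma reflect_root_self: "s \<in> V \<Longrightarrow> reflect s (simple_root s) = (\<lambda>x. - simple_root s x)"
  by (simp add: reflect_def pairing_root)

lemma cox_rev: "set w \<subseteq> V \<Longrightarrow> cox (rev w) (cox w v) = v"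
  by (induction w arbitrary: v) auto

lemma cox_rev': "set w \<subseteq> V \<Longrightarrow> cox w (cox (rev w) v) = v"
  using cox_rev[of "rev w"] by simp

lemma cox_inj: "set w \<subseteq> V \<Longrightarrow> cox w u = cox w v \<Longrightarrow> u = v"
  using cox_rev by metis

lemma inner_form_reflect:
  assumes "s \<in> V"
  shows "inner_form (reflect s u) (reflect s v) = inner_form u v"
proof -
  have sym: "(\<Sum>t\<in>V. u t * cos_form t s) = pairing s u"
    by (simp add: pairing_def cos_form_sym mult.commute)
  have root: "(\<Sum>t\<in>V. simple_root s t * f t) = f s" for f :: "'a \<Rightarrow> real"
  proof -
    have "(\<Sum>t\<in>V. simple_root s t * f t) = (\<Sum>t\<in>V. if t = s then f t else 0)"
      by (intro sum.cong) (auto simp: simple_root_def)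
    then show ?thesis using assms by simp
  qed
  have "inner_form (reflect s u) (reflect s v) =
      (\<Sum>t\<in>V. u t * pairing t v) - 2 * pairing s v * (\<Sum>t\<in>V. u t * cos_form t s)
      - 2 * pairing s u * (\<Sum>t\<in>V. simple_root s t * (pairing t v - 2 * pairing s v * cos_form t s))"
    by (simp add: inner_form_def pairing_reflect[OF assms], simp add: reflect_def algebra_simps
        sum.distrib sum_subtractf sum_distrib_left)
  also have "\<dots> = inner_form u v"
    by (simp add: sym root inner_form_def)
  finally show ?thesis .
qed

lemma inner_form_cox: "set w \<subseteq> V \<Longrightarrow> inner_form (cox w u) (cox w v) = inner_form u v"
  by (induction w) (auto simp: inner_form_reflect)

lemma inner_form_root:
  assumes "s \<in> V" "t \<in> V"
  shows "inner_form (simple_root s) (simple_root t) = cos_form s t"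
proof -
  have "inner_form (simple_root s) (simple_root t) = (\<Sum>x\<in>V. if x = s then cos_form x t else 0)"
    unfolding inner_form_def using assms
    by (intro sum.cong) (auto simp: pairing_root root_apply)
  then show ?thesis using assms by simp
qed

definition supp_in :: "'a set \<Rightarrow> ('a \<Rightarrow> real) \<Rightarrow> bool" where
  "supp_in S v \<longleftrightarrow> (\<forall>x. x \<notin> S \<longrightarrow> v x = 0)"

lemma supp_in_root: "s \<in> S \<Longrightarrow> supp_in S (simple_root s)"
  by (auto simp: supp_in_def simple_root_def)

lemma supp_in_cox: "set w \<subseteq> S \<Longrightarrow> supp_in S v \<Longrightarrow> supp_in S (cox w v)"
  by (induction w) (auto simp: supp_in_def reflect_def simple_root_def)

lemma inner_form_scaled_root:
  assumes "s \<in> V" "inner_form v v = 1" "v = (\<lambda>x. p * simple_root s x)" "0 \<le> p"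
  shows "v = simple_root s"
proof -
  have "pairing x v = p * cos_form x s" for x
    using pairing_lin[of x p "simple_root s" 0 "simple_root s"] assms(1,3) by (simp add: pairing_root)
  then have "inner_form v v = (\<Sum>x\<in>V. if x = s then p * p * cos_form x s else 0)"
    unfolding inner_form_def assms(3) by (intro sum.cong) (auto simp: simple_root_def)
  then have "p * p = 1" using assms(1,2) by simp
  then have "p = 1" using assms(4) by (metis abs_of_nonneg abs_square_eq_1 power2_eq_square)
  then show ?thesis using assms(3) by simp
qed

text \<open>Each reflection changes one of the two coordinates by the Chebyshev recursion; the
  parity of k tells which coordinate was changed last.\<close>

lemma cox_altw_root:
  assumes st: "s \<in> V" "t \<in> V" "s \<noteq> t"
  shows "cox (altw t s k) (simple_root s) =
    (\<lambda>x. cheb (- cos_form s t) (if odd k then k else Suc k) * simple_root s x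
       + cheb (- cos_form s t) (if odd k then Suc k else k) * simple_root t x)"
proof (induction k)
  case (Suc k)
  let ?c = "- cos_form s t"
  have R: "reflect t (simple_root s) = (\<lambda>x. simple_root s x + 2 * ?c * simple_root t x)"
    "reflect s (simple_root t) = (\<lambda>x. simple_root t x + 2 * ?c * simple_root s x)"
    using st by (auto simp: reflect_def pairing_root cos_form_sym)
  show ?case
  proof (cases "even k")
    case True
    have "cox (altw t s (Suc k)) (simple_root s) =
      reflect t (\<lambda>x. cheb ?c (Suc k) * simple_root s x + cheb ?c k * simple_root t x)"
      using Suc True by simp
    also have "\<dots> = (\<lambda>x. cheb ?c (Suc k) * (simple_root s x + 2 * ?c * simple_root t x) + cheb ?c k * - simple_root t x)"
      by (simp add: reflect_lin R reflect_root_self st)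
    also have "\<dots> = (\<lambda>x. cheb ?c (Suc k) * simple_root s x + cheb ?c (Suc (Suc k)) * simple_root t x)"
      by (simp add: algebra_simps)
    finally show ?thesis using True by simp
  next
    case False
    have "cox (altw t s (Suc k)) (simple_root s) =
      reflect s (\<lambda>x. cheb ?c k * simple_root s x + cheb ?c (Suc k) * simple_root t x)"
      using Suc False by simp
    also have "\<dots> = (\<lambda>x. cheb ?c k * - simple_root s x + cheb ?c (Suc k) * (simple_root t x + 2 * ?c * simple_root s x))"
      by (simp add: reflect_lin R reflect_root_self st)
    also have "\<dots> = (\<lambda>x. cheb ?c (Suc (Suc k)) * simple_root s x + cheb ?c (Suc k) * simple_root t x)"
      by (simp add: algebra_simps)
    finally show ?thesis using False by simp
  qed
qed simp

lemma cos_form_label: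
  assumes "label \<Gamma> {s, t} = Some m"
  shows "- cos_form s t = cos (pi / real m)" "0 < sin (pi / real m)"
proof -
  note m = label_SomeD[OF assms]
  show "- cos_form s t = cos (pi / real m)" using assms m by (simp add: cos_form_def)
  show "0 < sin (pi / real m)" using m by (intro sin_gt_zero) (auto simp: field_simps)
qed

text \<open>At the cosine of pi / m the k-th value is sin (k pi / m) / sin (pi / m). Positivity
  below m keeps roots positive under short alternating products, and the values around m yield the
  braid relation.\<close>

lemma cheb_label:
  assumes "label \<Gamma> {s, t} = Some m"
  shows "cheb (- cos_form s t) m = 0" "cheb (- cos_form s t) (m - 1) = 1"
    "cheb (- cos_form s t) (Suc m) = - 1"
    and "0 < k \<Longrightarrow> k < m \<Longrightarrow> 0 < cheb (- cos_form s t) k"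
proof -
  let ?\<theta> = "pi / real m"
  note m = label_SomeD[OF assms] and c = cos_form_label[OF assms]
  have eq: "cheb (- cos_form s t) k = sin (real k * ?\<theta>) / sin ?\<theta>" for k
    using cheb_cos[of ?\<theta> k] c by (simp add: field_simps)
  show "cheb (- cos_form s t) m = 0" using m by (simp add: eq)
  have "real (m - 1) * ?\<theta> = pi - ?\<theta>" "real (Suc m) * ?\<theta> = pi + ?\<theta>"
    using m by (auto simp: field_simps of_nat_diff)
  then show "cheb (- cos_form s t) (m - 1) = 1" "cheb (- cos_form s t) (Suc m) = - 1"
    unfolding eq using c(2) by (simp_all only: sin_diff sin_add) simp_all
  show "0 < cheb (- cos_form s t) k" if "0 < k" "k < m"
  proof -
    have "0 < sin (real k * ?\<theta>)" using that by (intro sin_gt_zero) (auto simp: field_simps)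
    then show ?thesis unfolding eq using c(2) by (rule divide_pos_pos)
  qed
qed

text \<open>The form is nondegenerate on the plane of the two simple roots because c * c < 1. Hence
  v splits into a part orthogonal to both, which both reflections fix, and a part in the plane,
  where the identity is checked on the simple roots.\<close>

lemma cox_braid:
  assumes l: "label \<Gamma> {s, t} = Some m"
  shows "cox (altw s t m) v = cox (altw t s m) v"
proof -
  note st = label_SomeD[OF l]
  define c where "c = - cos_form s t"
  have on_root: "cox (altw t s m) (simple_root s) = cox (altw s t m) (simple_root s)"
    if l: "label \<Gamma> {s, t} = Some m" for s t
  proof -
    note st = label_SomeD[OF l]
    have "altw s t m = altw t s (m - 1) @ [s]"
      using altw_Suc_right[of s t "m - 1"] st by simp
    then have "cox (altw s t m) (simple_root s) = (\<lambda>x. - cox (altw t s (m - 1)) (simple_root s) x)"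
      using st by (simp add: reflect_root_self cox_uminus)
    also have "\<dots> = cox (altw t s m) (simple_root s)"
      using cheb_label[OF l] st by (cases "even m") (auto simp: cox_altw_root)
    finally show ?thesis by simp
  qed
  have "sin (pi / real m) ^ 2 + c ^ 2 = 1" "0 < sin (pi / real m) ^ 2"
    using cos_form_label[OF l] by (auto simp: c_def)
  then have det: "1 - c * c > 0" by (simp add: power2_eq_square)
  \<comment> \<open>Cramer's rule for the coefficients that make v' orthogonal to both simple roots;
    1 - c * c is the Gram determinant.\<close>
  define p where "p = (pairing s v + c * pairing t v) / (1 - c * c)"
  define q where "q = (pairing t v + c * pairing s v) / (1 - c * c)"
  define v' where "v' x = 1 * v x + - 1 * (p * simple_root s x + q * simple_root t x)" for x
  have pair: "pairing x v' = pairing x v - p * cos_form x s - q * cos_form x t" for x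
  proof -
    have "pairing x v' = 1 * pairing x v + - 1 * pairing x (\<lambda>x. p * simple_root s x + q * simple_root t x)"
      unfolding v'_def by (rule pairing_lin)
    then show ?thesis using st by (simp add: pairing_lin pairing_root)
  qed
  have "(1 - c * c) * p = pairing s v + c * pairing t v" "(1 - c * c) * q = pairing t v + c * pairing s v"
    using det by (simp_all add: p_def q_def)
  then have "(1 - c * c) * (p - c * q) = (1 - c * c) * pairing s v"
    "(1 - c * c) * (q - c * p) = (1 - c * c) * pairing t v"
    by algebra+
  then have "p - c * q = pairing s v" "q - c * p = pairing t v"
    using det by (auto simp only: mult_cancel_left)
  then have "pairing s v' = 0" "pairing t v' = 0"
    by (auto simp: pair c_def cos_form_sym[of t s] algebra_simps)
  then have "reflect x v' = v'" if "x \<in> {s, t}" for x using that by (auto simp: reflect_def)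
  then have fix_v': "cox w v' = v'" if "set w \<subseteq> {s, t}" for w using that by (induction w) auto
  have v: "v = (\<lambda>x. 1 * v' x + 1 * (p * simple_root s x + q * simple_root t x))"
    by (simp add: v'_def)
  have "cox w v = (\<lambda>x. v' x + (p * cox w (simple_root s) x + q * cox w (simple_root t) x))" if "set w \<subseteq> {s, t}" for w
    by (subst v, subst cox_lin, subst cox_lin) (simp add: fix_v' that)
  from this[of "altw s t m"] this[of "altw t s m"] show ?thesis
    using on_root[OF l] on_root[of t s] l set_altw[of s t m] set_altw[of t s m]
    by (simp add: insert_commute)
qed

text \<open>Minimality makes u alternating and not ending in s. Its length is less than m: otherwise
  u ends in a full braid word, which can be rewritten to end in s, and then u followed by s has a
  word shorter than u. So only nonnegative Chebyshev values occur as coordinates.\<close>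

lemma dihedral_root_nonneg:
  assumes st: "s \<in> V" "t \<in> V" "s \<noteq> t" and u: "set u \<subseteq> {s, t}"
    and min: "\<And>u'. set u' \<subseteq> {s, t} \<Longrightarrow> cox u' = cox u \<Longrightarrow> length u \<le> length u'"
    and min_s: "\<And>u'. set u' \<subseteq> {s, t} \<Longrightarrow> cox u' = cox (u @ [s]) \<Longrightarrow> length u \<le> length u'"
  shows "\<exists>p q. 0 \<le> p \<and> 0 \<le> q \<and> cox u (simple_root s) = (\<lambda>x. p * simple_root s x + q * simple_root t x)"
proof -
  define k where "k = length u"
  have "successively (\<noteq>) u"
  proof (rule ccontr)
    assume "\<not> successively (\<noteq>) u"
    then obtain i where i: "Suc i < length u" "u ! i = u ! Suc i"
      by (auto simp: successively_conv_nth)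
    define u' where "u' = take i u @ drop (Suc (Suc i)) u"
    have u_split: "u = take i u @ u ! i # u ! i # drop (Suc (Suc i)) u"
      using i by (metis Cons_nth_drop_Suc Suc_lessD append_take_drop_id)
    have "u ! i \<in> V" using nth_mem[of i u] Suc_lessD[OF i(1)] u st(1,2) by blast
    then have "cox u v = cox u' v" for v
      using arg_cong[OF u_split, of "\<lambda>w. cox w v"] by (simp add: u'_def)
    then have "cox u' = cox u" by auto
    moreover have "set u' \<subseteq> {s, t}"
      using u set_take_subset[of i u] set_drop_subset[of "Suc (Suc i)" u] by (auto simp: u'_def)
    ultimately have "length u \<le> length u'" by (rule min[rotated])
    then show False using i by (simp add: u'_def)
  qed
  moreover have "last u \<noteq> s" if "u \<noteq> []"
  proof
    assume "last u = s"
    then have "u = butlast u @ [s]" using that append_butlast_last_id by metis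
    then have "cox u = cox (butlast u) \<circ> reflect s" using cox_append[of "butlast u" "[s]"] by (simp add: comp_def)
    then have "cox (butlast u) = cox (u @ [s])"
      using st by (simp add: cox_append fun_eq_iff)
    moreover have "set (butlast u) \<subseteq> {s, t}" using u by (meson in_set_butlastD subset_iff)
    ultimately have "length u \<le> length (butlast u)" by (rule min_s[rotated])
    moreover have "0 < length u" using that by simp
    ultimately show False unfolding length_butlast by linarith
  qed
  ultimately have u_alt: "u = altw t s k"
    using eq_altw[of u t s] u by (auto simp: k_def insert_commute)
  have "0 \<le> cheb (- cos_form s t) k \<and> 0 \<le> cheb (- cos_form s t) (Suc k)"
  proof (cases "label \<Gamma> {s, t}")
    case None
    then show ?thesis using st by (simp add: cos_form_def cheb_1 del: cheb.simps)
  next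
    case (Some m)
    note m = label_SomeD[OF Some]
    have "k < m"
    proof (rule ccontr)
      assume "\<not> k < m"
      then obtain j where j: "k = j + m" by (metis add.commute le_Suc_ex not_less)
      obtain u0 where u0: "set u0 \<subseteq> {s, t}" "u = u0 @ altw t s m"
        using altw_add[of t s j m] u_alt j by auto
      define u' where "u' = u0 @ altw t s (m - 1)"
      have alt: "altw s t m = altw t s (m - 1) @ [s]"
        using altw_Suc_right[of s t "m - 1"] m by simp
      have "cox u' = cox (u @ [s])"
      proof
        fix v
        have "cox (u @ [s]) v = cox u0 (cox (altw s t m) (reflect s v))"
          using cox_braid[OF Some] by (simp add: u0)
        also have "\<dots> = cox u' v" using st by (simp add: alt u'_def)
        finally show "cox u' v = cox (u @ [s]) v" by simp
      qed
      moreover have "set u' \<subseteq> {s, t}" using u0 set_altw[of t s "m - 1"] by (auto simp: u'_def)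
      ultimately have "length u \<le> length u'" by (rule min_s[rotated])
      then show False using m u0 by (simp add: u'_def)
    qed
    have pos: "0 \<le> cheb (- cos_form s t) i" if "i \<le> m" for i
      using cheb_label(1)[OF Some] cheb_label(4)[OF Some, of i] that
      by (cases "i = m"; cases "i = 0") (auto intro: less_imp_le)
    show ?thesis using pos[of k] pos[of "Suc k"] \<open>k < m\<close> by simp
  qed
  then show ?thesis
    unfolding u_alt cox_altw_root[OF st] by (intro exI conjI) (auto split: if_splits)
qed

section \<open>Positive and negative roots\<close>

definition nonneg :: "('a \<Rightarrow> real) \<Rightarrow> bool" where
  "nonneg v \<longleftrightarrow> (\<forall>x. 0 \<le> v x)"

text \<open>
  As in Humphreys, Theorem 5.4: split off the longest possible suffix of \<open>w\<close> in the dihedral group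
  generated by \<open>s\<close> and the last letter of \<open>w\<close>.
\<close>

lemma shortest_root_nonneg:
  assumes "set w \<subseteq> V" "s \<in> V"
    and "\<And>u. set u \<subseteq> V \<Longrightarrow> cox u = cox w \<Longrightarrow> length w \<le> length u"
    and "\<And>u. set u \<subseteq> V \<Longrightarrow> cox u = cox (w @ [s]) \<Longrightarrow> length w \<le> length u"
  shows "nonneg (cox w (simple_root s))"
  using assms
proof (induction w arbitrary: s rule: length_induct)
  case (1 w)
  note IH = 1(1) and w = 1(2) and s = 1(3) and min = 1(4) and min_s = 1(5)
  show ?case
  proof (cases w rule: rev_cases)
    case Nil
    then show ?thesis by (simp add: nonneg_def simple_root_def)
  next
    case (snoc w' t)
    have t: "t \<in> V" and w': "set w' \<subseteq> V" using w snoc by auto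
    have ts: "s \<noteq> t"
    proof
      assume "s = t"
      then have "cox w' = cox (w @ [s])" using snoc t by (simp add: fun_eq_iff)
      then have "length w \<le> length w'" by (rule min_s[OF w'])
      then show False using snoc by simp
    qed
    define F where "F v u \<longleftrightarrow> set v \<subseteq> V \<and> set u \<subseteq> {s, t} \<and> cox (v @ u) = cox w \<and>
      length v + length u = length w" for v u
    have Fw: "F w' [t]" using snoc t w' by (auto simp: F_def)
    then have "\<exists>v. \<exists>u. F v u" by blast
    then obtain v where v: "\<exists>u. F v u" and v_min: "\<And>v'. \<exists>u. F v' u \<Longrightarrow> length v \<le> length v'"
      using ex_has_least_nat[of "\<lambda>v. \<exists>u. F v u" _ length] by metis
    obtain u where vu: "F v u" using v by blast
    have V: "set v \<subseteq> V" "set u \<subseteq> {s, t}" and cox_vu: "cox (v @ u) = cox w"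
      and len: "length v + length u = length w" using vu by (auto simp: F_def)
    have uV: "set u \<subseteq> V" using V s t by auto
    have "length v \<le> length w'"
      using v_min[of w'] Fw by blast
    then have short: "length v < length w" using snoc by simp
    have nn: "nonneg (cox v (simple_root x))" if x: "x \<in> {s, t}" for x
    proof (rule IH[rule_format, OF short V(1)])
      show "x \<in> V" using x s t by auto
      fix v' assume v': "set v' \<subseteq> V" "cox v' = cox v"
      then have "cox (v' @ u) = cox w" using cox_vu by (simp add: fun_eq_iff)
      then have "length w \<le> length (v' @ u)" using v' uV by (intro min) auto
      then show "length v \<le> length v'" using len by simp
    next
      \<comment> \<open>If v followed by x had a shorter word than v, the letter x could be moved
        into the dihedral factor, contradicting the minimal length of v.\<close>
      fix v' assume v': "set v' \<subseteq> V" "cox v' = cox (v @ [x])"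
      show "length v \<le> length v'"
      proof (rule ccontr)
        assume *: "\<not> length v \<le> length v'"
        have eq: "cox (v' @ x # u) = cox w"
          using v'(2) cox_vu x s t by (auto simp: fun_eq_iff)
        then have "length w \<le> length (v' @ x # u)" using v' uV x s t by (intro min) auto
        with * len have "F v' (x # u)" using v' V x eq by (auto simp: F_def)
        then show False using v_min[of v'] * by auto
      qed
    qed
    have "\<exists>p q. 0 \<le> p \<and> 0 \<le> q \<and> cox u (simple_root s) = (\<lambda>x. p * simple_root s x + q * simple_root t x)"
    proof (rule dihedral_root_nonneg[OF s t ts V(2)])
      fix u' assume u': "set u' \<subseteq> {s, t}" "cox u' = cox u"
      then have "cox (v @ u') = cox w" unfolding cox_vu[symmetric] by (simp only: cox_append)
      then have "length w \<le> length (v @ u')" using u' V s t by (intro min) auto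
      then show "length u \<le> length u'" using len by simp
    next
      fix u' assume u': "set u' \<subseteq> {s, t}" "cox u' = cox (u @ [s])"
      then have "cox (v @ u') = cox (w @ [s])"
        unfolding cox_append cox_vu[symmetric] by (simp only: comp_assoc)
      then have "length w \<le> length (v @ u')" using u' V s t by (intro min_s) auto
      then show "length u \<le> length u'" using len by simp
    qed
    then obtain p q where pq: "0 \<le> p" "0 \<le> q" "cox u (simple_root s) = (\<lambda>x. p * simple_root s x + q * simple_root t x)"
      by blast
    have "cox w (simple_root s) = cox v (cox u (simple_root s))" using cox_vu by (simp add: fun_eq_iff)
    also have "\<dots> = (\<lambda>x. p * cox v (simple_root s) x + q * cox v (simple_root t) x)"
      by (simp add: pq cox_lin)
    finally show ?thesis using pq nn[of s] nn[of t] by (auto simp: nonneg_def)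
  qed
qed

lemma ex_shortest:
  assumes "set w \<subseteq> V"
  shows "\<exists>v. set v \<subseteq> V \<and> cox v = cox w \<and> (\<forall>u. set u \<subseteq> V \<longrightarrow> cox u = cox v \<longrightarrow> length v \<le> length u)"
  using ex_has_least_nat[of "\<lambda>v. set v \<subseteq> V \<and> cox v = cox w" w length] assms by auto

text \<open>A shortest word for w gives a nonnegative root unless w followed by s has a shorter one.
  In that case a shortest word for the latter qualifies, and the reflection in s changes the sign of
  the root.\<close>

lemma root_nonneg_or_nonpos:
  assumes "set w \<subseteq> V" "s \<in> V"
  shows "nonneg (cox w (simple_root s)) \<or> nonneg (\<lambda>x. - cox w (simple_root s) x)"
proof -
  obtain v where v: "set v \<subseteq> V" "cox v = cox w" "\<And>u. set u \<subseteq> V \<Longrightarrow> cox u = cox v \<Longrightarrow> length v \<le> length u"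
    using ex_shortest[OF assms(1)] by auto
  show ?thesis
  proof (cases "\<exists>u. set u \<subseteq> V \<and> cox u = cox (v @ [s]) \<and> length u < length v")
    case False
    then have "nonneg (cox v (simple_root s))"
      using v assms by (intro shortest_root_nonneg) (auto simp: not_less)
    then show ?thesis using v by simp
  next
    case True
    then obtain u0 where u0: "set u0 \<subseteq> V" "cox u0 = cox (v @ [s])" "length u0 < length v" by blast
    obtain u where u: "set u \<subseteq> V" "cox u = cox u0" "\<And>u'. set u' \<subseteq> V \<Longrightarrow> cox u' = cox u \<Longrightarrow> length u \<le> length u'"
      using ex_shortest[OF u0(1)] by auto
    have us: "cox (u @ [s]) = cox v" using u(2) u0(2) assms(2) by (auto simp: fun_eq_iff)
    have "nonneg (cox u (simple_root s))"
    proof (rule shortest_root_nonneg[OF u(1) assms(2) u(3)])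
      fix u' assume "set u' \<subseteq> V" "cox u' = cox (u @ [s])"
      then have "length v \<le> length u'" using us by (intro v(3)) auto
      then show "length u \<le> length u'" using u(3)[OF u0(1)] u(2) u0(3) by simp
    qed auto
    moreover have "cox w (simple_root s) = (\<lambda>x. - cox u (simple_root s) x)"
      using fun_cong[OF us, of "simple_root s"] v(2) assms(2) by (simp add: reflect_root_self cox_uminus)
    ultimately show ?thesis by simp
  qed
qed

end


section \<open>Homomorphisms and actions of presented groups\<close>

lemma presented_group_hom:
  fixes G (structure)
  assumes "group G" and f: "f ` X \<subseteq> carrier G"
    and rel: "\<And>u v. (u, v) \<in> R \<Longrightarrow> u \<in> words X \<Longrightarrow> v \<in> words X \<Longrightarrow> weval G f u = weval G f v"
  obtains \<iota> where "\<iota> \<in> hom (presented_group X R) G"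
    "\<And>w. w \<in> words X \<Longrightarrow> \<iota> (pres_class X R w) = weval G f w"
proof -
  interpret group G by fact
  define \<iota> where "\<iota> A = weval G f (SOME w. w \<in> words X \<and> pres_class X R w = A)" for A
  have \<iota>: "\<iota> (pres_class X R w) = weval G f w" if w: "w \<in> words X" for w
  proof -
    have "\<exists>v. v \<in> words X \<and> pres_class X R v = pres_class X R w" using w by blast
    from someI_ex[OF this] obtain v where "v \<in> words X" "pres_class X R v = pres_class X R w"
      "\<iota> (pres_class X R w) = weval G f v"
      unfolding \<iota>_def by blast
    then show ?thesis using weval_pres_cong[OF f rel, of R v w] w by (simp add: pres_class_eq_iff)
  qed
  moreover have "\<iota> \<in> hom (presented_group X R) G"
  proof (rule homI)
    fix A B assume "A \<in> carrier (presented_group X R)" "B \<in> carrier (presented_group X R)"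
    then obtain u v where "u \<in> words X" "A = pres_class X R u" "v \<in> words X" "B = pres_class X R v"
      by (auto simp: carrier_presented_group)
    then show "\<iota> (A \<otimes>\<^bsub>presented_group X R\<^esub> B) = \<iota> A \<otimes> \<iota> B"
      using \<iota>[of "u @ v"] by (simp add: presented_group_mult \<iota> weval_append[OF f])
  qed (use f in \<open>auto simp: carrier_presented_group \<iota>\<close>)
  ultimately show ?thesis using that by blast
qed

abbreviation run :: "('a \<Rightarrow> bool \<Rightarrow> 's \<Rightarrow> 's) \<Rightarrow> 'a word \<Rightarrow> 's \<Rightarrow> 's" where
  "run act \<equiv> foldr (\<lambda>l. act (fst l) (snd l))"

lemma presented_group_action:
  assumes closed: "\<And>x b e. x \<in> X \<Longrightarrow> e \<in> E \<Longrightarrow> act x b e \<in> E"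
    and inverse: "\<And>x b e. x \<in> X \<Longrightarrow> e \<in> E \<Longrightarrow> act x b (act x (\<not> b) e) = e"
    and rel: "\<And>u v e. (u, v) \<in> R \<Longrightarrow> u \<in> words X \<Longrightarrow> v \<in> words X \<Longrightarrow> e \<in> E \<Longrightarrow>
      run act u e = run act v e"
  obtains \<phi> where "group_action (presented_group X R) E \<phi>"
    "\<And>w e. w \<in> words X \<Longrightarrow> e \<in> E \<Longrightarrow> \<phi> (pres_class X R w) e = run act w e"
proof -
  interpret B: group "BijGroup E" by (rule group_BijGroup)
  define f where "f x = restrict (act x True) E" for x
  have bij: "bij_betw (act x b) E E" if "x \<in> X" for x b
    using closed[OF that] inverse[OF that, of _ b] inverse[OF that, of _ "\<not> b"]
    by (intro bij_betwI[of _ _ _ "act x (\<not> b)"]) auto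
  have f: "f ` X \<subseteq> carrier (BijGroup E)"
    using bij by (auto simp: f_def BijGroup_def Bij_def bij_betw_restrict_eq)
  have f_inv: "(inv\<^bsub>BijGroup E\<^esub> (f x)) e = act x False e" if "x \<in> X" "e \<in> E" for x e
  proof -
    have fx: "f x \<in> carrier (BijGroup E)" using f that by blast
    have g: "restrict (act x False) E \<in> carrier (BijGroup E)"
      using bij[OF that(1)] by (auto simp: BijGroup_def Bij_def bij_betw_restrict_eq)
    have "restrict (act x False) E \<otimes>\<^bsub>BijGroup E\<^esub> f x = \<one>\<^bsub>BijGroup E\<^esub>"
      using fx g closed[OF that(1)] inverse[OF that(1), of _ False]
      by (auto simp: BijGroup_def f_def compose_def restrict_def fun_eq_iff)
    from B.inv_equality[OF this fx g] show ?thesis using that by simp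
  qed
  have run_E: "run act w e \<in> E" if "w \<in> words X" "e \<in> E" for w e
    using that by (induction w) (auto intro: closed)
  have weval: "weval (BijGroup E) f w e = run act w e" if "w \<in> words X" "e \<in> E" for w e
    using that
  proof (induction w)
    case Nil
    then show ?case by (simp add: BijGroup_def)
  next
    case (Cons l w)
    define y where "y = (if snd l then f (fst l) else inv\<^bsub>BijGroup E\<^esub> f (fst l))"
    have fl: "f (fst l) \<in> carrier (BijGroup E)" using f Cons by auto
    then have y: "y \<in> carrier (BijGroup E)" by (simp add: y_def)
    have w: "weval (BijGroup E) f w \<in> carrier (BijGroup E)" using Cons B.weval_closed[OF f] by simp
    have "weval (BijGroup E) f (l # w) e = (y \<otimes>\<^bsub>BijGroup E\<^esub> weval (BijGroup E) f w) e"
      by (simp add: y_def)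
    also have "\<dots> = y (weval (BijGroup E) f w e)"
      using y w Cons by (simp add: BijGroup_def compose_def)
    also have "\<dots> = y (run act w e)" using Cons by simp
    also have "\<dots> = act (fst l) (snd l) (run act w e)"
      using f_inv[of "fst l"] run_E[of w e] Cons by (auto simp: y_def f_def)
    finally show ?case by simp
  qed
  have rel': "weval (BijGroup E) f u = weval (BijGroup E) f v"
    if "(u, v) \<in> R" "u \<in> words X" "v \<in> words X" for u v
  proof -
    have "weval (BijGroup E) f u \<in> extensional E" "weval (BijGroup E) f v \<in> extensional E"
      using B.weval_closed[OF f] that by (auto simp: BijGroup_def Bij_def)
    then show ?thesis
      by (rule extensionalityI) (use weval rel that in auto)
  qed
  obtain \<phi> where \<phi>: "\<phi> \<in> hom (presented_group X R) (BijGroup E)"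
    "\<And>w. w \<in> words X \<Longrightarrow> \<phi> (pres_class X R w) = weval (BijGroup E) f w"
    using presented_group_hom[OF B.is_group f rel'] by blast
  show ?thesis
  proof (rule that[of \<phi>])
    show "group_action (presented_group X R) E \<phi>"
      using \<phi>(1) by (simp add: group_action_def group_hom_def group_hom_axioms_def
          group_presented_group B.is_group)
  qed (simp add: \<phi> weval)
qed


section \<open>The action on chambers\<close>

lemma group_artin_group: "group (artin_group \<Gamma>)"
  by (simp add: artin_group_def group_presented_group)

lemma artin_gen_closed: "artin_gen \<Gamma> ` verts \<Gamma> \<subseteq> carrier (artin_group \<Gamma>)"
  unfolding artin_gen_def artin_group_def by (rule presented_group_generators)

lemma weval_artin_gen:
  "w \<in> words (verts \<Gamma>) \<Longrightarrow>
    weval (artin_group \<Gamma>) (artin_gen \<Gamma>) w = pres_class (verts \<Gamma>) (artin_relations \<Gamma>) w"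
  unfolding artin_group_def artin_gen_def[abs_def] by (rule weval_presented_group)

lemma weval_alternating:
  assumes "presentation_graph \<Gamma>" "label \<Gamma> {s, t} = Some m"
  shows "weval (artin_group \<Gamma>) (artin_gen \<Gamma>) (alternating m s t) =
    weval (artin_group \<Gamma>) (artin_gen \<Gamma>) (alternating m t s)"
proof -
  interpret coxeter_graph \<Gamma> by unfold_locales fact
  have "alternating m x y \<in> words (verts \<Gamma>)" if "x \<in> V" "y \<in> V" for x y
    using that by (induction m arbitrary: x y) auto
  then have "alternating m s t \<in> words (verts \<Gamma>)" "alternating m t s \<in> words (verts \<Gamma>)"
    using label_SomeD[OF assms(2)] by auto
  moreover have "(alternating m s t, alternating m t s) \<in> artin_relations \<Gamma>"
    using assms(2) by (auto simp: artin_relations_def)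
  ultimately show ?thesis by (simp add: weval_artin_gen pres_class_eq_iff pres_cong.relation)
qed

lemma verts_full_subgraph [simp]: "verts (full_subgraph \<Gamma> T) = T"
  by (simp add: full_subgraph_def)

lemma presentation_full_subgraph:
  assumes "presentation_graph \<Gamma>" "T \<subseteq> verts \<Gamma>"
  shows "presentation_graph (full_subgraph \<Gamma> T)"
proof -
  have "ran (label \<Gamma> |` Pow T) \<subseteq> ran (label \<Gamma>)" by (auto simp: ran_def restrict_map_def)
  then show ?thesis
    using assms unfolding presentation_graph_def full_subgraph_def edges_def
    by (auto intro: finite_subset)
qed

context coxeter_graph
begin

lemma pairing_eq_inner_form: "s \<in> V \<Longrightarrow> inner_form (simple_root s) v = pairing s v"
proof -
  assume s: "s \<in> V"
  have "inner_form (simple_root s) v = (\<Sum>t\<in>V. if t = s then pairing t v else 0)"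
    unfolding inner_form_def by (intro sum.cong) (auto simp: root_apply)
  then show ?thesis using s by simp
qed

text \<open>
  The representatives of minimal length of the cosets of the parabolic subgroup spanned by \<open>T\<close>.
\<close>

definition chambers :: "'a set \<Rightarrow> (('a \<Rightarrow> real) \<Rightarrow> 'a \<Rightarrow> real) set" where
  "chambers T = {c. (\<exists>w. set w \<subseteq> V \<and> c = cox w) \<and> (\<forall>r\<in>T. nonneg (c (simple_root r)))}"

lemma chambers_inj: "c \<in> chambers T \<Longrightarrow> c u = c v \<Longrightarrow> u = v"
  using cox_inj by (auto simp: chambers_def)

lemma chambers_inner_form: "c \<in> chambers T \<Longrightarrow> inner_form (c u) (c v) = inner_form u v"
  using inner_form_cox by (auto simp: chambers_def)

lemma chambers_lin:
  "c \<in> chambers T \<Longrightarrow> c (\<lambda>x. p * u x + q * v x) = (\<lambda>x. p * c u x + q * c v x)"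
  using cox_lin by (auto simp: chambers_def)

lemma id_chambers: "T \<subseteq> V \<Longrightarrow> id \<in> chambers T"
  unfolding chambers_def by (auto simp: nonneg_def root_apply intro!: exI[of _ "[]"])

text \<open>A reflection in s makes no positive root negative except the simple root of s: a root
  that changes sign has all coordinates other than s equal to zero, and its norm one then makes it
  simple.\<close>

lemma reflect_chambers:
  assumes T: "T \<subseteq> V" and c: "c \<in> chambers T" and s: "s \<in> V"
    and free: "\<And>r. r \<in> T \<Longrightarrow> c (simple_root r) \<noteq> simple_root s"
  shows "reflect s \<circ> c \<in> chambers T" "r \<in> T \<Longrightarrow> (reflect s \<circ> c) (simple_root r) \<noteq> simple_root s"
proof -
  obtain w where w: "set w \<subseteq> V" "c = cox w" using c by (auto simp: chambers_def)
  have "nonneg (reflect s (c (simple_root r)))" if r: "r \<in> T" for r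
  proof (rule ccontr)
    assume "\<not> nonneg (reflect s (c (simple_root r)))"
    then have neg: "nonneg (\<lambda>x. - reflect s (c (simple_root r)) x)"
      using root_nonneg_or_nonpos[of "s # w" r] w s r T by auto
    have pos: "nonneg (c (simple_root r))" using c r by (auto simp: chambers_def)
    have "c (simple_root r) x = 0" if "x \<noteq> s" for x
      using pos[unfolded nonneg_def, rule_format, of x] neg[unfolded nonneg_def, rule_format, of x] that
      by (simp add: reflect_def root_apply)
    then have "c (simple_root r) = (\<lambda>x. c (simple_root r) s * simple_root s x)"
      by (auto simp: root_apply)
    moreover have "inner_form (c (simple_root r)) (c (simple_root r)) = 1"
      using chambers_inner_form[OF c] inner_form_root[of r r] r T by auto
    moreover have "0 \<le> c (simple_root r) s" using pos by (simp add: nonneg_def)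
    ultimately have "c (simple_root r) = simple_root s"
      using inner_form_scaled_root[OF s] by blast
    with free[OF r] show False by simp
  qed
  then show "reflect s \<circ> c \<in> chambers T"
    using w s by (auto simp: chambers_def intro!: exI[of _ "s # w"])
  show "(reflect s \<circ> c) (simple_root r) \<noteq> simple_root s" if "r \<in> T"
  proof
    assume "(reflect s \<circ> c) (simple_root r) = simple_root s"
    then have "c (simple_root r) = (\<lambda>x. - simple_root s x)"
      using reflect_reflect[OF s, of "c (simple_root r)"] reflect_root_self[OF s] by simp
    moreover have "nonneg (c (simple_root r))" using c that by (auto simp: chambers_def)
    ultimately have "0 \<le> - simple_root s s" unfolding nonneg_def by metis
    then show False by (simp add: root_apply)
  qed
qed

text \<open>So left multiplication by s keeps the coset of c modulo the parabolic subgroup and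
  corresponds to r on the right. This is why a stuck generator has to act through r on the Artin
  group factor.\<close>

lemma chambers_reflect:
  assumes c: "c \<in> chambers T" and rs: "r \<in> V" "s \<in> V" and "c (simple_root r) = simple_root s"
  shows "reflect s \<circ> c = c \<circ> reflect r"
proof
  fix v
  have "pairing s (c v) = pairing r v"
    using chambers_inner_form[OF c, of "simple_root r" v] assms by (simp add: pairing_eq_inner_form)
  moreover have "c (\<lambda>x. 1 * v x + (- 2 * pairing r v) * simple_root r x) =
      (\<lambda>x. 1 * c v x + (- 2 * pairing r v) * c (simple_root r) x)"
    by (rule chambers_lin[OF c])
  ultimately show "(reflect s \<circ> c) v = (c \<circ> reflect r) v"
    using assms(4) by (simp add: reflect_def algebra_simps)
qed

text \<open>The sign b matters only if s is stuck; otherwise the generator and its inverse both act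
  as the involution \<open>reflect s\<close>. On chambers the description selects a unique r because
  c is injective.\<close>

definition gen_act :: "'a set \<Rightarrow> 'a \<Rightarrow> bool \<Rightarrow> (('a \<Rightarrow> real) \<Rightarrow> 'a \<Rightarrow> real) \<times> 'a word set \<Rightarrow>
    (('a \<Rightarrow> real) \<Rightarrow> 'a \<Rightarrow> real) \<times> 'a word set" where
  "gen_act T s b e =
    (if \<exists>r\<in>T. fst e (simple_root r) = simple_root s
     then (fst e, weval (artin_group (full_subgraph \<Gamma> T)) (artin_gen (full_subgraph \<Gamma> T))
        [(THE r. r \<in> T \<and> fst e (simple_root r) = simple_root s, b)]
        \<otimes>\<^bsub>artin_group (full_subgraph \<Gamma> T)\<^esub> snd e)
     else (reflect s \<circ> fst e, snd e))"

definition states :: "'a set \<Rightarrow> ((('a \<Rightarrow> real) \<Rightarrow> 'a \<Rightarrow> real) \<times> 'a word set) set" where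
  "states T = chambers T \<times> carrier (artin_group (full_subgraph \<Gamma> T))"

end

section \<open>Inverses and braid relations for the action on states\<close>

locale parabolic_chambers = coxeter_graph \<Gamma> for \<Gamma> :: "'a pgraph" +
  fixes T :: "'a set"
  assumes T_sub: "T \<subseteq> verts \<Gamma>"
begin

abbreviation A\<^sub>T :: "'a word set monoid" where
  "A\<^sub>T \<equiv> artin_group (full_subgraph \<Gamma> T)"

abbreviation gen\<^sub>T :: "'a \<Rightarrow> 'a word set" where
  "gen\<^sub>T \<equiv> artin_gen (full_subgraph \<Gamma> T)"

sublocale AT: group A\<^sub>T by (rule group_artin_group)

lemma gen_T_closed: "gen\<^sub>T ` T \<subseteq> carrier A\<^sub>T"
  using artin_gen_closed[of "full_subgraph \<Gamma> T"] by simp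

lemma weval_T_closed: "w \<in> words T \<Longrightarrow> weval A\<^sub>T gen\<^sub>T w \<in> carrier A\<^sub>T"
  using AT.weval_closed[OF gen_T_closed] .

lemma gen_act_stuck:
  assumes "c \<in> chambers T" "r \<in> T" "c (simple_root r) = simple_root s"
  shows "gen_act T s b (c, a) = (c, weval A\<^sub>T gen\<^sub>T [(r, b)] \<otimes>\<^bsub>A\<^sub>T\<^esub> a)"
proof -
  have the: "(THE r. r \<in> T \<and> c (simple_root r) = simple_root s) = r"
  proof (rule the_equality)
    fix r' assume "r' \<in> T \<and> c (simple_root r') = simple_root s"
    then have "simple_root r' = simple_root r" 
      using chambers_inj[OF assms(1), of "simple_root r'" "simple_root r"] assms(3) by simp
    then show "r' = r" by (rule root_inj)
  qed (use assms in simp)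
  have "\<exists>r\<in>T. c (simple_root r) = simple_root s" using assms(2,3) by blast
  then show ?thesis by (simp only: gen_act_def fst_conv snd_conv the if_True)
qed

lemma gen_act_free:
  assumes "\<And>r. r \<in> T \<Longrightarrow> c (simple_root r) \<noteq> simple_root s"
  shows "gen_act T s b (c, a) = (reflect s \<circ> c, a)"
  using assms by (auto simp: gen_act_def)

lemma gen_act_closed:
  assumes "s \<in> V" "e \<in> states T"
  shows "gen_act T s b e \<in> states T"
proof -
  obtain c a where e: "e = (c, a)" "c \<in> chambers T" "a \<in> carrier A\<^sub>T"
    using assms(2) by (auto simp: states_def)
  show ?thesis
  proof (cases "\<exists>r\<in>T. c (simple_root r) = simple_root s")
    case True
    then obtain r where r: "r \<in> T" "c (simple_root r) = simple_root s" by blast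
    then have "weval A\<^sub>T gen\<^sub>T [(r, b)] \<in> carrier A\<^sub>T" by (intro weval_T_closed) simp
    then show ?thesis unfolding e(1) gen_act_stuck[OF e(2) r] using e by (simp add: states_def del: weval.simps)
  next
    case False
    then show ?thesis
      using reflect_chambers(1)[OF T_sub e(2) assms(1)] e gen_act_free[of c s b a]
      by (auto simp: states_def)
  qed
qed

lemma gen_act_inverse:
  assumes "s \<in> V" "e \<in> states T"
  shows "gen_act T s b (gen_act T s (\<not> b) e) = e"
proof -
  obtain c a where e: "e = (c, a)" "c \<in> chambers T" "a \<in> carrier A\<^sub>T"
    using assms(2) by (auto simp: states_def)
  show ?thesis
  proof (cases "\<exists>r\<in>T. c (simple_root r) = simple_root s")
    case True
    then obtain r where r: "r \<in> T" "c (simple_root r) = simple_root s" by blast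
    have "gen\<^sub>T r \<in> carrier A\<^sub>T" using gen_T_closed r by blast
    then have "weval A\<^sub>T gen\<^sub>T [(r, b)] \<otimes>\<^bsub>A\<^sub>T\<^esub> (weval A\<^sub>T gen\<^sub>T [(r, \<not> b)] \<otimes>\<^bsub>A\<^sub>T\<^esub> a) = a"
      using e(3) by (cases b) (auto simp: AT.m_assoc[symmetric])
    then show ?thesis unfolding e(1) gen_act_stuck[OF e(2) r] by simp
  next
    case False
    then have free: "r \<in> T \<Longrightarrow> c (simple_root r) \<noteq> simple_root s" for r by blast
    have "gen_act T s b (reflect s \<circ> c, a) = (reflect s \<circ> (reflect s \<circ> c), a)"
      by (rule gen_act_free) (rule reflect_chambers(2)[OF T_sub e(2) assms(1) free])
    also have "reflect s \<circ> (reflect s \<circ> c) = c" using assms(1) by (simp add: fun_eq_iff)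
    moreover have "gen_act T s (\<not> b) (c, a) = (reflect s \<circ> c, a)" by (rule gen_act_free) (rule free)
    ultimately show ?thesis by (simp only: e(1))
  qed
qed

abbreviation pos_act :: "'a \<Rightarrow> (('a \<Rightarrow> real) \<Rightarrow> 'a \<Rightarrow> real) \<times> 'a word set \<Rightarrow>
    (('a \<Rightarrow> real) \<Rightarrow> 'a \<Rightarrow> real) \<times> 'a word set" where
  "pos_act s \<equiv> gen_act T s True"

lemma pos_run_states: "set xs \<subseteq> V \<Longrightarrow> e \<in> states T \<Longrightarrow> foldr pos_act xs e \<in> states T"
  by (induction xs) (auto intro: gen_act_closed)

lemma supp_in_cox_iff:
  assumes "set xs \<subseteq> V" "set xs \<subseteq> S"
  shows "supp_in S (cox xs v) \<longleftrightarrow> supp_in S v"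
  using supp_in_cox[OF assms(2)] supp_in_cox[of "rev xs" S "cox xs v"] cox_rev[OF assms(1)] assms(2)
  by auto

text \<open>Words in S preserve the property of being supported in S, so no root of T can be carried
  to the simple root of a letter in S, and no letter gets stuck.\<close>

lemma pos_run_free:
  assumes c: "c \<in> chambers T" and xs: "set xs \<subseteq> S" "S \<subseteq> V"
    and free: "\<And>r. r \<in> T \<Longrightarrow> \<not> supp_in S (c (simple_root r))"
  shows "foldr pos_act xs (c, a) = (cox xs \<circ> c, a)"
  using xs(1)
proof (induction xs)
  case (Cons z xs)
  have "set xs \<subseteq> V" using Cons.prems xs(2) by auto
  then have "(cox xs \<circ> c) (simple_root r) \<noteq> simple_root z" if "r \<in> T" for r
    using supp_in_cox_iff[of xs S "c (simple_root r)"] free[OF that] Cons.prems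
      supp_in_root[of z S] by auto
  then show ?case using Cons gen_act_free[of "cox xs \<circ> c" z] by (simp add: comp_def)
qed auto

text \<open>
  In rank two, with a single root \<open>r\<close> of \<open>T\<close> in the plane of \<open>s\<close> and \<open>t\<close>, an alternating word of
  length \<open>m\<close> crosses the wall of \<open>r\<close> at most once: between two crossings the image of the root
  runs through all \<open>m\<close> positive roots of the dihedral group.
\<close>

lemma pos_run_single:
  assumes c: "c \<in> chambers T" and l: "label \<Gamma> {x, y} = Some m"
    and r: "r \<in> T" and single: "\<And>r'. r' \<in> T \<Longrightarrow> supp_in {x, y} (c (simple_root r')) \<Longrightarrow> r' = r"
    and k: "k \<le> m" and a: "a \<in> carrier A\<^sub>T"
  shows "foldr pos_act (altw x y k) (c, a) = (cox (altw x y k) \<circ> c, a) \<or>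
    (\<exists>c' xs j. foldr pos_act (altw x y k) (c, a) = (c', gen\<^sub>T r \<otimes>\<^bsub>A\<^sub>T\<^esub> a) \<and>
      c' \<circ> reflect r = cox (altw x y k) \<circ> c \<and> set xs \<subseteq> {x, y} \<and> c' = cox xs \<circ> c \<and> j < k \<and>
      c' (simple_root r) = cox (if even j then altw y x (k - 1 - j) else altw x y (k - 1 - j))
        (simple_root (if even j then x else y)))"
  using k
proof (induction k)
  case (Suc k)
  note xy = label_SomeD[OF l]
  define z where "z = (if even k then x else y)"
  have z: "z \<in> V" "z \<in> {x, y}" using xy by (auto simp: z_def)
  have V: "{x, y} \<subseteq> V" using xy by auto
  have rV: "r \<in> V" using r T_sub by blast
  have alt: "altw x y (Suc k) = z # altw x y k" by (simp add: z_def)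
  have only_r: "r' = r" if "r' \<in> T" "(cox xs \<circ> c) (simple_root r') = simple_root z" "set xs \<subseteq> {x, y}" for r' xs
    using single[OF that(1)] supp_in_cox_iff[of xs "{x, y}" "c (simple_root r')"] that V
      supp_in_root[OF z(2)] by auto
  consider "foldr pos_act (altw x y k) (c, a) = (cox (altw x y k) \<circ> c, a)"
    | c' xs j where "foldr pos_act (altw x y k) (c, a) = (c', gen\<^sub>T r \<otimes>\<^bsub>A\<^sub>T\<^esub> a)"
      "c' \<circ> reflect r = cox (altw x y k) \<circ> c" "set xs \<subseteq> {x, y}" "c' = cox xs \<circ> c" "j < k"
      "c' (simple_root r) = cox (if even j then altw y x (k - 1 - j) else altw x y (k - 1 - j))
        (simple_root (if even j then x else y))"
    using Suc.IH[OF Suc_leD[OF Suc.prems]] by blast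
  then show ?case
  proof cases
    case 1
    define c' where "c' = cox (altw x y k) \<circ> c"
    have "(c', a) \<in> states T"
      using pos_run_states[of "altw x y k" "(c, a)"] 1 c a V set_altw[of x y k]
      by (auto simp: states_def c'_def)
    then have c': "c' \<in> chambers T" by (simp add: states_def)
    show ?thesis
    proof (cases "\<exists>r'\<in>T. c' (simple_root r') = simple_root z")
      case True
      then have c'r: "c' (simple_root r) = simple_root z"
        using only_r[of _ "altw x y k"] set_altw[of x y k] by (auto simp: c'_def)
      have "foldr pos_act (altw x y (Suc k)) (c, a) = (c', gen\<^sub>T r \<otimes>\<^bsub>A\<^sub>T\<^esub> a)"
        using 1 gen_act_stuck[OF c' r c'r, of True a] gen_T_closed r
        by (auto simp: alt c'_def[symmetric] image_subset_iff simp del: altw.simps)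
      moreover have "c' \<circ> reflect r = cox (altw x y (Suc k)) \<circ> c"
        using chambers_reflect[OF c' rV z(1) c'r]
        by (simp add: alt c'_def comp_def del: altw.simps)
      ultimately show ?thesis
        using set_altw[of x y k] c'r
        by (intro disjI2 exI[of _ c'] exI[of _ "altw x y k"] exI[of _ k]) (auto simp: c'_def z_def comp_def)
    next
      case False
      then show ?thesis
        using 1 gen_act_free[of c' z True a] by (simp add: alt c'_def comp_def del: altw.simps)
    qed
  next
    case (2 c' xs j)
    \<comment> \<open>The number of letters applied since the crossing at step j; x' is the letter
      that was stuck there.\<close>
    define i where "i = k - 1 - j"
    define x' y' where "x' = (if even j then x else y)" and "y' = (if even j then y else x)"
    have x'y': "x' \<in> V" "y' \<in> V" "x' \<noteq> y'" using xy by (auto simp: x'_def y'_def)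
    have l': "label \<Gamma> {x', y'} = Some m" using l by (auto simp: x'_def y'_def insert_commute)
    have c'r: "c' (simple_root r) = cox (altw y' x' i) (simple_root x')"
      using 2(6) by (auto simp: x'_def y'_def i_def)
    have z_i: "z = (if even i then y' else x')"
      using 2(5) by (auto simp: z_def x'_def y'_def i_def)
    have i: "Suc i < m" using 2(5) Suc.prems by (simp add: i_def)
    \<comment> \<open>As Suc i < m, the image of the root has two positive coordinates if i > 0. If
      i = 0 it is the simple root of x', while the next letter is y'. In neither case does the
      letter z get stuck.\<close>
    have "c' (simple_root r') \<noteq> simple_root z" if "r' \<in> T" for r'
    proof
      assume eq: "c' (simple_root r') = simple_root z"
      then have "r' = r" using only_r[OF that] 2 by auto
      with eq have root: "cox (altw y' x' i) (simple_root x') = simple_root z" using c'r by simp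
      have p: "0 < cheb (- cos_form x' y') (Suc i)" using cheb_label(4)[OF l'] i by simp
      have q: "0 < cheb (- cos_form x' y') i" if "i \<noteq> 0" using cheb_label(4)[OF l'] i that by simp
      show False
      proof (cases "i = 0")
        case True
        then show False using fun_cong[OF root, of x'] z_i x'y' by (simp add: root_apply)
      next
        case False
        have "cox (altw y' x' i) (simple_root x') x' > 0" "cox (altw y' x' i) (simple_root x') y' > 0"
          using p q[OF False] x'y' by (auto simp: cox_altw_root root_apply)
        then show False unfolding root using z_i x'y' by (auto simp: root_apply split: if_splits)
      qed
    qed
    then have "foldr pos_act (altw x y (Suc k)) (c, a) = (reflect z \<circ> c', gen\<^sub>T r \<otimes>\<^bsub>A\<^sub>T\<^esub> a)"
      using 2(1) gen_act_free[of c' z] by (simp add: alt del: altw.simps)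
    moreover have "(reflect z \<circ> c') \<circ> reflect r = cox (altw x y (Suc k)) \<circ> c"
      using fun_cong[OF 2(2)] by (simp add: alt comp_def del: altw.simps)
    moreover have "(reflect z \<circ> c') (simple_root r) = cox (altw y' x' (Suc i)) (simple_root x')"
      using c'r z_i by simp
    moreover have "Suc i = Suc k - 1 - j" using 2(5) by (simp add: i_def)
    ultimately show ?thesis
      using 2(3-5) z(2)
      by (intro disjI2 exI[of _ "reflect z \<circ> c'"] exI[of _ "z # xs"] exI[of _ j])
        (auto simp: x'_def y'_def comp_def)
  qed
qed simp

text \<open>
  If two roots of \<open>T\<close> lie in the plane of \<open>s\<close> and \<open>t\<close>, positivity of \<open>c\<inverse>\<close> on these forces them to
  be the simple roots of that plane.
\<close>

lemma two_roots_in_plane: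
  assumes c: "c \<in> chambers T" and st: "s \<in> V" "t \<in> V" "s \<noteq> t"
    and r: "r1 \<in> T" "r2 \<in> T" "r1 \<noteq> r2"
    and supp: "supp_in {s, t} (c (simple_root r1))" "supp_in {s, t} (c (simple_root r2))"
  shows "\<exists>r\<in>T. c (simple_root r) = simple_root s"
proof -
  obtain w where w: "set w \<subseteq> V" "c = cox w" using c by (auto simp: chambers_def)
  define p1 q1 p2 q2 where "p1 = c (simple_root r1) s" and "q1 = c (simple_root r1) t"
    and "p2 = c (simple_root r2) s" and "q2 = c (simple_root r2) t"
  have nn: "0 \<le> p1" "0 \<le> q1" "0 \<le> p2" "0 \<le> q2"
    using c r by (auto simp: p1_def q1_def p2_def q2_def chambers_def nonneg_def)
  have v: "c (simple_root r1) = (\<lambda>x. p1 * simple_root s x + q1 * simple_root t x)"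
    "c (simple_root r2) = (\<lambda>x. p2 * simple_root s x + q2 * simple_root t x)"
    using supp st by (auto simp: supp_in_def root_apply p1_def q1_def p2_def q2_def)
  have rV: "r1 \<in> V" "r2 \<in> V" using r T_sub by auto
  have indep: "p = 0 \<and> q = 0" if "c (\<lambda>x. p * simple_root r1 x + q * simple_root r2 x) = (\<lambda>x. 0)" for p q
  proof -
    have "c (\<lambda>x. 0) = (\<lambda>x. 0)" using chambers_lin[OF c, of 0 _ 0] by simp
    then have "(\<lambda>x. p * simple_root r1 x + q * simple_root r2 x) = (\<lambda>x. 0)"
      using chambers_inj[OF c] that by metis
    from fun_cong[OF this, of r1] fun_cong[OF this, of r2] show ?thesis
      using r by (simp add: root_apply)
  qed
  \<comment> \<open>The determinant of the two images in the plane, nonzero because c is linear and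
    injective.\<close>
  define D where "D = p1 * q2 - p2 * q1"
  have comb: "c (\<lambda>x. q2 * simple_root r1 x + - q1 * simple_root r2 x) = (\<lambda>x. D * simple_root s x)"
    "c (\<lambda>x. p2 * simple_root r1 x + - p1 * simple_root r2 x) = (\<lambda>x. - D * simple_root t x)"
    unfolding chambers_lin[OF c, of q2 _ "- q1"] chambers_lin[OF c, of p2 _ "- p1"]
    by (simp_all add: v D_def algebra_simps)
  have D: "D \<noteq> 0"
  proof
    assume "D = 0"
    then have "q2 = 0 \<and> - q1 = 0" "p2 = 0 \<and> - p1 = 0"
      using comb by (intro indep, simp)+
    then have "c (simple_root r1) = (\<lambda>x. 0)" using v by simp
    then show False using indep[of 1 0] by simp
  qed
  \<comment> \<open>The preimage of the simple root of s is again a root, so its coordinates q2 / D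
    and - q1 / D do not have opposite signs. As q1 and q2 are nonnegative, one of them is zero, and
    the corresponding image is a multiple of the simple root of s.\<close>
  define \<beta> where "\<beta> = cox (rev w) (simple_root s)"
  have "c \<beta> = simple_root s" using cox_rev'[OF w(1)] by (simp add: w(2) \<beta>_def)
  have \<beta>: "\<beta> = (\<lambda>x. q2 / D * simple_root r1 x + - q1 / D * simple_root r2 x)"
  proof (rule chambers_inj[OF c])
    have "c (\<lambda>x. q2 / D * simple_root r1 x + - q1 / D * simple_root r2 x) = simple_root s"
    proof -
      have "q2 / D * p1 + - q1 / D * p2 = (q2 * p1 - q1 * p2) / D"
        by (simp add: diff_divide_distrib)
      also have "q2 * p1 - q1 * p2 = D" by (simp add: D_def mult.commute)
      finally have one: "q2 / D * p1 + - q1 / D * p2 = 1" using D by simp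
      have "q2 / D * (p1 * simple_root s x + q1 * simple_root t x) +
          - q1 / D * (p2 * simple_root s x + q2 * simple_root t x) =
          (q2 / D * p1 + - q1 / D * p2) * simple_root s x" for x
        by (simp add: algebra_simps)
      then show ?thesis
        unfolding chambers_lin[OF c, of "q2 / D" _ "- q1 / D"] v one by simp
    qed
    then show "c \<beta> = c (\<lambda>x. q2 / D * simple_root r1 x + - q1 / D * simple_root r2 x)"
      using \<open>c \<beta> = simple_root s\<close> by simp
  qed
  have "nonneg \<beta> \<or> nonneg (\<lambda>x. - \<beta> x)"
    using root_nonneg_or_nonpos[of "rev w" s] w st by (simp add: \<beta>_def)
  then have "(0 \<le> q2 / D \<and> 0 \<le> - q1 / D) \<or> (0 \<le> - (q2 / D) \<and> 0 \<le> - (- q1 / D))"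
  proof
    assume "nonneg \<beta>"
    from this[unfolded nonneg_def \<beta>, rule_format, of r1] this[unfolded nonneg_def \<beta>, rule_format, of r2]
    show ?thesis using r by (simp add: root_apply)
  next
    assume "nonneg (\<lambda>x. - \<beta> x)"
    from this[unfolded nonneg_def \<beta>, rule_format, of r1] this[unfolded nonneg_def \<beta>, rule_format, of r2]
    show ?thesis using r by (simp add: root_apply)
  qed
  then have "q1 = 0 \<or> q2 = 0"
    using D nn by (cases "D > 0") (auto simp: zero_le_divide_iff divide_le_0_iff)
  moreover have norm: "inner_form (c (simple_root r')) (c (simple_root r')) = 1" if "r' \<in> V" for r'
    using chambers_inner_form[OF c] inner_form_root[OF that that] by simp
  ultimately show ?thesis
    using inner_form_scaled_root[OF st(1) norm[OF rV(1)], of p1] v(1) nn r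
      inner_form_scaled_root[OF st(1) norm[OF rV(2)], of p2] v(2) by auto
qed

text \<open>Cosine is injective on [0, pi], and a finite label never gives the value -1 of a missing
  edge. Since chambers preserve the form, edges of T can be compared with edges met
  elsewhere.\<close>

lemma cos_form_inj_label:
  assumes "label \<Gamma> {s, t} = Some m" "r \<noteq> r'" "cos_form r r' = cos_form s t"
  shows "label \<Gamma> {r, r'} = Some m"
proof (cases "label \<Gamma> {r, r'}")
  case None
  then have "cos (pi / real m) = 1"
    using assms cos_form_label(1)[OF assms(1)] by (simp add: cos_form_def)
  then show ?thesis using cos_form_label(2)[OF assms(1)] sin_cos_squared_add[of "pi / real m"] by simp
next
  case (Some m')
  note m = label_SomeD[OF assms(1)] and m' = label_SomeD[OF Some]
  have "cos (pi / real m') = cos (pi / real m)"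
    using cos_form_label(1)[OF assms(1)] cos_form_label(1)[OF Some] assms(3) by simp
  moreover have "0 \<le> pi / real k \<and> pi / real k \<le> pi" if "2 \<le> k" for k
    using that by (auto simp: field_simps)
  ultimately have "pi / real m' = pi / real m"
    using cos_inj_pi m(4) m'(4) by blast
  then show ?thesis using Some m m' by (simp add: field_simps)
qed

lemma pos_run_stuck:
  assumes c: "c \<in> chambers T" and f: "\<And>z. z \<in> S \<Longrightarrow> f z \<in> T \<and> c (simple_root (f z)) = simple_root z"
    and xs: "set xs \<subseteq> S" and a: "a \<in> carrier A\<^sub>T"
  shows "foldr pos_act xs (c, a) = (c, weval A\<^sub>T gen\<^sub>T (map (\<lambda>z. (f z, True)) xs) \<otimes>\<^bsub>A\<^sub>T\<^esub> a)"
  using xs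
proof (induction xs)
  case (Cons z xs)
  have g: "gen\<^sub>T (f z) \<in> carrier A\<^sub>T" using gen_T_closed f Cons by auto
  have "map (\<lambda>z. (f z, True)) xs \<in> words T"
    unfolding words_def using f Cons.prems by (auto simp: in_lists_conv_set)
  then have "weval A\<^sub>T gen\<^sub>T (map (\<lambda>z. (f z, True)) xs) \<in> carrier A\<^sub>T" by (rule weval_T_closed)
  then show ?case
    using Cons f[of z] g a gen_act_stuck[OF c, of "f z" z True] by (auto simp: AT.m_assoc)
qed (use a in auto)

text \<open>The cases count the roots of T that c sends into the plane of s and t. With none, the
  relation is that of the Coxeter group. With one, each side gets stuck at most once, always
  multiplying by the same generator. With two, every letter is stuck and the relation is a braid
  relation of the Artin group on T.\<close>

lemma pos_run_braid:
  assumes l: "label \<Gamma> {s, t} = Some m" and e: "e \<in> states T"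
  shows "foldr pos_act (altw s t m) e = foldr pos_act (altw t s m) e"
proof -
  obtain c a where ca: "e = (c, a)" "c \<in> chambers T" "a \<in> carrier A\<^sub>T"
    using e by (auto simp: states_def)
  note st = label_SomeD[OF l]
  have V: "{s, t} \<subseteq> V" using st by auto
  have l': "label \<Gamma> {t, s} = Some m" using l by (simp add: insert_commute)
  have alt: "set (altw s t m) \<subseteq> {s, t}" "set (altw t s m) \<subseteq> {s, t}"
    using set_altw[of s t m] set_altw[of t s m] by auto
  have braid: "cox (altw s t m) = cox (altw t s m)" using cox_braid[OF l] by blast
  define R where "R = {r \<in> T. supp_in {s, t} (c (simple_root r))}"
  consider (none) "R = {}" | (single) r where "R = {r}"
    | (two) r1 r2 where "r1 \<in> R" "r2 \<in> R" "r1 \<noteq> r2" by blast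
  then show ?thesis
  proof cases
    case none
    then show ?thesis
      using pos_run_free[OF ca(2) alt(1) V] pos_run_free[OF ca(2) alt(2) V] braid
      by (auto simp: ca(1) R_def)
  next
    case (single r)
    then have r: "r \<in> T" "r \<in> V" and only: "\<And>r'. r' \<in> T \<Longrightarrow> supp_in {s, t} (c (simple_root r')) \<Longrightarrow> r' = r"
      using T_sub by (auto simp: R_def)
    define P where "P = cox (altw s t m) \<circ> c"
    have st_states: "foldr pos_act (altw s t m) (c, a) \<in> states T" "foldr pos_act (altw t s m) (c, a) \<in> states T"
      using pos_run_states[of _ "(c, a)"] alt V e ca by auto
    have 1: "foldr pos_act (altw s t m) (c, a) = (P, a) \<or>
        (\<exists>c'. foldr pos_act (altw s t m) (c, a) = (c', gen\<^sub>T r \<otimes>\<^bsub>A\<^sub>T\<^esub> a) \<and> c' \<circ> reflect r = P)"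
      using pos_run_single[OF ca(2) l r(1) only order_refl ca(3)] unfolding P_def by blast
    have 2: "foldr pos_act (altw t s m) (c, a) = (P, a) \<or>
        (\<exists>c'. foldr pos_act (altw t s m) (c, a) = (c', gen\<^sub>T r \<otimes>\<^bsub>A\<^sub>T\<^esub> a) \<and> c' \<circ> reflect r = P)"
      using pos_run_single[OF ca(2) l' r(1) _ order_refl ca(3)] only unfolding P_def braid
      by (simp add: insert_commute) blast
    \<comment> \<open>One side cannot get stuck while the other does not: the two chambers would
      send the root of r to opposite vectors, both nonnegative.\<close>
    have mixed: False if "(P, a') \<in> states T" "(c', a'') \<in> states T" "c' \<circ> reflect r = P" for c' a' a''
    proof -
      have c': "c' \<in> chambers T" "P \<in> chambers T" using that by (auto simp: states_def)
      have "P (simple_root r) = c' (reflect r (simple_root r))" using that(3) by auto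
      also have "\<dots> = c' (\<lambda>x. - 1 * simple_root r x + 0 * simple_root r x)"
        unfolding reflect_root_self[OF r(2)] by simp
      finally have "P (simple_root r) = c' (\<lambda>x. - 1 * simple_root r x + 0 * simple_root r x)" .
      then have "P (simple_root r) = (\<lambda>x. - c' (simple_root r) x)"
        unfolding chambers_lin[OF c'(1)] by simp
      moreover have "nonneg (c' (simple_root r))" "nonneg (P (simple_root r))"
        using c' r(1) by (auto simp: chambers_def)
      ultimately have "P (simple_root r) = (\<lambda>x. 0)"
        unfolding nonneg_def by (auto simp: fun_eq_iff intro: antisym)
      also have "(\<lambda>x. 0) = P (\<lambda>x. 0)" using chambers_lin[OF c'(2), of 0 _ 0] by simp
      finally have "simple_root r = (\<lambda>x. 0)" by (rule chambers_inj[OF c'(2)])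
      from fun_cong[OF this, of r] show False by simp
    qed
    have "c1 = c2" if "c1 \<circ> reflect r = P" "c2 \<circ> reflect r = P" for c1 c2
    proof
      fix v
      show "c1 v = c2 v"
        using fun_cong[OF that(1), of "reflect r v"] fun_cong[OF that(2), of "reflect r v"] r(2) by simp
    qed
    then show ?thesis using 1 2 mixed st_states unfolding ca(1) by metis
  next
    case (two r1 r2)
    have r12: "r1 \<in> T" "r2 \<in> T" "supp_in {s, t} (c (simple_root r1))" "supp_in {s, t} (c (simple_root r2))"
      using two by (auto simp: R_def)
    obtain rs where rs: "rs \<in> T" "c (simple_root rs) = simple_root s"
      using two_roots_in_plane[OF ca(2) st(1-3) r12(1,2) two(3) r12(3,4)] by blast
    obtain rt where rt: "rt \<in> T" "c (simple_root rt) = simple_root t"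
      using two_roots_in_plane[OF ca(2) st(2,1) _ r12(1,2) two(3)] r12(3,4) st(3)
      by (auto simp: insert_commute)
    define f where "f z = (if z = s then rs else rt)" for z
    have f: "z \<in> {s, t} \<Longrightarrow> f z \<in> T \<and> c (simple_root (f z)) = simple_root z" for z
      using rs rt by (auto simp: f_def)
    have "rs \<noteq> rt" using rs rt st root_inj by metis
    moreover have "cos_form rs rt = cos_form s t"
      using chambers_inner_form[OF ca(2), of "simple_root rs" "simple_root rt"] rs rt st T_sub
      by (auto simp: inner_form_root subset_iff)
    ultimately have "label \<Gamma> {rs, rt} = Some m" using cos_form_inj_label[OF l] by blast
    then have "label (full_subgraph \<Gamma> T) {rs, rt} = Some m"
      using rs rt by (simp add: full_subgraph_def)
    from weval_alternating[OF presentation_full_subgraph[OF presentation_graph T_sub] this]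
    have "weval A\<^sub>T gen\<^sub>T (alternating m rs rt) = weval A\<^sub>T gen\<^sub>T (alternating m rt rs)" .
    moreover have fs: "f s = rs" "f t = rt" using st by (auto simp: f_def)
    have "map (\<lambda>z. (f z, True)) (altw x y k) = map (\<lambda>z. (z, True)) (altw (f x) (f y) k)" for x y k
      by (induction k) auto
    then have "{map (\<lambda>z. (f z, True)) (altw s t m), map (\<lambda>z. (f z, True)) (altw t s m)} =
        {alternating m rs rt, alternating m rt rs}"
      using fs alternating_eq_map[of m rs rt] alternating_eq_map[of m rt rs]
      by (auto simp: map_fst_alternating)
    ultimately have "weval A\<^sub>T gen\<^sub>T (map (\<lambda>z. (f z, True)) (altw s t m)) =
        weval A\<^sub>T gen\<^sub>T (map (\<lambda>z. (f z, True)) (altw t s m))"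
      by (auto simp: doubleton_eq_iff)
    then show ?thesis
      using pos_run_stuck[OF ca(2) f alt(1) ca(3)] pos_run_stuck[OF ca(2) f alt(2) ca(3)]
      by (simp add: ca(1))
  qed
qed

lemma run_relation:
  assumes "(u, v) \<in> artin_relations \<Gamma>" "e \<in> states T"
  shows "run (gen_act T) u e = run (gen_act T) v e"
proof -
  obtain m s t where uv: "u = alternating m s t" "v = alternating m t s" "label \<Gamma> {s, t} = Some m"
    using assms(1) by (auto simp: artin_relations_def)
  have "run (gen_act T) (alternating k x y) e = foldr pos_act (map fst (alternating k x y)) e" for k x y
    by (induction k arbitrary: x y) auto
  then show ?thesis
    using pos_run_braid[OF uv(3) assms(2)] by (simp add: uv(1,2) map_fst_alternating)
qed

lemma run_right_mult:
  assumes "w \<in> words V" "(c, a) \<in> states T" "b \<in> carrier A\<^sub>T"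
  shows "run (gen_act T) w (c, a \<otimes>\<^bsub>A\<^sub>T\<^esub> b) =
    (fst (run (gen_act T) w (c, a)), snd (run (gen_act T) w (c, a)) \<otimes>\<^bsub>A\<^sub>T\<^esub> b)"
  using assms(1)
proof (induction w)
  case (Cons l w)
  obtain c' a' where ca': "run (gen_act T) w (c, a) = (c', a')" by fastforce
  have "run (gen_act T) w (c, a) \<in> states T"
    using Cons.prems assms(2) by (induction w) (auto intro: gen_act_closed)
  then have c': "c' \<in> chambers T" "a' \<in> carrier A\<^sub>T" by (auto simp: ca' states_def)
  have IH: "run (gen_act T) w (c, a \<otimes>\<^bsub>A\<^sub>T\<^esub> b) = (c', a' \<otimes>\<^bsub>A\<^sub>T\<^esub> b)"
    using Cons by (simp add: ca')
  show ?case
  proof (cases "\<exists>r\<in>T. c' (simple_root r) = simple_root (fst l)")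
    case True
    then obtain r where r: "r \<in> T" "c' (simple_root r) = simple_root (fst l)" by blast
    have "weval A\<^sub>T gen\<^sub>T [(r, snd l)] \<in> carrier A\<^sub>T" using r by (intro weval_T_closed) simp
    then show ?thesis
      using IH ca' c' assms(3) gen_act_stuck[OF c'(1) r] by (simp add: AT.m_assoc del: weval.simps)
  next
    case False
    then show ?thesis using IH ca' gen_act_free[of c' "fst l"] by (simp add: comp_def)
  qed
qed simp

lemma run_parabolic:
  assumes c: "c \<in> chambers T" "\<And>r. r \<in> T \<Longrightarrow> c (simple_root r) = simple_root r"
    and w: "w \<in> words T" and a: "a \<in> carrier A\<^sub>T"
  shows "run (gen_act T) w (c, a) = (c, weval A\<^sub>T gen\<^sub>T w \<otimes>\<^bsub>A\<^sub>T\<^esub> a)"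
  using w
proof (induction w)
  case (Cons l w)
  have "weval A\<^sub>T gen\<^sub>T w \<in> carrier A\<^sub>T" "gen\<^sub>T (fst l) \<in> carrier A\<^sub>T"
    using Cons weval_T_closed gen_T_closed by auto
  then show ?case
    using Cons a gen_act_stuck[OF c(1), of "fst l" "fst l"] c(2) by (auto simp: AT.m_assoc)
qed (use a in simp)

end


section \<open>Parabolic subgroups\<close>

lemma (in group) conjugate_eq_image:
  "conjugate G g H = (\<lambda>x. g \<otimes> x \<otimes> inv g) ` H"
  by (auto simp: conjugate_def l_coset_def r_coset_def)

lemma (in group) conjugation_hom:
  "g \<in> carrier G \<Longrightarrow> (\<lambda>x. g \<otimes> x \<otimes> inv g) \<in> hom G G"
proof (rule homI)
  fix x y assume g: "g \<in> carrier G" and xy: "x \<in> carrier G" "y \<in> carrier G"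
  have "g \<otimes> x \<otimes> inv g \<otimes> (g \<otimes> y \<otimes> inv g) = g \<otimes> x \<otimes> (inv g \<otimes> g) \<otimes> y \<otimes> inv g"
    using g xy by (simp only: m_assoc m_closed inv_closed)
  also have "\<dots> = g \<otimes> (x \<otimes> y) \<otimes> inv g"
    using g xy by (simp add: m_assoc)
  finally show "g \<otimes> (x \<otimes> y) \<otimes> inv g = g \<otimes> x \<otimes> inv g \<otimes> (g \<otimes> y \<otimes> inv g)" by simp
qed auto

lemma (in group) conjugation_inj:
  "g \<in> carrier G \<Longrightarrow> inj_on (\<lambda>x. g \<otimes> x \<otimes> inv g) (carrier G)"
  by (rule inj_onI) simp

lemma (in group) conjugate_generate:
  assumes "g \<in> carrier G" "X \<subseteq> carrier G"
  shows "conjugate G g (generate G X) = generate G (conjugate G g X)"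
proof -
  interpret c: group_hom G G "\<lambda>x. g \<otimes> x \<otimes> inv g"
    by unfold_locales (rule conjugation_hom[OF assms(1)])
  show ?thesis using c.generate_img[OF assms(2)] by (simp add: conjugate_eq_image)
qed

lemma (in group) conjugate_conjugate:
  assumes "g \<in> carrier G" "h \<in> carrier G" "H \<subseteq> carrier G"
  shows "conjugate G g (conjugate G h H) = conjugate G (g \<otimes> h) H"
  unfolding conjugate_eq_image image_image
proof (rule image_cong)
  fix x assume "x \<in> H"
  then have "x \<in> carrier G" using assms by blast
  then show "g \<otimes> (h \<otimes> x \<otimes> inv h) \<otimes> inv g = g \<otimes> h \<otimes> x \<otimes> inv (g \<otimes> h)"
    using assms by (simp add: m_assoc inv_mult_group)
qed simp

lemma (in group) conjugate_closed:
  "g \<in> carrier G \<Longrightarrow> H \<subseteq> carrier G \<Longrightarrow> conjugate G g H \<subseteq> carrier G"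
  by (auto simp: conjugate_eq_image subset_iff)

lemma (in group) conjugate_mono: "H \<subseteq> K \<Longrightarrow> conjugate G g H \<subseteq> conjugate G g K"
  by (auto simp: conjugate_eq_image)

lemma (in group) conjugate_one: "H \<subseteq> carrier G \<Longrightarrow> conjugate G \<one> H = H"
  by (auto simp: conjugate_eq_image subset_iff image_iff)

lemma (in group) conjugate_inv:
  "g \<in> carrier G \<Longrightarrow> H \<subseteq> carrier G \<Longrightarrow> conjugate G (inv g) (conjugate G g H) = H"
  by (simp add: conjugate_conjugate conjugate_one)

lemma (in group) conjugate_inv':
  "g \<in> carrier G \<Longrightarrow> H \<subseteq> carrier G \<Longrightarrow> conjugate G g (conjugate G (inv g) H) = H"
  by (simp add: conjugate_conjugate conjugate_one)

lemma (in group) conjugate_subgroup_elem: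
  assumes "subgroup H G" "b \<in> H"
  shows "conjugate G b H = H"
proof -
  have sub: "conjugate G x H \<subseteq> H" if "x \<in> H" for x
    using that subgroup.m_closed[OF assms(1)] subgroup.m_inv_closed[OF assms(1)]
    by (auto simp: conjugate_eq_image)
  have car: "b \<in> carrier G" "H \<subseteq> carrier G"
    using subgroup.mem_carrier[OF assms] subgroup.subset[OF assms(1)] by auto
  have "H = conjugate G b (conjugate G (inv b) H)" using car by (simp add: conjugate_inv')
  also have "\<dots> \<subseteq> conjugate G b H"
    using sub subgroup.m_inv_closed[OF assms] by (intro conjugate_mono) auto
  finally show ?thesis using sub[OF assms(2)] by blast
qed

lemma (in group) conjugate_subgroup:
  assumes "subgroup H G" "g \<in> carrier G"
  shows "subgroup (conjugate G g H) G"
proof -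
  interpret c: group_hom G G "\<lambda>x. g \<otimes> x \<otimes> inv g"
    by unfold_locales (rule conjugation_hom[OF assms(2)])
  show ?thesis using c.subgroup_img_is_subgroup[OF assms(1)] by (simp add: conjugate_eq_image)
qed

lemma (in group) normalizer_eq:
  assumes "H \<subseteq> carrier G"
  shows "normalizer G H = {g \<in> carrier G. conjugate G g H = H}"
  using assms by (auto simp: normalizer_def stabilizer_def conjugate_def)

section \<open>The embedding of standard parabolic subgroups\<close>

context parabolic_chambers
begin

abbreviation G :: "'a word set monoid" where "G \<equiv> artin_group \<Gamma>"
abbreviation gen :: "'a \<Rightarrow> 'a word set" where "gen \<equiv> artin_gen \<Gamma>"

sublocale G: group G by (rule group_artin_group)

lemma words_T_V: "w \<in> words T \<Longrightarrow> w \<in> words V"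
  using T_sub by (auto simp: words_def)

lemma label_full_subgraph: "label (full_subgraph \<Gamma> T) e = Some m \<Longrightarrow> label \<Gamma> e = Some m"
  by (auto simp: full_subgraph_def restrict_map_def split: if_splits)

lemma gen_T_G: "gen ` T \<subseteq> carrier G"
  using artin_gen_closed[of \<Gamma>] T_sub by blast

lemma standard_parabolic_weval: "standard_parabolic \<Gamma> T = weval G gen ` words T"
  unfolding standard_parabolic_def by (rule G.generate_eq_weval[OF gen_T_G])

lemma artin_action:
  obtains \<phi> where "group_action G (states T) \<phi>"
    "\<And>w e. w \<in> words V \<Longrightarrow> e \<in> states T \<Longrightarrow> \<phi> (weval G gen w) e = run (gen_act T) w e"
proof -
  have rel: "(u, v) \<in> artin_relations \<Gamma> \<Longrightarrow> u \<in> words V \<Longrightarrow> v \<in> words V \<Longrightarrow> e \<in> states T \<Longrightarrow>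
      run (gen_act T) u e = run (gen_act T) v e" for u v e
    by (rule run_relation)
  obtain \<phi> where "group_action (presented_group V (artin_relations \<Gamma>)) (states T) \<phi>"
    "\<And>w e. w \<in> words V \<Longrightarrow> e \<in> states T \<Longrightarrow>
      \<phi> (pres_class V (artin_relations \<Gamma>) w) e = run (gen_act T) w e"
    using presented_group_action[OF gen_act_closed gen_act_inverse rel] by blast
  then show ?thesis using that by (simp add: artin_group_def[symmetric] weval_artin_gen)
qed

lemma id_state: "id \<in> chambers T" "r \<in> T \<Longrightarrow> id (simple_root r) = simple_root r"
  using id_chambers[OF T_sub] by auto

lemma run_base:
  assumes "w \<in> words T"
  shows "run (gen_act T) w (id, \<one>\<^bsub>A\<^sub>T\<^esub>) = (id, weval A\<^sub>T gen\<^sub>T w)"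
  using run_parabolic[OF id_state assms AT.one_closed]
  by (simp only: AT.r_one[OF weval_T_closed[OF assms]])

text \<open>Injectivity: an element of the image, applied to the base state, shows in the second
  component the element of the smaller Artin group from which it came.\<close>

lemma parabolic_inclusion:
  obtains \<iota> where "\<iota> \<in> hom A\<^sub>T G" "inj_on \<iota> (carrier A\<^sub>T)"
    "\<And>w. w \<in> words T \<Longrightarrow> \<iota> (weval A\<^sub>T gen\<^sub>T w) = weval G gen w"
    "\<iota> ` carrier A\<^sub>T = standard_parabolic \<Gamma> T"
proof -
  let ?R = "artin_relations (full_subgraph \<Gamma> T)"
  have rel: "weval G gen u = weval G gen v" if uv: "(u, v) \<in> ?R" for u v
  proof -
    obtain m s t where "u = alternating m s t" "v = alternating m t s"
      "label (full_subgraph \<Gamma> T) {s, t} = Some m"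
      using uv unfolding artin_relations_def by blast
    then show ?thesis
      using weval_alternating[OF presentation_graph label_full_subgraph] by simp
  qed
  obtain \<iota> where \<iota>: "\<iota> \<in> hom (presented_group T ?R) G"
    "\<And>w. w \<in> words T \<Longrightarrow> \<iota> (pres_class T ?R w) = weval G gen w"
    using presented_group_hom[OF G.is_group gen_T_G rel] by blast
  have \<iota>_weval: "\<iota> (weval A\<^sub>T gen\<^sub>T w) = weval G gen w" if "w \<in> words T" for w
    using \<iota>(2)[OF that] weval_artin_gen[of w "full_subgraph \<Gamma> T"] that by simp
  have car: "carrier A\<^sub>T = weval A\<^sub>T gen\<^sub>T ` words T"
    by (simp add: artin_group_def[of "full_subgraph \<Gamma> T"] carrier_presented_group
        weval_artin_gen[of _ "full_subgraph \<Gamma> T", unfolded artin_group_def verts_full_subgraph] cong: image_cong)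
  obtain \<phi> where \<phi>: "group_action G (states T) \<phi>"
    "\<And>w e. w \<in> words V \<Longrightarrow> e \<in> states T \<Longrightarrow> \<phi> (weval G gen w) e = run (gen_act T) w e"
    using artin_action by blast
  have "\<phi> (weval G gen w) (id, \<one>\<^bsub>A\<^sub>T\<^esub>) = (id, weval A\<^sub>T gen\<^sub>T w)" if "w \<in> words T" for w
    using \<phi>(2)[OF words_T_V[OF that], of "(id, \<one>\<^bsub>A\<^sub>T\<^esub>)"] id_state(1)
    by (simp add: run_base[OF that] states_def)
  then have inj: "weval A\<^sub>T gen\<^sub>T u = weval A\<^sub>T gen\<^sub>T v"
    if "u \<in> words T" "v \<in> words T" "weval G gen u = weval G gen v" for u v
    using that by (metis prod.inject)
  have "inj_on \<iota> (carrier A\<^sub>T)"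
  proof (rule inj_onI)
    fix x y assume "x \<in> carrier A\<^sub>T" "y \<in> carrier A\<^sub>T" and eq: "\<iota> x = \<iota> y"
    then obtain u v where uv: "u \<in> words T" "v \<in> words T" "x = weval A\<^sub>T gen\<^sub>T u" "y = weval A\<^sub>T gen\<^sub>T v"
      unfolding car by blast
    then show "x = y" using inj[OF uv(1,2)] eq \<iota>_weval by simp
  qed
  moreover have "\<iota> ` carrier A\<^sub>T = standard_parabolic \<Gamma> T"
    unfolding car standard_parabolic_weval image_image by (rule image_cong) (auto simp: \<iota>_weval)
  moreover have "\<iota> \<in> hom A\<^sub>T G" using \<iota>(1) by (simp add: artin_group_def[of "full_subgraph \<Gamma> T"])
  ultimately show ?thesis using that \<iota>_weval by blast
qed

lemma alternative_pair_standard_parabolic: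
  assumes "power_alternative A\<^sub>T" "x \<in> standard_parabolic \<Gamma> T" "y \<in> standard_parabolic \<Gamma> T"
  shows "alternative_pair G x y"
proof -
  obtain \<iota> where \<iota>: "\<iota> \<in> hom A\<^sub>T G" "inj_on \<iota> (carrier A\<^sub>T)" "\<iota> ` carrier A\<^sub>T = standard_parabolic \<Gamma> T"
    using parabolic_inclusion by metis
  obtain x' y' where "x' \<in> carrier A\<^sub>T" "x = \<iota> x'" "y' \<in> carrier A\<^sub>T" "y = \<iota> y'"
    using assms(2,3) unfolding \<iota>(3)[symmetric] by blast
  then show ?thesis
    using G.alternative_pair_hom[OF AT.is_group \<iota>(1,2)] assms(1) by (simp add: power_alternative_iff)
qed

text \<open>
  If a conjugate \<open>g s g\<inverse>\<close> of a generator lies in \<open>A\<^sub>T\<close>, then acting on the base state shows that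
  \<open>s\<close> is stuck at the chamber of \<open>g\<inverse>\<close>, which exhibits it as a conjugate within \<open>A\<^sub>T\<close> of a generator.
\<close>

lemma conjugate_gens_in_parabolic:
  assumes S: "S \<subseteq> V" and g: "g \<in> carrier G"
    and sub: "\<And>s. s \<in> S \<Longrightarrow> g \<otimes>\<^bsub>G\<^esub> gen s \<otimes>\<^bsub>G\<^esub> inv\<^bsub>G\<^esub> g \<in> standard_parabolic \<Gamma> T"
  obtains b \<rho> where "b \<in> standard_parabolic \<Gamma> T" "inj_on \<rho> S" "\<rho> ` S \<subseteq> T"
    "\<And>s. s \<in> S \<Longrightarrow> g \<otimes>\<^bsub>G\<^esub> gen s \<otimes>\<^bsub>G\<^esub> inv\<^bsub>G\<^esub> g = b \<otimes>\<^bsub>G\<^esub> gen (\<rho> s) \<otimes>\<^bsub>G\<^esub> inv\<^bsub>G\<^esub> b"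
proof -
  obtain \<iota> where \<iota>: "\<iota> \<in> hom A\<^sub>T G" "inj_on \<iota> (carrier A\<^sub>T)"
    "\<And>w. w \<in> words T \<Longrightarrow> \<iota> (weval A\<^sub>T gen\<^sub>T w) = weval G gen w"
    "\<iota> ` carrier A\<^sub>T = standard_parabolic \<Gamma> T"
    using parabolic_inclusion by metis
  interpret \<iota>: group_hom A\<^sub>T G \<iota> by unfold_locales (rule \<iota>(1))
  obtain \<phi> where \<phi>: "group_action G (states T) \<phi>"
    "\<And>w e. w \<in> words V \<Longrightarrow> e \<in> states T \<Longrightarrow> \<phi> (weval G gen w) e = run (gen_act T) w e"
    using artin_action by blast
  interpret \<phi>: group_action G "states T" \<phi> by (rule \<phi>(1))
  have car: "carrier G = weval G gen ` words V"
    by (simp add: artin_group_def[of \<Gamma>] carrier_presented_group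
        weval_artin_gen[of _ \<Gamma>, unfolded artin_group_def] cong: image_cong)
  obtain v where v: "v \<in> words V" "inv\<^bsub>G\<^esub> g = weval G gen v" using g car G.inv_closed by (metis imageE)
  let ?e = "(id, \<one>\<^bsub>A\<^sub>T\<^esub>)"
  have e: "(id, x) \<in> states T" if "x \<in> carrier A\<^sub>T" for x using that id_state(1) by (simp add: states_def)
  obtain c a where ca: "run (gen_act T) v ?e = (c, a)" by fastforce
  have "run (gen_act T) v ?e \<in> states T"
    using \<phi>.element_image[OF G.inv_closed[OF g] e[OF AT.one_closed] HOL.refl]
    unfolding v(2) \<phi>(2)[OF v(1) e[OF AT.one_closed]] .
  then have c: "c \<in> chambers T" and a: "a \<in> carrier A\<^sub>T" by (auto simp: ca states_def)
  have stuck: "\<exists>r. r \<in> T \<and> c (simple_root r) = simple_root s \<and>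
      g \<otimes>\<^bsub>G\<^esub> gen s \<otimes>\<^bsub>G\<^esub> inv\<^bsub>G\<^esub> g = inv\<^bsub>G\<^esub> (\<iota> a) \<otimes>\<^bsub>G\<^esub> gen r \<otimes>\<^bsub>G\<^esub> \<iota> a" if s: "s \<in> S" for s
  proof -
    have sV: "s \<in> V" and gs: "gen s \<in> carrier G" using s S artin_gen_closed[of \<Gamma>] by auto
    define x where "x = g \<otimes>\<^bsub>G\<^esub> gen s \<otimes>\<^bsub>G\<^esub> inv\<^bsub>G\<^esub> g"
    have xG: "x \<in> carrier G" using g gs by (simp add: x_def)
    obtain w where w: "w \<in> words T" "x = weval G gen w"
      using sub[OF s] unfolding x_def[symmetric] standard_parabolic_weval by blast
    define x' where "x' = weval A\<^sub>T gen\<^sub>T w"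
    have x': "x' \<in> carrier A\<^sub>T" "x = \<iota> x'" using weval_T_closed[OF w(1)] \<iota>(3)[OF w(1)] w by (auto simp: x'_def)
    \<comment> \<open>Both sides are applied to the base state. The right side gives chamber c,
      since x only changes the second component of the base state and the action commutes with right
      multiplication there. Hence s does not move the chamber c.\<close>
    have "gen s \<otimes>\<^bsub>G\<^esub> inv\<^bsub>G\<^esub> g = inv\<^bsub>G\<^esub> g \<otimes>\<^bsub>G\<^esub> x"
      using g gs by (simp add: x_def G.m_assoc[symmetric])
    then have "\<phi> (gen s) (\<phi> (inv\<^bsub>G\<^esub> g) ?e) = \<phi> (inv\<^bsub>G\<^esub> g) (\<phi> x ?e)"
      using \<phi>.composition_rule[OF e[OF AT.one_closed] gs G.inv_closed[OF g]]
        \<phi>.composition_rule[OF e[OF AT.one_closed] G.inv_closed[OF g] xG] by simp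
    moreover have "\<phi> (inv\<^bsub>G\<^esub> g) ?e = (c, a)" using \<phi>(2)[OF v(1) e] v(2) ca by simp
    moreover have "\<phi> x ?e = (id, x')"
      using \<phi>(2)[OF words_T_V[OF w(1)] e[OF AT.one_closed]]
      by (simp only: run_base[OF w(1)] w(2) x'_def)
    moreover have "\<phi> (inv\<^bsub>G\<^esub> g) (id, x') = (c, a \<otimes>\<^bsub>A\<^sub>T\<^esub> x')"
      using \<phi>(2)[OF v(1) e[OF x'(1)]] v(2) ca run_right_mult[OF v(1) e[OF AT.one_closed] x'(1)] x' by simp
    moreover have "\<phi> (gen s) (c, a) = gen_act T s True (c, a)"
      using \<phi>(2)[of "[(s, True)]" "(c, a)"] sV gs c a by (simp add: states_def)
    ultimately have eq: "gen_act T s True (c, a) = (c, a \<otimes>\<^bsub>A\<^sub>T\<^esub> x')" by simp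
    have "\<exists>r\<in>T. c (simple_root r) = simple_root s"
    proof (rule ccontr)
      assume "\<not> (\<exists>r\<in>T. c (simple_root r) = simple_root s)"
      then have "reflect s \<circ> c = c" using eq gen_act_free[of c s True a] by auto
      moreover obtain w' where w': "set w' \<subseteq> V" "c = cox w'" using c by (auto simp: chambers_def)
      have "c (cox (rev w') (simple_root s)) = simple_root s" using cox_rev'[OF w'(1)] w'(2) by simp
      ultimately have "reflect s (simple_root s) = simple_root s" by (metis comp_apply)
      then show False using fun_cong[OF reflect_root_self[OF sV], of s] by simp
    qed
    then obtain r where r: "r \<in> T" "c (simple_root r) = simple_root s" by blast
    have gr: "gen\<^sub>T r \<in> carrier A\<^sub>T" and gr': "gen r \<in> carrier G" using gen_T_closed gen_T_G r by auto
    have "gen\<^sub>T r \<otimes>\<^bsub>A\<^sub>T\<^esub> a = a \<otimes>\<^bsub>A\<^sub>T\<^esub> x'" using eq gen_act_stuck[OF c r, of True a] gr by simp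
    then have "\<iota> (gen\<^sub>T r) \<otimes>\<^bsub>G\<^esub> \<iota> a = \<iota> a \<otimes>\<^bsub>G\<^esub> x" using gr a x' by (metis \<iota>.hom_mult)
    moreover have "\<iota> (gen\<^sub>T r) = gen r" using \<iota>(3)[of "[(r, True)]"] r gr gr' by simp
    ultimately have "x = inv\<^bsub>G\<^esub> (\<iota> a) \<otimes>\<^bsub>G\<^esub> (gen r \<otimes>\<^bsub>G\<^esub> \<iota> a)"
      using G.inv_solve_left[of x "\<iota> a" "gen r \<otimes>\<^bsub>G\<^esub> \<iota> a"] xG gr' a \<iota>.hom_closed[OF a] by simp
    then show ?thesis using r gr' \<iota>.hom_closed[OF a] by (auto simp: x_def[symmetric] G.m_assoc)
  qed
  obtain \<rho> where \<rho>: "\<And>s. s \<in> S \<Longrightarrow> \<rho> s \<in> T \<and> c (simple_root (\<rho> s)) = simple_root s \<and>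
      g \<otimes>\<^bsub>G\<^esub> gen s \<otimes>\<^bsub>G\<^esub> inv\<^bsub>G\<^esub> g = inv\<^bsub>G\<^esub> (\<iota> a) \<otimes>\<^bsub>G\<^esub> gen (\<rho> s) \<otimes>\<^bsub>G\<^esub> \<iota> a"
    using stuck by metis
  have "\<iota> (inv\<^bsub>A\<^sub>T\<^esub> a) = inv\<^bsub>G\<^esub> (\<iota> a)" using a by simp
  then have "inv\<^bsub>G\<^esub> (\<iota> a) \<in> standard_parabolic \<Gamma> T" using \<iota>(4) a by (metis AT.inv_closed imageI)
  moreover have "inj_on \<rho> S" using \<rho> root_inj by (intro inj_onI) metis
  ultimately show ?thesis using that[of "inv\<^bsub>G\<^esub> (\<iota> a)" \<rho>] \<rho> \<iota>.hom_closed[OF a] by (simp add: image_subset_iff)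
qed

end

section \<open>Rank and inclusions of parabolic subgroups\<close>

context coxeter_graph
begin

abbreviation A :: "'a word set monoid" where "A \<equiv> artin_group \<Gamma>"
abbreviation par :: "'a set \<Rightarrow> 'a word set set" where "par \<equiv> standard_parabolic \<Gamma>"

sublocale AG: group A by (rule group_artin_group)

lemma par_subgroup: "S \<subseteq> V \<Longrightarrow> subgroup (par S) A"
  unfolding standard_parabolic_def
  using artin_gen_closed[of \<Gamma>] by (intro AG.generate_is_subgroup) blast

lemma par_closed: "S \<subseteq> V \<Longrightarrow> par S \<subseteq> carrier A"
  using par_subgroup subgroup.subset by blast

text \<open>The conjugated generators of S are, up to one common conjugation inside the subgroup of
  T, distinct generators of T. This bounds the rank; when all generators of T are reached, the
  conjugation by b is absorbed.\<close>

lemma conjugate_par_subset: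
  assumes ST: "S \<subseteq> V" "T \<subseteq> V" and g: "g \<in> carrier A" and sub: "conjugate A g (par S) \<subseteq> par T"
  shows "card S \<le> card T" "card T \<le> card S \<Longrightarrow> conjugate A g (par S) = par T"
proof -
  interpret parabolic_chambers \<Gamma> T by unfold_locales (rule ST(2))
  have gens: "artin_gen \<Gamma> ` S \<subseteq> carrier A" "artin_gen \<Gamma> ` T \<subseteq> carrier A"
    using artin_gen_closed[of \<Gamma>] ST by auto
  have "g \<otimes>\<^bsub>A\<^esub> artin_gen \<Gamma> s \<otimes>\<^bsub>A\<^esub> inv\<^bsub>A\<^esub> g \<in> par T" if "s \<in> S" for s
  proof -
    have "artin_gen \<Gamma> s \<in> par S" using that by (auto simp: standard_parabolic_def intro: generate.incl)
    then show ?thesis using sub by (auto simp: AG.conjugate_eq_image)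
  qed
  then obtain b \<rho> where b: "b \<in> par T" and \<rho>: "inj_on \<rho> S" "\<rho> ` S \<subseteq> T"
    and eq: "\<And>s. s \<in> S \<Longrightarrow> g \<otimes>\<^bsub>A\<^esub> artin_gen \<Gamma> s \<otimes>\<^bsub>A\<^esub> inv\<^bsub>A\<^esub> g =
      b \<otimes>\<^bsub>A\<^esub> artin_gen \<Gamma> (\<rho> s) \<otimes>\<^bsub>A\<^esub> inv\<^bsub>A\<^esub> b"
    using conjugate_gens_in_parabolic[OF ST(1) g] by metis
  have fin: "finite T" using ST(2) finite_V finite_subset by blast
  show "card S \<le> card T" using card_inj_on_le[OF \<rho> fin] .
  assume "card T \<le> card S"
  then have "\<rho> ` S = T" using \<rho> fin card_image[OF \<rho>(1)] by (metis card_seteq)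
  then have "conjugate A g (artin_gen \<Gamma> ` S) = conjugate A b (artin_gen \<Gamma> ` T)"
    using eq by (auto simp: AG.conjugate_eq_image image_image cong: image_cong)
  moreover have "b \<in> carrier A" using b par_closed ST by blast
  ultimately have "conjugate A g (par S) = conjugate A b (par T)"
    unfolding standard_parabolic_def using AG.conjugate_generate g gens by simp
  then show "conjugate A g (par S) = par T"
    using AG.conjugate_subgroup_elem[OF par_subgroup[OF ST(2)] b] by simp
qed

lemma conjugate_par_subset':
  assumes ST: "S \<subseteq> V" "T \<subseteq> V" and gh: "g \<in> carrier A" "h \<in> carrier A"
    and sub: "conjugate A g (par S) \<subseteq> conjugate A h (par T)" and card: "card T \<le> card S"
  shows "conjugate A g (par S) = conjugate A h (par T)"
proof -
  have "conjugate A (inv\<^bsub>A\<^esub> h) (conjugate A g (par S)) \<subseteq> conjugate A (inv\<^bsub>A\<^esub> h) (conjugate A h (par T))"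
    using sub by (rule AG.conjugate_mono)
  then have "conjugate A (inv\<^bsub>A\<^esub> h \<otimes>\<^bsub>A\<^esub> g) (par S) \<subseteq> par T"
    using gh par_closed ST by (simp add: AG.conjugate_conjugate AG.conjugate_one)
  then have "conjugate A (inv\<^bsub>A\<^esub> h \<otimes>\<^bsub>A\<^esub> g) (par S) = par T"
    using conjugate_par_subset(2)[OF ST] gh card by simp
  then have "conjugate A h (par T) = conjugate A h (conjugate A (inv\<^bsub>A\<^esub> h \<otimes>\<^bsub>A\<^esub> g) (par S))" by simp
  also have "\<dots> = conjugate A g (par S)"
    using gh par_closed ST by (simp add: AG.conjugate_conjugate AG.m_assoc[symmetric])
  finally show ?thesis by simp
qed

lemma parabolic_subgroup: "parabolic \<Gamma> P \<Longrightarrow> subgroup P A"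
  using AG.conjugate_subgroup par_subgroup by (auto simp: parabolic_def)

text \<open>Conjugation keeps the rank, so a parabolic subgroup is never conjugate to a proper
  subgroup of itself.\<close>

lemma parabolic_conjugate_subset_eq:
  assumes "parabolic \<Gamma> P" "h \<in> carrier A" "conjugate A h P \<subseteq> P"
  shows "conjugate A h P = P"
proof -
  obtain S k where S: "S \<subseteq> V" "k \<in> carrier A" "P = conjugate A k (par S)"
    using assms(1) by (auto simp: parabolic_def)
  then have "conjugate A h P = conjugate A (h \<otimes>\<^bsub>A\<^esub> k) (par S)"
    using assms(2) par_closed by (simp add: AG.conjugate_conjugate)
  then show ?thesis
    using conjugate_par_subset'[OF S(1) S(1), of "h \<otimes>\<^bsub>A\<^esub> k" k] assms S by simp
qed

text \<open>From a member of least rank on, every later member is contained in it and has no smaller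
  rank, hence equals it.\<close>

lemma parabolic_chain_stable:
  assumes P: "\<And>n :: nat. parabolic \<Gamma> (P n)" and dec: "\<And>m n. m \<le> n \<Longrightarrow> P n \<subseteq> P m"
  shows "\<exists>N. \<forall>n\<ge>N. P n = P N"
proof -
  \<comment> \<open>A relation rather than a function, as no representation of the parabolic
    subgroup is singled out.\<close>
  define rk where "rk n k \<longleftrightarrow> (\<exists>S\<subseteq>V. \<exists>g\<in>carrier A. P n = conjugate A g (par S) \<and> card S = k)" for n k
  have "\<exists>k. \<exists>n. rk n k" using P[of 0] by (auto simp: parabolic_def rk_def)
  then obtain k where k: "\<exists>n. rk n k" "\<And>k'. \<exists>n. rk n k' \<Longrightarrow> k \<le> k'"
    using ex_has_least_nat[of "\<lambda>k. \<exists>n. rk n k" _ id] by (metis id_apply)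
  then obtain N S g where N: "S \<subseteq> V" "g \<in> carrier A" "P N = conjugate A g (par S)" "card S = k"
    by (auto simp: rk_def)
  have "P n = P N" if "N \<le> n" for n
  proof -
    obtain T h where T: "T \<subseteq> V" "h \<in> carrier A" "P n = conjugate A h (par T)"
      using P[of n] by (auto simp: parabolic_def)
    then have "rk n (card T)" by (auto simp: rk_def)
    then have "k \<le> card T" using k(2) by blast
    then show ?thesis using conjugate_par_subset'[OF T(1) N(1) T(2) N(2)] dec[OF that] T(3) N(3,4) by simp
  qed
  then show ?thesis by blast
qed

end

section \<open>Elements normalising a parabolic subgroup\<close>

lemma finite_permutation_power:
  assumes fin: "finite X" and f: "f ` X = X"
  shows "\<exists>n\<ge>1. \<forall>x\<in>X. (f ^^ n) x = x"
proof -
  have inj: "inj_on f X" using fin f by (simp add: eq_card_imp_inj_on)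
  have im: "(f ^^ n) ` X = X" for n
  proof (induction n)
    case (Suc n)
    have "(f ^^ Suc n) ` X = f ` (f ^^ n) ` X" by (simp add: image_comp)
    then show ?case using Suc f by simp
  qed simp
  have inj_n: "inj_on (f ^^ n) X" for n using fin im by (simp add: eq_card_imp_inj_on)
  let ?F = "\<lambda>n. restrict (f ^^ n) X"
  have "(f ^^ n) x \<in> X" if "x \<in> X" for n x using im[of n] that by blast
  then have "range ?F \<subseteq> X \<rightarrow>\<^sub>E X" by auto
  then have "finite (range ?F)" using finite_PiE[of X "\<lambda>_. X"] fin finite_subset by blast
  then have "\<not> inj ?F" using finite_imageD infinite_UNIV_nat by blast
  then obtain i j where ij: "i < j" "?F i = ?F j" by (metis (no_types, lifting) injI linorder_neqE_nat)
  have "(f ^^ (j - i)) x = x" if x: "x \<in> X" for x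
  proof -
    obtain y where y: "y \<in> X" "x = (f ^^ i) y" using im[of i] x by blast
    have "(f ^^ (j - i)) x = (f ^^ (j - i + i)) y" by (simp only: y funpow_add comp_apply)
    also have "\<dots> = (f ^^ i) y" using fun_cong[OF ij(2), of y] ij(1) y(1) by simp
    finally show ?thesis using y by simp
  qed
  then show ?thesis using ij(1) by (intro exI[of _ "j - i"]) auto
qed

context group
begin

lemma alternative_pair_powers:
  assumes gh: "g \<in> carrier G" "h \<in> carrier G" and n: "(n::nat) \<ge> 1"
    and alt: "alternative_pair G (g [^] n) (h [^] n)"
  shows "alternative_pair G g h"
proof -
  obtain m :: nat where "m \<ge> 1"
    "g [^] (n * m) \<otimes> h [^] (n * m) = h [^] (n * m) \<otimes> g [^] (n * m) \<or>
      subgroup_generated G {g [^] (n * m), h [^] (n * m)} \<cong> F\<^sub>2"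
    using alt gh by (auto simp: alternative_pair_def nat_pow_pow)
  then show ?thesis using n unfolding alternative_pair_def by (intro exI[of _ "n * m"]) auto
qed

lemma normalising_pow:
  assumes P: "subgroup P G" and q: "q \<in> carrier G"
    and norm: "\<And>y. y \<in> P \<Longrightarrow> q \<otimes> y \<otimes> inv q \<in> P" and y: "y \<in> P"
  shows "q [^] (n::nat) \<otimes> y \<otimes> inv (q [^] n) \<in> P"
proof (induction n)
  case (Suc n)
  have "q [^] Suc n \<otimes> y \<otimes> inv (q [^] Suc n) = q \<otimes> (q [^] n \<otimes> y \<otimes> inv (q [^] n)) \<otimes> inv q"
    unfolding nat_pow_Suc2[OF q] using q subgroup.mem_carrier[OF P y]
    by (simp add: inv_mult_group m_assoc del: nat_pow_Suc)
  then show ?case using norm[OF Suc] by simp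
qed (use y subgroup.mem_carrier[OF P y] in simp)

text \<open>As q normalises P, all factors from P can be collected to the left of the powers of
  q.\<close>

lemma normal_form_pow:
  assumes P: "subgroup P G" and u: "u \<in> P" and q: "q \<in> carrier G"
    and norm: "\<And>y. y \<in> P \<Longrightarrow> q \<otimes> y \<otimes> inv q \<in> P"
  shows "\<exists>v\<in>P. (u \<otimes> q) [^] (n::nat) = v \<otimes> q [^] n"
proof (induction n)
  case 0
  then show ?case using subgroup.one_closed[OF P] by (intro bexI[of _ \<one>]) auto
next
  case (Suc n)
  then obtain v where v: "v \<in> P" "(u \<otimes> q) [^] n = v \<otimes> q [^] n" by blast
  have PG: "x \<in> carrier G" if "x \<in> P" for x using subgroup.mem_carrier[OF P that] .
  have w: "q [^] n \<otimes> u \<otimes> inv (q [^] n) \<in> P" using normalising_pow[OF P q norm u] .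
  have "(u \<otimes> q) [^] Suc n = v \<otimes> (q [^] n \<otimes> u \<otimes> inv (q [^] n)) \<otimes> q [^] Suc n"
    using v q PG[OF v(1)] PG[OF u] by (simp add: m_assoc inv_solve_left)
  then show ?case using subgroup.m_closed[OF P v(1) w] by blast
qed

text \<open>
  Powers of \<open>h\<close> and \<open>g\<close> with a common exponent are elements of \<open>P\<close> twisted by powers of the
  element \<open>q\<^sup>k\<close> centralising \<open>P\<close>.
\<close>

lemma alternative_pair_over_normal:
  assumes P: "subgroup P G" and pairs: "\<And>x y. x \<in> P \<Longrightarrow> y \<in> P \<Longrightarrow> alternative_pair G x y"
    and q: "q \<in> carrier G" and norm: "\<And>y. y \<in> P \<Longrightarrow> q \<otimes> y \<otimes> inv q \<in> P"
    and k: "k \<ge> 1" "\<And>y. y \<in> P \<Longrightarrow> q [^] k \<otimes> y = y \<otimes> q [^] (k::nat)"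
    and u: "u \<in> P" and h: "h = u \<otimes> q"
    and g: "g \<in> carrier G" and a: "a \<ge> 1" and p: "p \<in> P" and gp: "g [^] (a::nat) = h [^] (b::nat) \<otimes> p"
  shows "alternative_pair G g h"
proof -
  have PG: "x \<in> carrier G" if "x \<in> P" for x using subgroup.mem_carrier[OF P that] .
  have hG: "h \<in> carrier G" using h PG[OF u] q by simp
  have norm_n: "q [^] n \<otimes> y \<otimes> inv (q [^] n) \<in> P" if "y \<in> P" for y and n :: nat
    using normalising_pow[OF P q norm that] .
  obtain v where v: "v \<in> P" "h [^] b = v \<otimes> q [^] b"
    using normal_form_pow[OF P u q norm, of b] h by blast
  define w where "w = v \<otimes> (q [^] b \<otimes> p \<otimes> inv (q [^] b))"
  have w: "w \<in> P" using subgroup.m_closed[OF P v(1) norm_n[OF p]] by (simp add: w_def)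
  have "g [^] a = w \<otimes> q [^] b"
    using v q PG[OF v(1)] PG[OF p] by (simp add: gp w_def m_assoc)
  then obtain w' where w': "w' \<in> P" "(g [^] a) [^] k = w' \<otimes> (q [^] b) [^] k"
    using normal_form_pow[OF P w _ norm_n, of b k] q by auto
  obtain v' where v': "v' \<in> P" "h [^] (a * k) = v' \<otimes> q [^] (a * k)"
    using normal_form_pow[OF P u q norm, of "a * k"] h by blast
  define z where "z = q [^] k"
  have z: "z \<in> carrier G" using q by (simp add: z_def)
  have "g [^] (a * k) = w' \<otimes> z [^] int b" "h [^] (a * k) = v' \<otimes> z [^] int a"
    using w' v' q g by (simp_all add: z_def nat_pow_pow int_pow_int mult.commute)
  moreover have "alternative_pair G (w' \<otimes> z [^] int b) (v' \<otimes> z [^] int a)"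
    using k w'(1) v'(1) PG pairs z by (intro alternative_pair_central_twist) (auto simp: z_def)
  ultimately have "alternative_pair G (g [^] (a * k)) (h [^] (a * k))" by simp
  then show ?thesis using alternative_pair_powers[OF g hG, of "a * k"] a k(1) by simp
qed

end

text \<open>After conjugation to a standard parabolic subgroup, h splits off an element q0 of
  \<open>QZ\<close>, which permutes the finitely many standard generators by conjugation. A power of
  this permutation is the identity, so that power of q0 commutes with the whole subgroup.\<close>

lemma (in coxeter_graph) normaliser_decomposition:
  assumes nsp: "normaliser_structure_property \<Gamma>" and P: "parabolic \<Gamma> P"
    and h: "h \<in> carrier A" "conjugate A h P = P"
  obtains u q k where "u \<in> P" "q \<in> carrier A" "h = u \<otimes>\<^bsub>A\<^esub> q"
    "\<And>y. y \<in> P \<Longrightarrow> q \<otimes>\<^bsub>A\<^esub> y \<otimes>\<^bsub>A\<^esub> inv\<^bsub>A\<^esub> q \<in> P"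
    "(k::nat) \<ge> 1" "\<And>y. y \<in> P \<Longrightarrow> q [^]\<^bsub>A\<^esub> k \<otimes>\<^bsub>A\<^esub> y = y \<otimes>\<^bsub>A\<^esub> q [^]\<^bsub>A\<^esub> k"
proof -
  obtain S c where S: "S \<subseteq> V" "c \<in> carrier A" "P = conjugate A c (par S)"
    using P by (auto simp: parabolic_def)
  let ?X = "artin_gen \<Gamma> ` S"
  have X: "?X \<subseteq> carrier A" "finite ?X"
    using artin_gen_closed[of \<Gamma>] S finite_subset[OF S(1) finite_V] by auto
  note parS = par_closed[OF S(1)]
  define h0 where "h0 = inv\<^bsub>A\<^esub> c \<otimes>\<^bsub>A\<^esub> h \<otimes>\<^bsub>A\<^esub> c"
  have "conjugate A h0 (par S) = conjugate A (inv\<^bsub>A\<^esub> c) (conjugate A h (conjugate A c (par S)))"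
    using S(2) h(1) parS by (simp add: h0_def AG.conjugate_conjugate AG.m_assoc AG.conjugate_closed)
  also have "\<dots> = par S" using h(2) by (simp only: S(3) AG.conjugate_inv[OF S(2) parS])
  finally have "h0 \<in> normalizer A (par S)" using S h by (simp add: AG.normalizer_eq[OF parS] h0_def)
  then obtain u0 q0 where uq: "u0 \<in> par S" "q0 \<in> QZ \<Gamma> S" "h0 = u0 \<otimes>\<^bsub>A\<^esub> q0"
    using nsp S(1) by (auto simp: normaliser_structure_property_def set_mult_def)
  have u0: "u0 \<in> carrier A" and q0: "q0 \<in> carrier A" "conjugate A q0 ?X = ?X"
    using uq parS by (auto simp: QZ_def)
  have q0_par: "conjugate A q0 (par S) = par S"
    using AG.conjugate_generate[OF q0(1) X(1)] q0(2) by (simp add: standard_parabolic_def)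
  let ?conj = "\<lambda>x. q0 \<otimes>\<^bsub>A\<^esub> x \<otimes>\<^bsub>A\<^esub> inv\<^bsub>A\<^esub> q0"
  have "?conj ` ?X = ?X" using q0(2) by (simp add: AG.conjugate_eq_image)
  from finite_permutation_power[OF X(2) this]
  obtain k where "k \<ge> 1 \<and> (\<forall>x\<in>?X. (?conj ^^ k) x = x)" ..
  then have k: "k \<ge> 1" "x \<in> ?X \<Longrightarrow> (?conj ^^ k) x = x" for x by auto
  have conj_pow: "(?conj ^^ n) x = q0 [^]\<^bsub>A\<^esub> n \<otimes>\<^bsub>A\<^esub> x \<otimes>\<^bsub>A\<^esub> inv\<^bsub>A\<^esub> (q0 [^]\<^bsub>A\<^esub> n)"
    if "x \<in> carrier A" for n x
  proof (induction n)
    case (Suc n)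
    then show ?case unfolding AG.nat_pow_Suc2[OF q0(1)]
      using that q0(1) by (simp add: AG.inv_mult_group AG.m_assoc del: AG.nat_pow_Suc)
  qed (use that in simp)
  have central0: "q0 [^]\<^bsub>A\<^esub> k \<otimes>\<^bsub>A\<^esub> y = y \<otimes>\<^bsub>A\<^esub> q0 [^]\<^bsub>A\<^esub> k" if "y \<in> par S" for y
    using that unfolding standard_parabolic_def
  proof induction
    case one
    then show ?case using q0 by simp
  next
    case (incl x)
    then have xG: "x \<in> carrier A" using X by blast
    have "q0 [^]\<^bsub>A\<^esub> k \<otimes>\<^bsub>A\<^esub> x \<otimes>\<^bsub>A\<^esub> inv\<^bsub>A\<^esub> (q0 [^]\<^bsub>A\<^esub> k) = x"
      using k(2)[OF incl] conj_pow[OF xG] by simp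
    then show ?case
      using AG.inv_solve_right[of x "q0 [^]\<^bsub>A\<^esub> k \<otimes>\<^bsub>A\<^esub> x" "q0 [^]\<^bsub>A\<^esub> k"] xG q0 by simp
  next
    case (inv x)
    then have xG: "x \<in> carrier A" using X by blast
    have "q0 [^]\<^bsub>A\<^esub> k \<otimes>\<^bsub>A\<^esub> x \<otimes>\<^bsub>A\<^esub> inv\<^bsub>A\<^esub> (q0 [^]\<^bsub>A\<^esub> k) = x"
      using k(2)[OF inv] conj_pow[OF xG] by simp
    then have "q0 [^]\<^bsub>A\<^esub> k \<otimes>\<^bsub>A\<^esub> x = x \<otimes>\<^bsub>A\<^esub> q0 [^]\<^bsub>A\<^esub> k"
      using AG.inv_solve_right[of x "q0 [^]\<^bsub>A\<^esub> k \<otimes>\<^bsub>A\<^esub> x" "q0 [^]\<^bsub>A\<^esub> k"] xG q0 by simp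
    then show ?case using xG q0 by (intro AG.commute_inv) auto
  next
    case (eng x y)
    then have "x \<in> carrier A" "y \<in> carrier A" using AG.generate_in_carrier[OF X(1)] by auto
    then show ?case using eng q0 by (intro AG.commute_mult) auto
  qed
  let ?c = "\<lambda>x. c \<otimes>\<^bsub>A\<^esub> x \<otimes>\<^bsub>A\<^esub> inv\<^bsub>A\<^esub> c"
  interpret c: group_hom A A ?c by unfold_locales (rule AG.conjugation_hom[OF S(2)])
  have P_eq: "P = ?c ` par S" using S(3) by (simp add: AG.conjugate_eq_image)
  show ?thesis
  proof (rule that[of "?c u0" "?c q0" k])
    show "?c u0 \<in> P" using uq by (simp add: P_eq)
    show "?c q0 \<in> carrier A" using q0 S by simp
    have "h = ?c h0" using h S by (simp add: h0_def AG.m_assoc[symmetric]) (simp add: AG.m_assoc)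
    also have "\<dots> = ?c u0 \<otimes>\<^bsub>A\<^esub> ?c q0" using uq(3) u0 q0 c.hom_mult by simp
    finally show "h = ?c u0 \<otimes>\<^bsub>A\<^esub> ?c q0" .
    fix y assume "y \<in> P"
    then obtain y0 where y0: "y0 \<in> par S" "y = ?c y0" by (auto simp: P_eq)
    have y0G: "y0 \<in> carrier A" using y0 parS by blast
    have "?c q0 \<otimes>\<^bsub>A\<^esub> y \<otimes>\<^bsub>A\<^esub> inv\<^bsub>A\<^esub> (?c q0) = ?c (?conj y0)"
      using y0 y0G q0 c.hom_mult c.hom_inv by simp
    moreover have "?conj y0 \<in> par S" using q0_par y0 by (auto simp: AG.conjugate_eq_image)
    ultimately show "?c q0 \<otimes>\<^bsub>A\<^esub> y \<otimes>\<^bsub>A\<^esub> inv\<^bsub>A\<^esub> (?c q0) \<in> P" by (simp add: P_eq)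
    have "?c (q0 [^]\<^bsub>A\<^esub> k \<otimes>\<^bsub>A\<^esub> y0) = ?c (y0 \<otimes>\<^bsub>A\<^esub> q0 [^]\<^bsub>A\<^esub> k)" using central0[OF y0(1)] by simp
    then have "?c (q0 [^]\<^bsub>A\<^esub> k) \<otimes>\<^bsub>A\<^esub> y = y \<otimes>\<^bsub>A\<^esub> ?c (q0 [^]\<^bsub>A\<^esub> k)"
      using y0 y0G q0 c.hom_mult[of "q0 [^]\<^bsub>A\<^esub> k" y0] c.hom_mult[of y0 "q0 [^]\<^bsub>A\<^esub> k"] by simp
    then show "?c q0 [^]\<^bsub>A\<^esub> k \<otimes>\<^bsub>A\<^esub> y = y \<otimes>\<^bsub>A\<^esub> ?c q0 [^]\<^bsub>A\<^esub> k"
      using c.hom_nat_pow[OF q0(1), of k] by simp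
  qed (rule k(1))
qed


section \<open>The Bass--Serre tree\<close>

lemma (in group) group_actionI:
  assumes closed: "\<And>g e. g \<in> carrier G \<Longrightarrow> e \<in> E \<Longrightarrow> act g e \<in> E"
    and one: "\<And>e. e \<in> E \<Longrightarrow> act \<one> e = e"
    and mult: "\<And>g h e. g \<in> carrier G \<Longrightarrow> h \<in> carrier G \<Longrightarrow> e \<in> E \<Longrightarrow> act (g \<otimes> h) e = act g (act h e)"
  shows "group_action G E (\<lambda>g. restrict (act g) E)"
proof -
  have bij: "bij_betw (act g) E E" if g: "g \<in> carrier G" for g
  proof (rule bij_betwI[of _ _ _ "act (inv g)"])
    show "act (inv g) (act g e) = e" "act g (act (inv g) e) = e" if "e \<in> E" for e
      using mult[of "inv g" g e] mult[of g "inv g" e] one g that by simp_all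
  qed (use closed g in auto)
  then have Bij: "restrict (act g) E \<in> Bij E" if "g \<in> carrier G" for g
    using that by (simp add: Bij_def bij_betw_restrict_eq)
  have "(\<lambda>g. restrict (act g) E) \<in> hom G (BijGroup E)"
  proof (rule homI)
    fix g h assume "g \<in> carrier G" "h \<in> carrier G"
    then show "restrict (act (g \<otimes> h)) E = restrict (act g) E \<otimes>\<^bsub>BijGroup E\<^esub> restrict (act h) E"
      using closed mult by (simp add: BijGroup_def Bij) (auto simp: compose_def restrict_def fun_eq_iff)
  qed (simp add: BijGroup_def Bij)
  then show ?thesis
    by (simp add: group_action_def group_hom_def group_hom_axioms_def is_group group_BijGroup)
qed

section \<open>The tree of reduced walks\<close>

fun lcp :: "'a list \<Rightarrow> 'a list \<Rightarrow> nat" where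
  "lcp (x # xs) (y # ys) = (if x = y then Suc (lcp xs ys) else 0)"
| "lcp _ _ = 0"

lemma lcp_Nil [simp]: "lcp xs [] = 0" "lcp [] xs = 0"
  by (cases xs) auto

lemma lcp_sym: "lcp xs ys = lcp ys xs"
  by (induction xs ys rule: lcp.induct) auto

lemma lcp_le: "lcp xs ys \<le> length xs" "lcp xs ys \<le> length ys"
  by (induction xs ys rule: lcp.induct) auto

lemma lcp_eq_lengths: "lcp xs ys = length xs \<Longrightarrow> lcp xs ys = length ys \<Longrightarrow> xs = ys"
  by (induction xs ys rule: lcp.induct) (auto split: if_splits)

lemma lcp_ultrametric: "min (lcp xs ys) (lcp ys zs) \<le> lcp xs zs"
proof (induction xs ys arbitrary: zs rule: lcp.induct)
  case (1 x xs y ys)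
  then show ?case by (cases zs) auto
qed auto

lemma lcp_take: "lcp (take n xs) ys = min n (lcp xs ys)"
proof (induction xs ys arbitrary: n rule: lcp.induct)
  case (1 x xs y ys)
  then show ?case by (cases n) auto
qed auto

lemma lcp_self: "lcp xs xs = length xs"
  by (induction xs) auto

lemma lcp_map: "inj_on f (set xs \<union> set ys) \<Longrightarrow> lcp (map f xs) (map f ys) = lcp xs ys"
proof (induction xs ys rule: lcp.induct)
  case (1 x xs y ys)
  then have "inj_on f (set xs \<union> set ys)" by (auto intro: inj_on_subset)
  with 1 show ?case by (auto simp: inj_on_def)
qed auto

text \<open>The path metric of the tree in which a list is joined to its extensions by one entry.
  The ultrametric inequality for common prefixes becomes the four-point condition.\<close>

definition lcp_dist :: "'a list \<Rightarrow> 'a list \<Rightarrow> int" where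
  "lcp_dist xs ys = int (length xs) + int (length ys) - 2 * int (lcp xs ys)"

text \<open>Only a return after two steps is excluded; consecutive entries may coincide, so the
  complete graph is understood with loops.\<close>

fun reduced_walk :: "'a list \<Rightarrow> bool" where
  "reduced_walk (x # y # z # r) \<longleftrightarrow> x \<noteq> z \<and> reduced_walk (y # z # r)"
| "reduced_walk _ \<longleftrightarrow> True"

lemma reduced_walk_Cons: "reduced_walk (x # w) \<longleftrightarrow> reduced_walk w \<and> (tl w \<noteq> [] \<longrightarrow> hd (tl w) \<noteq> x)"
  by (cases w; cases "tl w") auto

lemma reduced_walk_take: "reduced_walk w \<Longrightarrow> reduced_walk (take n w)"
proof (induction w arbitrary: n)
  case (Cons x w)
  then show ?case
    by (cases n; cases "n - 1") (auto simp: reduced_walk_Cons tl_take take_Suc)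
qed simp

lemma reduced_walk_map: "inj_on f (set w) \<Longrightarrow> reduced_walk (map f w) \<longleftrightarrow> reduced_walk w"
proof (induction w rule: reduced_walk.induct)
  case (1 x y z r)
  then have "inj_on f (set (y # z # r))" by (auto intro: inj_on_subset)
  with 1 show ?case by (auto simp: inj_on_def)
qed auto

definition walks :: "'a set \<Rightarrow> 'a \<Rightarrow> 'a list set" where
  "walks Y u = {w. w \<noteq> [] \<and> hd w = u \<and> set w \<subseteq> Y \<and> reduced_walk w}"

lemma tree_metric_walks: "tree_metric (walks Y a) lcp_dist"
proof
  fix x y z w :: "'a list"
  show "0 \<le> lcp_dist x y" using lcp_le[of x y] by (simp add: lcp_dist_def)
  show "lcp_dist x y = 0 \<longleftrightarrow> x = y"
  proof
    assume "lcp_dist x y = 0"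
    then have "lcp x y = length x" "lcp x y = length y"
      using lcp_le[of x y] by (auto simp: lcp_dist_def)
    then show "x = y" by (rule lcp_eq_lengths)
  qed (simp add: lcp_dist_def lcp_self)
  show "lcp_dist x y = lcp_dist y x" by (simp add: lcp_dist_def lcp_sym)
  show "lcp_dist x y + lcp_dist z w \<le> max (lcp_dist x z + lcp_dist y w) (lcp_dist x w + lcp_dist y z)"
    using lcp_ultrametric[of x z y] lcp_ultrametric[of x w y] lcp_ultrametric[of z x w]
      lcp_ultrametric[of z y w]
    unfolding lcp_dist_def lcp_sym[of z y] lcp_sym[of w y] lcp_sym[of z x] by linarith
  show "even (lcp_dist x y + lcp_dist y z + lcp_dist x z)"
    by (simp add: lcp_dist_def)
  fix k assume x: "x \<in> walks Y a" and y: "y \<in> walks Y a" and k: "0 \<le> k" "k \<le> lcp_dist x y"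
  define l where "l = lcp x y"
  \<comment> \<open>All walks start at a, so the path between two of them never reaches the empty
    list.\<close>
  have l: "1 \<le> l" using x y by (cases x; cases y) (auto simp: walks_def l_def)
  have ll: "l \<le> length x" "l \<le> length y" using lcp_le[of x y] by (auto simp: l_def)
  have take: "take n v \<in> walks Y a" if "v \<in> walks Y a" "1 \<le> n" for n v
    using that reduced_walk_take[of v n] set_take_subset[of n v] by (cases v; cases n) (auto simp: walks_def)
  show "\<exists>z\<in>walks Y a. lcp_dist x z = k \<and> lcp_dist z y = lcp_dist x y - k"
  \<comment> \<open>The geodesic first shortens x to the common prefix and then lengthens it to
    y.\<close>
  proof (cases "k \<le> int (length x) - int l")
    case True
    define n where "n = length x - nat k"
    have n: "int n = int (length x) - k" "l \<le> n" using True k ll by (auto simp: n_def)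
    have "lcp x (take n x) = n" using lcp_take[of n x x] n k by (simp add: lcp_sym lcp_self)
    moreover have "lcp (take n x) y = l" using lcp_take[of n x y] n(2) by (simp add: l_def)
    moreover have "length (take n x) = n" using n k by simp
    ultimately show ?thesis
      using take[OF x, of n] n l
      by (intro bexI[of _ "take n x"]) (auto simp: lcp_dist_def l_def[symmetric])
  next
    case False
    define n where "n = l + nat (k - (int (length x) - int l))"
    have kd: "k \<le> int (length x) + int (length y) - 2 * int l" using k by (simp add: lcp_dist_def l_def)
    have n: "int n = k - int (length x) + 2 * int l" "l \<le> n" "n \<le> length y"
      using False k kd by (auto simp: n_def)
    have "lcp x (take n y) = l" using lcp_take[of n y x] n(2) by (simp add: lcp_sym l_def)
    moreover have "lcp (take n y) y = n" using lcp_take[of n y y] n(3) by (simp add: lcp_self)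
    moreover have "length (take n y) = n" using n by simp
    ultimately show ?thesis
      using take[OF y, of n] n l
      by (intro bexI[of _ "take n y"]) (auto simp: lcp_dist_def l_def[symmetric])
  qed
qed

text \<open>Change of root along one edge: the same vertex of the tree is described by a walk from
  u, cancelling the backtracking if the walk already began by going to u.\<close>

definition rebase :: "'a \<Rightarrow> 'a list \<Rightarrow> 'a list" where
  "rebase u w = (if tl w \<noteq> [] \<and> hd (tl w) = u then tl w else u # w)"

lemma rebase_walks:
  assumes "w \<in> walks Y x" "u \<in> Y"
  shows "rebase u w \<in> walks Y u"
proof -
  obtain r where w: "w = x # r" using assms(1) by (cases w) (auto simp: walks_def)
  then show ?thesis
    using assms by (cases r) (auto simp: rebase_def walks_def reduced_walk_Cons)
qed

lemma rebase_rebase: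
  assumes "w \<in> walks Y x"
  shows "rebase x (rebase u w) = w"
proof -
  obtain r where w: "w = x # r" using assms by (cases w) (auto simp: walks_def)
  have r: "reduced_walk (x # r)" using assms by (simp add: w walks_def)
  show ?thesis
  proof (cases r)
    case (Cons y r')
    then show ?thesis using r by (auto simp: rebase_def w reduced_walk_Cons split: if_splits)
  qed (simp add: rebase_def w)
qed

lemma last_rebase: "w \<noteq> [] \<Longrightarrow> last (rebase u w) = last w"
  by (cases w) (auto simp: rebase_def)

lemma map_rebase: "inj_on f (insert u (set w)) \<Longrightarrow> map f (rebase u w) = rebase (f u) (map f w)"
  by (cases w; cases "tl w") (auto simp: rebase_def inj_on_def)

lemma lcp_dist_rebase:
  assumes "w \<in> walks Y x" "w' \<in> walks Y x"
  shows "lcp_dist (rebase u w) (rebase u w') = lcp_dist w w'"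
proof -
  obtain r r' where w: "w = x # r" "w' = x # r'"
    using assms by (cases w; cases w') (auto simp: walks_def)
  have "reduced_walk (x # r)" "reduced_walk (x # r')" using assms by (simp_all add: w walks_def)
  then show ?thesis
    by (cases r; cases r'; cases "tl r"; cases "tl r'")
      (auto simp: rebase_def w lcp_dist_def reduced_walk_Cons)
qed

text \<open>
  The tree consists of the reduced walks from \<open>a\<close> in the complete graph on \<open>Y\<close>: the generators in
  \<open>X\<^sub>1\<close> act on walks from \<open>a\<close>, those in \<open>X\<^sub>2\<close> on walks from \<open>b\<close>, and these two sets of walks are
  identified along the edge between \<open>a\<close> and \<open>b\<close>.  The stabiliser of a walk is only known to lie in
  that of its end point, which suffices and avoids normal forms for amalgams.
\<close>

lemma presented_amalgam_tree_action:
  assumes Y: "group_action (presented_group (X\<^sub>1 \<union> X\<^sub>2) R) Y \<psi>"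
    and ab: "a \<in> Y" "b \<in> Y"
    and fix_a: "\<And>x. x \<in> X\<^sub>1 \<Longrightarrow> \<psi> (pres_class (X\<^sub>1 \<union> X\<^sub>2) R [(x, True)]) a = a"
    and fix_b: "\<And>x. x \<in> X\<^sub>2 \<Longrightarrow> \<psi> (pres_class (X\<^sub>1 \<union> X\<^sub>2) R [(x, True)]) b = b"
    and R: "\<And>u v. (u, v) \<in> R \<Longrightarrow> (u \<in> words X\<^sub>1 \<and> v \<in> words X\<^sub>1) \<or> (u \<in> words X\<^sub>2 \<and> v \<in> words X\<^sub>2)"
  obtains \<phi> where "tree_action (presented_group (X\<^sub>1 \<union> X\<^sub>2) R) (walks Y a) \<phi> lcp_dist"
    "\<And>g w. g \<in> carrier (presented_group (X\<^sub>1 \<union> X\<^sub>2) R) \<Longrightarrow> w \<in> walks Y a \<Longrightarrow>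
      last (\<phi> g w) = \<psi> g (last w)"
proof -
  let ?X = "X\<^sub>1 \<union> X\<^sub>2"
  let ?G = "presented_group ?X R"
  let ?cl = "pres_class ?X R"
  interpret Y: group_action ?G Y \<psi> by fact
  interpret G: group ?G by (rule group_presented_group)
  have words_mono: "u \<in> words ?X" if "u \<in> words X\<^sub>1 \<or> u \<in> words X\<^sub>2" for u
    using that by (auto simp: words_def)
  have cl: "?cl u \<in> carrier ?G" if "u \<in> words ?X" for u
    using that by (simp add: carrier_presented_group)
  have \<psi>_Y: "\<psi> g y \<in> Y" if "g \<in> carrier ?G" "y \<in> Y" for g y
    using Y.element_image that by blast
  have \<psi>_inj: "inj_on (\<psi> g) Y" if "g \<in> carrier ?G" for g
    using Y.inj_prop that by blast
  have \<psi>_append: "\<psi> (?cl (u @ v)) y = \<psi> (?cl u) (\<psi> (?cl v) y)"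
    if "u \<in> words ?X" "v \<in> words ?X" "y \<in> Y" for u v y
    using Y.composition_rule[OF that(3) cl cl, of u v] that by (simp add: presented_group_mult)
  have \<psi>_Nil: "\<psi> (?cl []) y = y" if "y \<in> Y" for y
    using fun_cong[OF Y.id_eq_one, of y] that by (simp add: one_presented_group)
  have fix_letter: "\<psi> (?cl [(x, c)]) y = y"
    if "x \<in> ?X" "y \<in> Y" "\<psi> (?cl [(x, True)]) y = y" for x c y
  proof (cases c)
    case False
    have "?cl ([(x, False)] @ [(x, True)]) = ?cl []"
      using pres_cong.cancel[of x ?X False R] that by (simp add: pres_class_eq_iff)
    then show ?thesis
      using \<psi>_append[of "[(x, False)]" "[(x, True)]" y] \<psi>_Nil[of y] that False by simp
  qed (use that in simp)
  have fix_word: "\<psi> (?cl u) y = y"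
    if "u \<in> words Z" "Z \<subseteq> ?X" "y \<in> Y" "\<And>x. x \<in> Z \<Longrightarrow> \<psi> (?cl [(x, True)]) y = y" for u y Z
    using that(1)
  proof (induction u)
    case (Cons l u)
    have "u \<in> words ?X" using Cons that(2) by (auto simp: words_def)
    then show ?case
      using Cons \<psi>_append[of "[l]" u y] fix_letter[of "fst l" y "snd l"] that by auto
  qed (use \<psi>_Nil that in simp)
  have walks_map: "map (\<psi> g) w \<in> walks Y u" if "g \<in> carrier ?G" "w \<in> walks Y u" "\<psi> g u = u" for g w u
    using that \<psi>_Y[OF that(1)] reduced_walk_map[OF inj_on_subset[OF \<psi>_inj[OF that(1)]], of w]
    by (auto simp: walks_def hd_map)
  have map_map: "map (\<psi> (?cl (u @ v))) w = map (\<psi> (?cl u)) (map (\<psi> (?cl v)) w)"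
    if "u \<in> words ?X" "v \<in> words ?X" "w \<in> walks Y z" for u v w z
    using that \<psi>_append by (auto simp: walks_def)
  define on_b where "on_b g w = rebase a (map (\<psi> g) (rebase b w))" for g w
  define act where "act x c = (if x \<in> X\<^sub>1 then map (\<psi> (?cl [(x, c)])) else on_b (?cl [(x, c)]))" for x c
  \<comment> \<open>A letter in both alphabets fixes a and b, so changing the root commutes with its
    action and the two prescriptions agree.\<close>
  have act_b: "act x c w = on_b (?cl [(x, c)]) w" if x: "x \<in> X\<^sub>2" and w: "w \<in> walks Y a" for x c w
  proof (cases "x \<in> X\<^sub>1")
    case True
    let ?g = "?cl [(x, c)]"
    have g: "?g \<in> carrier ?G" using x by (intro cl) simp
    have fixed: "\<psi> ?g a = a" "\<psi> ?g b = b" using fix_letter fix_a fix_b ab True x by auto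
    have "map (\<psi> ?g) (rebase b w) = rebase b (map (\<psi> ?g) w)"
      using map_rebase[OF inj_on_subset[OF \<psi>_inj[OF g]], of b w] w ab fixed
      by (auto simp: walks_def)
    then show ?thesis
      using rebase_rebase[OF walks_map[OF g w fixed(1)]] True by (simp add: on_b_def act_def)
  qed (simp add: act_def)
  have on_b_walks: "on_b g w \<in> walks Y a" if "g \<in> carrier ?G" "\<psi> g b = b" "w \<in> walks Y a" for g w
    unfolding on_b_def by (rule rebase_walks[OF walks_map[OF that(1) rebase_walks[OF that(3) ab(2)] that(2)] ab(1)])
  have act_walks: "act x c w \<in> walks Y a" if x: "x \<in> ?X" and w: "w \<in> walks Y a" for x c w
  proof (cases "x \<in> X\<^sub>1")
    case True
    then show ?thesis using walks_map[OF cl w, of "[(x, c)]"] fix_letter fix_a ab by (simp add: act_def)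
  next
    case False
    then show ?thesis using on_b_walks[OF cl _ w, of "[(x, c)]"] fix_letter fix_b ab x by (auto simp: act_def)
  qed
  have run1: "run act u w = map (\<psi> (?cl u)) w" if "u \<in> words X\<^sub>1" "w \<in> walks Y a" for u w
    using that(1)
  proof (induction u)
    case Nil
    then show ?case using \<psi>_Nil that(2) by (auto simp: walks_def intro!: map_idI[symmetric])
  next
    case (Cons l u)
    then show ?case
      using map_map[of "[l]" u w a] that(2) words_mono[of u] by (simp add: act_def)
  qed
  have run2: "run act u w = on_b (?cl u) w" if "u \<in> words X\<^sub>2" "w \<in> walks Y a" for u w
    using that(1)
  proof (induction u)
    case Nil
    have "map (\<psi> (?cl [])) (rebase b w) = rebase b w"
      using \<psi>_Nil rebase_walks[OF that(2) ab(2)] by (auto simp: walks_def intro!: map_idI)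
    then show ?case using rebase_rebase[OF that(2)] by (simp add: on_b_def)
  next
    case (Cons l u)
    have u: "u \<in> words X\<^sub>2" "u \<in> words ?X" and l: "fst l \<in> X\<^sub>2" using Cons words_mono by auto
    then have l': "[l] \<in> words ?X" by simp
    have b: "rebase b w \<in> walks Y b" using rebase_walks[OF that(2) ab(2)] .
    have "\<psi> (?cl u) b = b" using fix_word[OF u(1) _ ab(2)] fix_b by auto
    then have w': "map (\<psi> (?cl u)) (rebase b w) \<in> walks Y b" "on_b (?cl u) w \<in> walks Y a"
      using walks_map[OF cl[OF u(2)] b] on_b_walks[OF cl[OF u(2)] _ that(2)] by auto
    have "run act (l # u) w = on_b (?cl [l]) (on_b (?cl u) w)"
      using Cons u act_b[OF l w'(2), of "snd l"] by simp
    also have "\<dots> = rebase a (map (\<psi> (?cl [l])) (map (\<psi> (?cl u)) (rebase b w)))"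
      using rebase_rebase[OF w'(1), of a] by (simp add: on_b_def)
    also have "\<dots> = on_b (?cl (l # u)) w"
      unfolding on_b_def map_map[OF l' u(2) b, symmetric] by simp
    finally show ?case .
  qed
  have inverse: "act x c (act x (\<not> c) w) = w" if x: "x \<in> ?X" and w: "w \<in> walks Y a" for x c w
  proof -
    let ?u = "[(x, c), (x, \<not> c)]"
    have "?cl ?u = ?cl []" using x by (simp add: pres_class_eq_iff pres_cong.cancel)
    moreover have "run act [] w = w" by simp
    ultimately have "run act ?u w = w"
      using run1[of ?u w] run1[of "[]" w] run2[of ?u w] run2[of "[]" w] x w by auto
    then show ?thesis by simp
  qed
  \<comment> \<open>Each relation lies within one alphabet, where a whole word acts through its
    class.\<close>
  have rel: "run act u w = run act v w" if "(u, v) \<in> R" "u \<in> words ?X" "v \<in> words ?X" "w \<in> walks Y a" for u v w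
  proof -
    have "?cl u = ?cl v" using that by (simp add: pres_class_eq_iff pres_cong.relation)
    then show ?thesis using R[OF that(1)] run1 run2 that(4) by auto
  qed
  obtain \<phi> where \<phi>: "group_action ?G (walks Y a) \<phi>"
    "\<And>u w. u \<in> words ?X \<Longrightarrow> w \<in> walks Y a \<Longrightarrow> \<phi> (?cl u) w = run act u w"
    using presented_group_action[OF act_walks inverse rel] by blast
  have run_walks: "run act u w \<in> walks Y a" if "u \<in> words ?X" "w \<in> walks Y a" for u w
    using that by (induction u) (auto intro: act_walks)
  have act_isometry: "lcp_dist (act x c w) (act x c w') = lcp_dist w w'"
    if x: "x \<in> ?X" and w: "w \<in> walks Y a" "w' \<in> walks Y a" for x c w w'
  proof -
    let ?g = "?cl [(x, c)]"
    have g: "?g \<in> carrier ?G" using x by (intro cl) simp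
    have map: "lcp_dist (map (\<psi> ?g) v) (map (\<psi> ?g) v') = lcp_dist v v'"
      if "v \<in> walks Y z" "v' \<in> walks Y z" for v v' z
      using lcp_map[OF inj_on_subset[OF \<psi>_inj[OF g]], of v v'] that by (simp add: lcp_dist_def walks_def)
    show ?thesis
    proof (cases "x \<in> X\<^sub>1")
      case True
      then show ?thesis using map[OF w] by (simp add: act_def)
    next
      case False
      have b: "rebase b w \<in> walks Y b" "rebase b w' \<in> walks Y b" 
        using rebase_walks[OF w(1) ab(2)] rebase_walks[OF w(2) ab(2)] by simp_all
      have "\<psi> ?g b = b" using fix_letter fix_b ab x False by auto
      then have "map (\<psi> ?g) (rebase b w) \<in> walks Y b" "map (\<psi> ?g) (rebase b w') \<in> walks Y b"
        using walks_map[OF g] b by auto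
      then show ?thesis
        using False lcp_dist_rebase[of _ Y b _ a] map[OF b] lcp_dist_rebase[OF w]
        by (simp add: act_def on_b_def)
    qed
  qed
  have act_last: "last (act x c w) = \<psi> (?cl [(x, c)]) (last w)" if "x \<in> ?X" "w \<in> walks Y a" for x c w
  proof -
    have ne: "w \<noteq> []" "rebase b w \<noteq> []" using that by (auto simp: walks_def rebase_def)
    then show ?thesis
      by (auto simp: act_def on_b_def last_map last_rebase)
  qed
  show ?thesis
  proof (rule that)
    interpret \<phi>: group_action ?G "walks Y a" \<phi> by fact
    interpret tree_metric "walks Y a" lcp_dist by (rule tree_metric_walks)
    show "tree_action ?G (walks Y a) \<phi> lcp_dist"
    proof
      fix g w w' assume g: "g \<in> carrier ?G" and w: "w \<in> walks Y a" "w' \<in> walks Y a"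
      obtain u where u: "u \<in> words ?X" "g = ?cl u" using g by (auto simp: carrier_presented_group)
      have "lcp_dist (run act u w) (run act u w') = lcp_dist w w'"
        using u(1) by (induction u) (use act_isometry run_walks w in auto)
      then show "lcp_dist (\<phi> g w) (\<phi> g w') = lcp_dist w w'" using \<phi>(2) u w by simp
    qed
    fix g w assume g: "g \<in> carrier ?G" and w: "w \<in> walks Y a"
    obtain u where u: "u \<in> words ?X" "g = ?cl u" using g by (auto simp: carrier_presented_group)
    have Y_last: "last w \<in> Y" using w last_in_set[of w] by (auto simp: walks_def)
    have "last (run act u w) = \<psi> (?cl u) (last w)"
      using u(1)
    proof (induction u)
      case (Cons l u)
      then show ?case
        using act_last[of "fst l" "run act u w" "snd l"] run_walks[of u w] w \<psi>_append[of "[l]" u] Y_last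
        by auto
    qed (use \<psi>_Nil Y_last in simp)
    then show "last (\<phi> g w) = \<psi> g (last w)" using \<phi>(2) u w by simp
  qed
qed


section \<open>Artin groups of incomplete graphs\<close>

lemma (in group) lcoset_fixed_iff:
  assumes P: "subgroup P G" and k: "k \<in> carrier G"
  shows "{g \<in> carrier G. g <# (k <# P) = k <# P} = conjugate G k P"
proof
  have PG: "P \<subseteq> carrier G" using subgroup.subset[OF P] .
  show "{g \<in> carrier G. g <# (k <# P) = k <# P} \<subseteq> conjugate G k P"
  proof
    fix g assume "g \<in> {g \<in> carrier G. g <# (k <# P) = k <# P}"
    then have g: "g \<in> carrier G" "(g \<otimes> k) <# P = k <# P" using k PG by (auto simp: lcos_m_assoc)
    have "g \<otimes> k \<otimes> \<one> \<in> (g \<otimes> k) <# P" using subgroup.one_closed[OF P] by (auto simp: l_coset_def)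
    then have "g \<otimes> k \<in> k <# P" using g k by simp
    then obtain p where p: "p \<in> P" "g \<otimes> k = k \<otimes> p" by (auto simp: l_coset_def)
    have pG: "p \<in> carrier G" using p PG by blast
    have "g = k \<otimes> p \<otimes> inv k"
      using inv_solve_right[of g "k \<otimes> p" k] p(2) g(1) k pG by simp
    then show "g \<in> conjugate G k P" using p(1) by (auto simp: conjugate_eq_image)
  qed
  show "conjugate G k P \<subseteq> {g \<in> carrier G. g <# (k <# P) = k <# P}"
  proof
    fix g assume "g \<in> conjugate G k P"
    then obtain p where p: "p \<in> P" "g = k \<otimes> p \<otimes> inv k" by (auto simp: conjugate_eq_image)
    have pG: "p \<in> carrier G" using p PG by blast
    have "g <# (k <# P) = (g \<otimes> k) <# P" using p pG k PG by (simp add: lcos_m_assoc)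
    also have "g \<otimes> k = k \<otimes> p" using p pG k by (simp add: m_assoc)
    also have "(k \<otimes> p) <# P = k <# (p <# P)" using pG k PG by (simp add: lcos_m_assoc)
    also have "p <# P = P" using coset_join3[OF pG P p(1)] .
    finally show "g \<in> {g \<in> carrier G. g <# (k <# P) = k <# P}" using p pG k by simp
  qed
qed

lemma alternating_in_words: "x \<in> Z \<Longrightarrow> y \<in> Z \<Longrightarrow> alternating m x y \<in> words Z"
  by (induction m arbitrary: x y) auto

locale visual_splitting = coxeter_graph \<Gamma> for \<Gamma> :: "'a pgraph" +
  fixes s t :: 'a
  assumes st: "s \<in> verts \<Gamma>" "t \<in> verts \<Gamma>" "s \<noteq> t" and no_edge: "{s, t} \<notin> edges \<Gamma>"
    and pip: "parabolic_intersection_property \<Gamma>" and nsp: "normaliser_structure_property \<Gamma>"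
    and alt_s: "power_alternative (artin_group (full_subgraph \<Gamma> (verts \<Gamma> - {s})))"
    and alt_t: "power_alternative (artin_group (full_subgraph \<Gamma> (verts \<Gamma> - {t})))"
begin

text \<open>These cosets would be the vertices of the Bass--Serre tree; here they are only the
  entries of the walks, and stabilisers are computed at the last entry.\<close>

definition cosets :: "'a word set set set" where
  "cosets = {k <#\<^bsub>A\<^esub> par S | k S. k \<in> carrier A \<and> S \<in> {V - {s}, V - {t}}}"

definition coset_action :: "'a word set \<Rightarrow> 'a word set set \<Rightarrow> 'a word set set" where
  "coset_action g = restrict (\<lambda>y. g <#\<^bsub>A\<^esub> y) cosets"

lemma cosets_subset: "y \<in> cosets \<Longrightarrow> y \<subseteq> carrier A"
proof -
  assume "y \<in> cosets"
  then obtain k S where kS: "y = k <#\<^bsub>A\<^esub> par S" "k \<in> carrier A" "S \<subseteq> V" by (auto simp: cosets_def)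
  then show ?thesis using AG.l_coset_subset_G[OF par_closed] by blast
qed

lemma group_action_cosets: "group_action A cosets coset_action"
  unfolding coset_action_def[abs_def]
proof (rule AG.group_actionI)
  fix g y assume g: "g \<in> carrier A" and "y \<in> cosets"
  then obtain k S where kS: "y = k <#\<^bsub>A\<^esub> par S" "k \<in> carrier A" "S \<in> {V - {s}, V - {t}}"
    by (auto simp: cosets_def)
  then have "g <#\<^bsub>A\<^esub> y = (g \<otimes>\<^bsub>A\<^esub> k) <#\<^bsub>A\<^esub> par S"
    using g par_closed[of S] by (auto simp: AG.lcos_m_assoc)
  then show "g <#\<^bsub>A\<^esub> y \<in> cosets" using kS g by (auto simp: cosets_def)
qed (auto simp: AG.lcos_mult_one AG.lcos_m_assoc cosets_subset)

lemma stabilizer_coset: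
  assumes "y \<in> cosets"
  obtains k S where "k \<in> carrier A" "S \<in> {V - {s}, V - {t}}"
    "stabilizer A coset_action y = conjugate A k (par S)"
proof -
  obtain k S where kS: "y = k <#\<^bsub>A\<^esub> par S" "k \<in> carrier A" "S \<in> {V - {s}, V - {t}}"
    using assms by (auto simp: cosets_def)
  then have "subgroup (par S) A" using par_subgroup[of S] by auto
  from AG.lcoset_fixed_iff[OF this kS(2)]
  have "stabilizer A coset_action y = conjugate A k (par S)"
    using assms by (simp add: stabilizer_def coset_action_def kS(1))
  with kS that show ?thesis by blast
qed

lemma parabolic_stabilizer: "y \<in> cosets \<Longrightarrow> parabolic \<Gamma> (stabilizer A coset_action y)"
  by (rule stabilizer_coset) (auto simp: parabolic_def)

lemma alternative_pair_stabilizer: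
  assumes "y \<in> cosets" "g \<in> stabilizer A coset_action y" "h \<in> stabilizer A coset_action y"
  shows "alternative_pair A g h"
proof -
  obtain k S where kS: "k \<in> carrier A" "S \<in> {V - {s}, V - {t}}"
    "stabilizer A coset_action y = conjugate A k (par S)"
    using stabilizer_coset[OF assms(1)] .
  have SV: "S \<subseteq> V" using kS(2) by auto
  interpret parabolic_chambers \<Gamma> S by unfold_locales (rule SV)
  let ?c = "\<lambda>x. k \<otimes>\<^bsub>A\<^esub> x \<otimes>\<^bsub>A\<^esub> inv\<^bsub>A\<^esub> k"
  obtain p q where pq: "p \<in> par S" "g = ?c p" "q \<in> par S" "h = ?c q"
    using assms(2,3) unfolding kS(3) AG.conjugate_eq_image by blast
  have "power_alternative (artin_group (full_subgraph \<Gamma> S))" using kS(2) alt_s alt_t by auto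
  then have "alternative_pair A p q" using alternative_pair_standard_parabolic pq by blast
  moreover have "p \<in> carrier A" "q \<in> carrier A" using pq par_closed[OF SV] by auto
  ultimately show ?thesis
    unfolding pq
    using AG.alternative_pair_hom[OF AG.is_group AG.conjugation_hom[OF kS(1)] AG.conjugation_inj[OF kS(1)]]
    by simp
qed

lemma tree_action_walks:
  obtains \<phi> where "tree_action A (walks cosets (par (V - {s}))) \<phi> lcp_dist"
    "\<And>g w. g \<in> carrier A \<Longrightarrow> w \<in> walks cosets (par (V - {s})) \<Longrightarrow>
      last (\<phi> g w) = coset_action g (last w)"
proof -
  let ?R = "artin_relations \<Gamma>"
  have un: "(V - {s}) \<union> (V - {t}) = V" using st by auto
  have A: "presented_group V ?R = A" by (simp add: artin_group_def)
  have cos: "par S \<in> cosets" if "S \<in> {V - {s}, V - {t}}" for S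
    unfolding cosets_def using that par_closed[of S]
    by (intro CollectI exI[of _ "\<one>\<^bsub>A\<^esub>"] exI[of _ S]) (auto simp: AG.lcos_mult_one)
  have fixed: "coset_action (pres_class V ?R [(x, True)]) (par S) = par S"
    if S: "S \<in> {V - {s}, V - {t}}" and x: "x \<in> S" for S x
  proof -
    have "artin_gen \<Gamma> x \<in> par S" using x by (auto simp: standard_parabolic_def intro: generate.incl)
    moreover have "artin_gen \<Gamma> x \<in> carrier A" using artin_gen_closed[of \<Gamma>] S x by auto
    ultimately have "artin_gen \<Gamma> x <#\<^bsub>A\<^esub> par S = par S"
      using AG.coset_join3 par_subgroup[of S] S by auto
    then show ?thesis using cos[OF S] by (simp add: coset_action_def artin_gen_def)
  qed
  have rel: "(u \<in> words (V - {s}) \<and> v \<in> words (V - {s})) \<or> (u \<in> words (V - {t}) \<and> v \<in> words (V - {t}))"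
    if uv: "(u, v) \<in> ?R" for u v
  proof -
    obtain m x y where xy: "u = alternating m x y" "v = alternating m y x" "label \<Gamma> {x, y} = Some m"
      using uv unfolding artin_relations_def by blast
    have V: "x \<in> V" "y \<in> V" using label_SomeD[OF xy(3)] by auto
    \<comment> \<open>The missing edge enters here: no relation involves both s and t.\<close>
    have "{x, y} \<noteq> {s, t}" using no_edge xy(3) by (auto simp: edges_def)
    then have "(x \<in> V - {s} \<and> y \<in> V - {s}) \<or> (x \<in> V - {t} \<and> y \<in> V - {t})"
      using V label_SomeD(3)[OF xy(3)] st(3) by auto
    then show ?thesis
      using alternating_in_words[of x _ y m] alternating_in_words[of y _ x m]
      unfolding xy(1,2) by (elim disjE conjE) simp_all
  qed
  show ?thesis
  proof (rule presented_amalgam_tree_action[of "V - {s}" "V - {t}" ?R cosets coset_action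
        "par (V - {s})" "par (V - {t})", unfolded un A])
    show "group_action A cosets coset_action" by (rule group_action_cosets)
    show "par (V - {s}) \<in> cosets" "par (V - {t}) \<in> cosets" using cos by auto
  qed (use fixed rel that in auto)
qed

theorem power_alternative_artin_group: "power_alternative A"
  unfolding power_alternative_iff
proof (intro ballI)
  fix g h assume gh: "g \<in> carrier A" "h \<in> carrier A"
  let ?E = "walks cosets (par (V - {s}))"
  obtain \<phi> where \<phi>: "tree_action A ?E \<phi> lcp_dist"
    "\<And>g w. g \<in> carrier A \<Longrightarrow> w \<in> ?E \<Longrightarrow> last (\<phi> g w) = coset_action g (last w)"
    using tree_action_walks by metis
  interpret \<phi>: tree_action A ?E \<phi> lcp_dist by (rule \<phi>(1))
  interpret Y: group_action A cosets coset_action by (rule group_action_cosets)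
  have last: "last w \<in> cosets" if "w \<in> ?E" for w
    using that last_in_set[of w] by (auto simp: walks_def)
  have stab: "g \<in> stabilizer A coset_action (last w)"
    if "g \<in> carrier A" "w \<in> ?E" "\<phi> g w = w" for g w
    using \<phi>(2)[OF that(1,2)] that by (simp add: stabilizer_def)
  have base: "?E \<noteq> {}"
  proof -
    have "par (V - {s}) \<in> cosets"
      unfolding cosets_def using par_closed[of "V - {s}"]
      by (intro CollectI exI[of _ "\<one>\<^bsub>A\<^esub>"] exI[of _ "V - {s}"]) (auto simp: AG.lcos_mult_one)
    then have "[par (V - {s})] \<in> ?E" by (simp add: walks_def)
    then show ?thesis by blast
  qed
  have ray: "alternative_pair A g h"
    if gh: "g \<in> carrier A" "h \<in> carrier A" and ray: "\<phi>.share_ray g h" for g h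
  proof -
    obtain \<rho> :: "nat \<Rightarrow> 'a word set set list" and l :: nat and g' h' where g': "g' \<in> {g, inv\<^bsub>A\<^esub> g}" and h': "h' \<in> {h, inv\<^bsub>A\<^esub> h}"
      and \<rho>: "range \<rho> \<subseteq> ?E" and h_\<rho>: "\<And>m. \<phi> h' (\<rho> m) = \<rho> (m + l)"
      and comm: "\<And>N. \<exists>a::nat. \<exists>b::nat. a \<ge> 1 \<and>
        (\<forall>m\<le>N. \<phi> (g' [^]\<^bsub>A\<^esub> a) (\<rho> m) = \<phi> (h' [^]\<^bsub>A\<^esub> b) (\<rho> m))"
      using ray unfolding \<phi>.share_ray_def by blast
    have G: "g' \<in> carrier A" "h' \<in> carrier A" using g' h' gh by auto
    have \<rho>E: "\<rho> m \<in> ?E" for m using \<rho> by blast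
    define y where "y m = last (\<rho> m)" for m
    have y: "y m \<in> cosets" for m using last[OF \<rho>E] by (simp add: y_def)
    \<comment> \<open>The stabilisers of the last entries are intersected, not those of the walks,
      because the former are conjugates of standard parabolic subgroups.\<close>
    define P where "P n = (\<Inter>m\<le>n. stabilizer A coset_action (y m))" for n
    have P_parabolic: "parabolic \<Gamma> (P n)" for n
    proof (induction n)
      case 0
      then show ?case using parabolic_stabilizer[OF y] by (simp add: P_def)
    next
      case (Suc n)
      have "P (Suc n) = stabilizer A coset_action (y (Suc n)) \<inter> P n" by (auto simp: P_def atMost_Suc)
      then show ?case
        using pip Suc parabolic_stabilizer[OF y] by (simp add: parabolic_intersection_property_def)
    qed
    have "P n \<subseteq> P m" if "m \<le> n" for m n using that by (auto simp: P_def)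
    then obtain N where N: "\<And>n. n \<ge> N \<Longrightarrow> P n = P N"
      using parabolic_chain_stable[of P, OF P_parabolic] by blast
    have PA: "x \<in> carrier A" if "x \<in> P N" for x
      using that by (auto simp: P_def stabilizer_def)
    have y_shift: "y (m + l) = coset_action h' (y m)" for m
      using \<phi>(2)[OF G(2) \<rho>E[of m]] h_\<rho> by (simp add: y_def)
    \<comment> \<open>Stability gives P N = P (N + l), so an element of P N also fixes the shifted
      cosets up to index N + l. Conjugating by h' moves these back to the cosets with index at most
      N.\<close>
    have "conjugate A (inv\<^bsub>A\<^esub> h') (P N) \<subseteq> P N"
    proof
      fix z assume "z \<in> conjugate A (inv\<^bsub>A\<^esub> h') (P N)"
      then obtain x where x: "x \<in> P N" "z = inv\<^bsub>A\<^esub> h' \<otimes>\<^bsub>A\<^esub> x \<otimes>\<^bsub>A\<^esub> h'"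
        using G by (auto simp: AG.conjugate_eq_image)
      have xA: "x \<in> carrier A" using PA[OF x(1)] .
      have "coset_action z (y m) = y m" if "m \<le> N" for m
      proof -
        have "x \<in> P (N + l)" using N[of "N + l"] x by simp
        then have "coset_action x (y (m + l)) = y (m + l)" using that by (auto simp: P_def stabilizer_def)
        then have "coset_action (x \<otimes>\<^bsub>A\<^esub> h') (y m) = coset_action h' (y m)"
          using Y.composition_rule[OF y xA G(2)] by (simp add: y_shift)
        then have "coset_action z (y m) = coset_action (inv\<^bsub>A\<^esub> h') (coset_action h' (y m))"
          using Y.composition_rule[OF y, of "inv\<^bsub>A\<^esub> h'" "x \<otimes>\<^bsub>A\<^esub> h'"] G xA x(2)
          by (simp add: AG.m_assoc)
        also have "\<dots> = coset_action \<one>\<^bsub>A\<^esub> (y m)"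
          using Y.composition_rule[OF y, of "inv\<^bsub>A\<^esub> h'" h'] G by simp
        also have "\<dots> = y m" using fun_cong[OF Y.id_eq_one, of "y m"] y by simp
        finally show ?thesis .
      qed
      then show "z \<in> P N" using x G xA by (auto simp: P_def stabilizer_def)
    qed
    then have "conjugate A (inv\<^bsub>A\<^esub> h') (P N) = P N"
      using parabolic_conjugate_subset_eq[OF P_parabolic] G by simp
    then have norm: "conjugate A h' (P N) = P N"
      using AG.conjugate_inv'[OF G(2), of "P N"] PA by (simp add: subsetI)
    \<comment> \<open>Agreement up to N is enough, since P N already fixes the cosets at the ends of
      all walks of the ray.\<close>
    obtain a b :: nat where ab: "a \<ge> 1" "\<And>m. m \<le> N \<Longrightarrow> \<phi> (g' [^]\<^bsub>A\<^esub> a) (\<rho> m) = \<phi> (h' [^]\<^bsub>A\<^esub> b) (\<rho> m)"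
      using comm by blast
    define p where "p = inv\<^bsub>A\<^esub> (h' [^]\<^bsub>A\<^esub> b) \<otimes>\<^bsub>A\<^esub> g' [^]\<^bsub>A\<^esub> a"
    have pA: "p \<in> carrier A" using G by (simp add: p_def)
    have "p \<in> stabilizer A coset_action (y m)" if "m \<le> N" for m
    proof -
      have "\<phi> p (\<rho> m) = \<rho> m"
        using ab(2)[OF that] G \<rho>E by (simp add: p_def \<phi>.act_mult)
      then show ?thesis using stab[OF pA \<rho>E] by (simp add: y_def)
    qed
    then have p: "p \<in> P N" by (simp add: P_def)
    have gp: "g' [^]\<^bsub>A\<^esub> a = h' [^]\<^bsub>A\<^esub> b \<otimes>\<^bsub>A\<^esub> p"
      using G by (simp add: p_def AG.m_assoc[symmetric])
    have pairs: "alternative_pair A x x'" if "x \<in> P N" "x' \<in> P N" for x x'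
      using alternative_pair_stabilizer[OF y[of 0]] that by (auto simp: P_def)
    obtain u q k where uqk: "u \<in> P N" "q \<in> carrier A" "h' = u \<otimes>\<^bsub>A\<^esub> q"
      "\<And>y. y \<in> P N \<Longrightarrow> q \<otimes>\<^bsub>A\<^esub> y \<otimes>\<^bsub>A\<^esub> inv\<^bsub>A\<^esub> q \<in> P N"
      "(k::nat) \<ge> 1" "\<And>y. y \<in> P N \<Longrightarrow> q [^]\<^bsub>A\<^esub> k \<otimes>\<^bsub>A\<^esub> y = y \<otimes>\<^bsub>A\<^esub> q [^]\<^bsub>A\<^esub> k"
      using normaliser_decomposition[OF nsp P_parabolic G(2) norm] by blast
    have "alternative_pair A g' h'"
      by (rule AG.alternative_pair_over_normal[OF parabolic_subgroup[OF P_parabolic] pairs uqk(2) uqk(4)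
            uqk(5,6,1,3) G(1) ab(1) p gp])
    then have "alternative_pair A g h'"
      using g' AG.alternative_pair_inv[OF gh(1) G(2)] by auto
    then show ?thesis
      using h' AG.alternative_pair_inv[OF gh(2,1)] alternative_pair_sym[of A g h'] alternative_pair_sym[of A h g]
      by auto
  qed
  show "alternative_pair A g h"
  proof (rule \<phi>.alternative_or_elliptic_or_share_ray[OF gh base])
    fix n :: nat and w assume n: "n \<ge> 1" and w: "w \<in> ?E"
      and fixed: "\<phi> (g [^]\<^bsub>A\<^esub> n) w = w" "\<phi> (h [^]\<^bsub>A\<^esub> n) w = w"
    then have "alternative_pair A (g [^]\<^bsub>A\<^esub> n) (h [^]\<^bsub>A\<^esub> n)"
      using alternative_pair_stabilizer[OF last[OF w]] stab[OF _ w] gh by simp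
    then show ?thesis using AG.alternative_pair_powers[OF gh n] by blast
  next
    assume "\<phi>.share_ray h g"
    from ray[OF gh(2,1) this] show ?thesis by (rule alternative_pair_sym)
  qed (use ray[OF gh] in auto)
qed

end

section \<open>Induction on the number of vertices\<close>

theorem corollary4p22:
  fixes \<C> :: "'a pgraph set"
  assumes "\<forall>\<Gamma>\<in>\<C>. presentation_graph \<Gamma>"
    and "closed_under_standard_parabolics \<C>"
    and "closed_under_parabolic_amalgams \<C>"
    and "\<forall>\<Gamma>\<in>\<C>. parabolic_intersection_property \<Gamma>"
    and "\<forall>\<Gamma>\<in>\<C>. normaliser_structure_property \<Gamma>"
    and "\<forall>\<Gamma>\<in>\<C>. free_of_infinity \<Gamma> \<longrightarrow> power_alternative (artin_group \<Gamma>)"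
  shows "\<forall>\<Gamma>\<in>\<C>. power_alternative (artin_group \<Gamma>)"
proof
  fix \<Gamma> assume "\<Gamma> \<in> \<C>"
  then show "power_alternative (artin_group \<Gamma>)"
  proof (induction "card (verts \<Gamma>)" arbitrary: \<Gamma> rule: less_induct)
    case less
    show ?case
    proof (cases "free_of_infinity \<Gamma>")
      case True
      then show ?thesis using assms(6) less.prems by blast
    next
      case False
      then obtain s t where st: "s \<in> verts \<Gamma>" "t \<in> verts \<Gamma>" "s \<noteq> t" "{s, t} \<notin> edges \<Gamma>"
        by (auto simp: free_of_infinity_def)
      have fin: "finite (verts \<Gamma>)"
        using assms(1) less.prems by (simp add: presentation_graph_def)
      have "power_alternative (artin_group (full_subgraph \<Gamma> (verts \<Gamma> - {x})))" if "x \<in> verts \<Gamma>" for x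
      proof (rule less.hyps)
        show "card (verts (full_subgraph \<Gamma> (verts \<Gamma> - {x}))) < card (verts \<Gamma>)"
          using card_Diff1_less[OF fin that] by simp
        show "full_subgraph \<Gamma> (verts \<Gamma> - {x}) \<in> \<C>"
          using assms(2) less.prems by (simp add: closed_under_standard_parabolics_def)
      qed
      then interpret visual_splitting \<Gamma> s t
        using assms(1,4,5) less.prems st by unfold_locales auto
      show ?thesis by (rule power_alternative_artin_group)
    qed
  qed
qed

end
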